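(* Let $N,p\in\mathbb N$ and $C>0$ be fixed, let measurements $\tilde{\mathbf u}_{meas}(P_j)\in\mathbb R^3$, $j=1,\dots,N$, be given, and suppose that, for $m\in B$ and $\mathbf g\in\mathcal F_p$, $$\rho(m,\mathbf g|\tilde{\mathbf u}_{meas})\propto\rho(\tilde{\mathbf u}_{meas}|m,\mathbf g)\,\rho_{\mathcal F_p}(\mathbf g)\,\rho_{prior}(m),$$ where $$\rho(\tilde{\mathbf u}_{meas}|m,\mathbf g)\propto\exp\Big(-\tfrac12\sum_{j=1}^NC'(j,N)|\mathcal C^{-1/2}(A_m\mathbf g-\tilde{\mathbf u}_{meas})(P_j)|^2\Big),\qquad\rho_{\mathcal F_p}(\mathbf g)\propto\exp\Big(-\tfrac12C\int_R|\nabla\mathbf g|^2\Big).$$ Then integrating the right-hand side over $\mathbf g\in\mathcal F_p$ gives $$\rho(m|\tilde{\mathbf u}_{meas})\propto\exp\Big(-\tfrac12F^{disc}_{m,C}(\mathbf h^{disc}_{m,C})\Big)\,\frac{\rho_{prior}(m)}{\sqrt{\det\big((2\pi)^{-1}(A_m'\mathcal D^2A_m+C I_q)\big)}},$$ where $\propto$ means equality up to a positive multiplicative constant independent of $m$ (and of $\mathbf g$).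
   Context: Elasticity problem. $\mathbb R^{3-}=\{x_3<0\}\subset\mathbb R^3$; $\lambda,\mu>0$ are constants. For a displacement field $\mathbf u$, $\sigma_{ij}(\mathbf u)=\lambda\,\mathrm{div}\,\mathbf u\,\delta_{ij}+\mu(\partial_iu_j+\partial_ju_i)$ and $T_{\mathbf n}\mathbf u=\sigma(\mathbf u)\mathbf n$. For a Lipschitz open surface $\Gamma$ strictly included in $\mathbb R^{3-}$ and a tangential field $\mathbf g$ on $\Gamma$ in $\tilde H^{1/2}(\Gamma)^2$ (restrictions to $\Gamma$ of tangential $H^{1/2}$ fields, supported in $\Gamma$, on a closed Lipschitz surface containing $\Gamma$), consider the problem: $\mu\Delta\mathbf u+(\lambda+\mu)\nabla\mathrm{div}\,\mathbf u=0$ in $\mathbb R^{3-}\setminus\overline\Gamma$; $T_{\mathbf e_3}\mathbf u=0$ on $x_3=0$, where $\mathbf e_3=(0,0,1)$; $T_{\mathbf n}\mathbf u$ is continuous across $\Gamma$; the jump $[\mathbf u]$ of $\mathbf u$ across $\Gamma$ equals $\mathbf g$. It is known to have a unique solution in the space $\mathcal V$ of fields with $\nabla\mathbf u$ and $\mathbf u/(1+|\mathbf x|^2)^{1/2}$ in $L^2(\mathbb R^{3-}\setminus\overline\Gamma)$; this solution can be written $\mathbf u(\mathbf x)=\int_\Gamma\mathbf H(\mathbf x,\mathbf y)\mathbf g(\mathbf y)\,d\sigma(\mathbf y)$ with $\mathbf H$ the corresponding half-space Green's tensor. Geometry. $R$ is a closed (non-degenerate) rectangle in the plane $x_3=0$.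 $B$ is a closed and bounded subset of $\mathbb R^3$ such that for every $m=(a,b,d)\in B$ the set $\Gamma_m=\{(x_1,x_2,ax_1+bx_2+d):(x_1,x_2)\in R\}$ is included in $\{x_3<0\}$. $V$ is a bounded open subset of the plane $x_3=0$. The prior of $m$ is $\rho_{prior}(m)\propto1_B(m)$. Slip-to-displacement operator. Elements $\mathbf g$ of $H^1_0(R)$ are two-component fields on $R$ vanishing on the boundary of $R$; $\mathbf g=(g_1,g_2)$ represents the tangential field $g_1(1,0,a)+g_2(0,1,b)$ on $\Gamma_m$ via the parametrization $(y_1,y_2)\mapsto(y_1,y_2,ay_1+by_2+d)$. For $m\in B$, $(A_m\mathbf g)(\mathbf x)=\int_R\mathbf H_m(\mathbf x,y_1,y_2)\mathbf g(y_1,y_2)\,\sigma\,dy_1dy_2$, where $\sigma=\sqrt{1+a^2+b^2}$ is the surface element and $\mathbf H_m$ is $\mathbf H$ for $\mathbf y$ on $\Gamma_m$; i.e. $A_m\mathbf g$ is the restriction to the surface $x_3=0$ of the unique solution $\mathbf u\in\mathcal V$ (with $\Gamma=\Gamma_m$) of: $\mu\Delta\mathbf u+(\lambda+\mu)\nabla\mathrm{div}\,\mathbf u=0$ in $\mathbb R^{3-}\setminus\Gamma_m$, $T_{\mathbf e_3}\mathbf u=0$ on $x_3=0$, $T_{\mathbf n}\mathbf u$ continuous across $\Gamma_m$, and jump $[\mathbf u]$ across $\Gamma_m$ equal to the tangential field represented by $\mathbf g$. It is smooth on $\overline V$, hence can be evaluated pointwise. $H^1_0(R)$ carries the inner product associated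 with the norm $(\int_R|\nabla\mathbf g|^2)^{1/2}$. Discrete objects. $\mathcal F_p$ is a finite-dimensional subspace of $H^1_0(R)$, $q=\dim\mathcal F_p$; integration over $\mathcal F_p$ is with respect to Lebesgue measure. $P_1,\dots,P_N\in\overline V$; $C'(j,N)>0$; $\mathcal C(\mathbf x)$ is a diagonal positive definite $3\times3$ matrix for $\mathbf x\in\overline V$, smooth in $\mathbf x$. For $\mathbf g\in\mathcal F_p$, $$F^{disc}_{m,C}(\mathbf g)=\sum_{j=1}^NC'(j,N)\,|\mathcal C^{-1/2}(A_m\mathbf g-\tilde{\mathbf u}_{meas})(P_j)|^2+C\int_R|\nabla\mathbf g|^2,$$ and $\mathbf h^{disc}_{m,C}$ is its unique minimizer in $\mathcal F_p$. In the determinant, $A_m$ denotes the restricted operator $\mathcal F_p\to\mathbb R^{3N}$, $\mathbf g\mapsto(A_m\mathbf g(P_1),\dots,A_m\mathbf g(P_N))$; $A_m'$ is its adjoint for the $H^1_0(R)$ inner product on $\mathcal F_p$ and the Euclidean one on $\mathbb R^{3N}$; $I_q$ is the identity of $\mathcal F_p$; $\mathcal D$ is the $3N\times3N$ diagonal matrix with $3\times 3$ diagonal blocks $C'(j,N)^{1/2}\mathcal C(P_j)^{-1/2}$. *)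

theory Defs
  imports "Jordan_Normal_Form.Determinant" "HOL-Analysis.Analysis"
begin

(* "$" is reserved for the components of vectors of type "real ^ 'n". *)
no_notation Matrix.vec_index (infixl "$" 100)


section \<open>Smoothness and differential operators\<close>

text \<open>\<open>Ck_on k f S\<close>: \<open>f\<close> is of class \<open>C\<^sup>k\<close> on the open set \<open>S\<close>.\<close>

primrec Ck_on :: "nat \<Rightarrow> ('a::euclidean_space \<Rightarrow> 'b::real_normed_vector) \<Rightarrow> 'a set \<Rightarrow> bool" where
  "Ck_on 0 f S \<longleftrightarrow> continuous_on S f"
| "Ck_on (Suc k) f S \<longleftrightarrow>
     f differentiable_on S \<and> (\<forall>v\<in>Basis. Ck_on k (\<lambda>x. frechet_derivative f (at x) v) S)"

text \<open>Smoothness on a set that need not be open: restriction of a smooth function on the whole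
  space.\<close>

definition smooth_on_set :: "('a::euclidean_space \<Rightarrow> 'b::real_normed_vector) \<Rightarrow> 'a set \<Rightarrow> bool" where
  "smooth_on_set f S \<longleftrightarrow> (\<exists>G. (\<forall>k. Ck_on k G UNIV) \<and> (\<forall>x\<in>S. G x = f x))"

definition test_field :: "'a::euclidean_space set \<Rightarrow> ('a \<Rightarrow> 'b::real_normed_vector) \<Rightarrow> bool" where
  "test_field U \<phi> \<longleftrightarrow>
     (\<forall>k. Ck_on k \<phi> UNIV) \<and> compact (closure {x. \<phi> x \<noteq> 0}) \<and> closure {x. \<phi> x \<noteq> 0} \<subseteq> U"

definition pderivative :: "'n \<Rightarrow> (real ^ 'n \<Rightarrow> 'b::real_normed_vector) \<Rightarrow> real ^ 'n \<Rightarrow> 'b" where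
  "pderivative i f x = frechet_derivative f (at x) (axis i 1)"

definition divergence :: "(real ^ 'n \<Rightarrow> real ^ 'n) \<Rightarrow> real ^ 'n \<Rightarrow> real" where
  "divergence u x = (\<Sum>i\<in>UNIV. pderivative i u x $ i)"

definition gradient :: "(real ^ 'n \<Rightarrow> real) \<Rightarrow> real ^ 'n \<Rightarrow> real ^ 'n" where
  "gradient f x = (\<chi> i. pderivative i f x)"

definition laplacian :: "(real ^ 'n \<Rightarrow> real ^ 'n) \<Rightarrow> real ^ 'n \<Rightarrow> real ^ 'n" where
  "laplacian u x = (\<Sum>i\<in>UNIV. pderivative i (pderivative i u) x)"

definition stress :: "real \<Rightarrow> real \<Rightarrow> (real ^ 3 \<Rightarrow> real ^ 3) \<Rightarrow> real ^ 3 \<Rightarrow> real ^ 3 ^ 3" where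
  "stress lam mu u x = (\<chi> i j. lam * divergence u x * (if i = j then 1 else 0)
                          + mu * (pderivative i u x $ j + pderivative j u x $ i))"

definition traction ::
  "real \<Rightarrow> real \<Rightarrow> real ^ 3 \<Rightarrow> (real ^ 3 \<Rightarrow> real ^ 3) \<Rightarrow> real ^ 3 \<Rightarrow> real ^ 3" where
  "traction lam mu n u x = stress lam mu u x *v n"


section \<open>The space \<open>H\<^sup>1\<^sub>0(R)\<close>\<close>

text \<open>Measurable planar vector fields modulo equality almost everywhere.  Fields on \<open>R\<close> that vanish
  on the boundary of \<open>R\<close> are extended by zero to the whole plane.\<close>

quotient_type plane_field = "real ^ 2 \<Rightarrow> real ^ 2" / partial:
  "\<lambda>f g. f \<in> borel_measurable borel \<and> g \<in> borel_measurable borel \<and> (AE x in lborel. f x = g x)"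
  morphisms rep_field abs_field
proof (rule part_equivpI)
  show "\<exists>f :: real ^ 2 \<Rightarrow> real ^ 2. f \<in> borel_measurable borel \<and> f \<in> borel_measurable borel \<and>
          (AE x in lborel. f x = f x)"
    by (rule exI[of _ "\<lambda>_. 0"]) simp
qed (auto intro!: sympI transpI elim: AE_mp)

instantiation plane_field :: real_vector
begin

lift_definition zero_plane_field :: plane_field is "\<lambda>_. 0" by simp

lift_definition plus_plane_field :: "plane_field \<Rightarrow> plane_field \<Rightarrow> plane_field"
  is "\<lambda>f g x. f x + g x" by (auto elim!: AE_mp)

lift_definition minus_plane_field :: "plane_field \<Rightarrow> plane_field \<Rightarrow> plane_field"
  is "\<lambda>f g x. f x - g x" by (auto elim!: AE_mp)

lift_definition uminus_plane_field :: "plane_field \<Rightarrow> plane_field"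
  is "\<lambda>f x. - f x" by auto

lift_definition scaleR_plane_field :: "real \<Rightarrow> plane_field \<Rightarrow> plane_field"
  is "\<lambda>c f x. c *\<^sub>R f x" by (auto elim!: AE_mp)

instance
  by standard (transfer; auto simp: algebra_simps)+

end

text \<open>\<open>H\<^sup>1\<^sub>0(R)\<close> is the closure, for the \<open>H\<^sup>1\<close> norm, of the smooth fields with compact support in the
  interior of \<open>R\<close>; \<open>H10_limit R g G\<close> says that \<open>g\<close> is in this closure and that its gradient is
  \<open>G\<close> (as an \<open>L\<^sup>2\<close> limit, which determines \<open>G\<close> almost everywhere).  Norms of matrices of type
  \<open>real ^ 2 ^ 2\<close> are Frobenius norms.\<close>

definition H10_limit :: "(real ^ 2) set \<Rightarrow> plane_field \<Rightarrow> (real ^ 2 \<Rightarrow> real ^ 2 ^ 2) \<Rightarrow> bool" where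
  "H10_limit R g G \<longleftrightarrow> G \<in> borel_measurable borel \<and>
     (\<exists>\<phi> :: nat \<Rightarrow> real ^ 2 \<Rightarrow> real ^ 2. (\<forall>k. test_field (interior R) (\<phi> k)) \<and>
        (\<lambda>k. \<integral>\<^sup>+ x. ennreal ((norm (\<phi> k x - rep_field g x))\<^sup>2) \<partial>lborel) \<longlonglongrightarrow> 0 \<and>
        (\<lambda>k. \<integral>\<^sup>+ x. ennreal ((norm (jacobian (\<phi> k) (at x) - G x))\<^sup>2) \<partial>lborel) \<longlonglongrightarrow> 0)"

definition H10 :: "(real ^ 2) set \<Rightarrow> plane_field set" where
  "H10 R = {g. \<exists>G. H10_limit R g G}"

definition field_gradient :: "(real ^ 2) set \<Rightarrow> plane_field \<Rightarrow> real ^ 2 \<Rightarrow> real ^ 2 ^ 2" where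
  "field_gradient R g = (SOME G. H10_limit R g G)"

definition H10_inner :: "(real ^ 2) set \<Rightarrow> plane_field \<Rightarrow> plane_field \<Rightarrow> real" where
  "H10_inner R g h = (LINT x:R|lborel. field_gradient R g x \<bullet> field_gradient R h x)"

definition H10_energy :: "(real ^ 2) set \<Rightarrow> plane_field \<Rightarrow> real" where
  "H10_energy R g = (LINT x:R|lborel. (norm (field_gradient R g x))\<^sup>2)"


section \<open>Finite-dimensional subspaces: Lebesgue measure, determinant, adjoint\<close>

definition subspace_basis :: "'a::real_vector set \<Rightarrow> nat \<Rightarrow> 'a" where
  "subspace_basis F = (SOME b. inj_on b {..<dim F} \<and> independent (b ` {..<dim F}) \<and>
                               span (b ` {..<dim F}) = F)"

text \<open>Lebesgue measure in the coordinates of some basis of \<open>F\<close>; another basis changes it by a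
  positive constant factor.\<close>

definition lebesgue_on_subspace :: "'a::real_vector set \<Rightarrow> 'a measure" where
  "lebesgue_on_subspace F =
     embed_measure (\<Pi>\<^sub>M i\<in>{..<dim F}. (lborel :: real measure))
       (\<lambda>c. \<Sum>i<dim F. c i *\<^sub>R subspace_basis F i)"

text \<open>Determinant of the linear operator \<open>T : F \<rightarrow> F\<close>, via its matrix in some basis.\<close>

definition operator_det :: "'a::real_vector set \<Rightarrow> ('a \<Rightarrow> 'a) \<Rightarrow> real" where
  "operator_det F T =
     Determinant.det (Matrix.mat (dim F) (dim F) (\<lambda>(i, j).
       representation (subspace_basis F ` {..<dim F}) (T (subspace_basis F j)) (subspace_basis F i)))"

text \<open>Adjoint of \<open>A : F \<rightarrow> 'b\<close>, where \<open>F\<close> carries the inner product \<open>ip\<close>.\<close>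

definition adjoint_on ::
  "'a set \<Rightarrow> ('a \<Rightarrow> 'a \<Rightarrow> real) \<Rightarrow> ('a \<Rightarrow> 'b::real_inner) \<Rightarrow> 'b \<Rightarrow> 'a" where
  "adjoint_on F ip A v = (THE g. g \<in> F \<and> (\<forall>f\<in>F. ip f g = A f \<bullet> v))"


section \<open>The fault and the slip-to-displacement operator\<close>

definition closed_rectangle :: "(real ^ 2) set \<Rightarrow> bool" where
  "closed_rectangle R \<longleftrightarrow> (\<exists>p v w. v \<noteq> 0 \<and> w \<noteq> 0 \<and> v \<bullet> w = 0 \<and>
     R = {p + s *\<^sub>R v + t *\<^sub>R w |s t. s \<in> {0..1} \<and> t \<in> {0..1}})"

text \<open>The geometry parameter \<open>m = (a, b, d)\<close> is the vector with components \<open>m $ 1\<close>, \<open>m $ 2\<close>,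
  \<open>m $ 3\<close>.\<close>

definition fault_point :: "real ^ 3 \<Rightarrow> real ^ 2 \<Rightarrow> real ^ 3" where
  "fault_point m y = vector [y $ 1, y $ 2, m $ 1 * y $ 1 + m $ 2 * y $ 2 + m $ 3]"

definition fault :: "real ^ 3 \<Rightarrow> (real ^ 2) set \<Rightarrow> (real ^ 3) set" where
  "fault m R = fault_point m ` R"

definition fault_normal :: "real ^ 3 \<Rightarrow> real ^ 3" where
  "fault_normal m = (1 / sqrt (1 + (m $ 1)\<^sup>2 + (m $ 2)\<^sup>2)) *\<^sub>R vector [- m $ 1, - m $ 2, 1]"

definition tangential_field :: "real ^ 3 \<Rightarrow> real ^ 2 \<Rightarrow> real ^ 3" where
  "tangential_field m w = w $ 1 *\<^sub>R vector [1, 0, m $ 1] + w $ 2 *\<^sub>R vector [0, 1, m $ 2]"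

definition lower_halfspace :: "(real ^ 3) set" where
  "lower_halfspace = {x. x $ 3 < 0}"

definition surface_plane :: "(real ^ 3) set" where
  "surface_plane = {x. x $ 3 = 0}"

definition energy_space :: "(real ^ 3) set \<Rightarrow> (real ^ 3 \<Rightarrow> real ^ 3) set" where
  "energy_space \<Omega> = {u. set_integrable lborel \<Omega> (\<lambda>x. (norm (jacobian u (at x)))\<^sup>2) \<and>
                         set_integrable lborel \<Omega> (\<lambda>x. (norm (u x /\<^sub>R sqrt (1 + (norm x)\<^sup>2)))\<^sup>2)}"

text \<open>\<open>dislocation_solution lam mu R m g u\<close>: \<open>u\<close> solves the elasticity problem in the lower half-space cut
  along the fault, with slip \<open>g\<close>.  By elliptic regularity solutions are classical inside the
  domain and smooth up to the plane \<open>x\<^sub>3 = 0\<close>, so that the equation and the condition on that plane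
  are stated pointwise.  Since \<open>g\<close> is only of class \<open>H\<^sup>1\<^sub>0\<close>, the two conditions across the fault are
  stated for the traces of \<open>u\<close> (limits in \<open>L\<^sup>2\<close>) and of the traction (limits in the sense of
  distributions on the relative interior of the fault) along the normal.  The jump is the value on the
  side of the upward normal minus the value on the other side.  Outside its domain
  \<open>u\<close> is set to zero, so that it is determined as a total function.\<close>

definition dislocation_solution ::
  "real \<Rightarrow> real \<Rightarrow> (real ^ 2) set \<Rightarrow> real ^ 3 \<Rightarrow> plane_field \<Rightarrow> (real ^ 3 \<Rightarrow> real ^ 3) \<Rightarrow> bool" where
  "dislocation_solution lam mu R m g u \<longleftrightarrow>
     (let \<Omega> = lower_halfspace - fault m R; n = fault_normal m in
       u \<in> energy_space \<Omega> \<and> Ck_on 2 u \<Omega> \<and> continuous_on (\<Omega> \<union> surface_plane) u \<and>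
       (\<forall>x. x \<notin> \<Omega> \<union> surface_plane \<longrightarrow> u x = 0) \<and>
       (\<forall>x\<in>\<Omega>. mu *\<^sub>R laplacian u x + (lam + mu) *\<^sub>R gradient (divergence u) x = 0) \<and>
       (\<forall>x\<in>surface_plane. (traction lam mu (vector [0, 0, 1]) u \<longlongrightarrow> 0) (at x within lower_halfspace)) \<and>
       (\<forall>\<phi> :: real ^ 2 \<Rightarrow> real ^ 3. test_field (interior R) \<phi> \<longrightarrow>
          ((\<lambda>t. LINT y:R|lborel. (traction lam mu n u (fault_point m y + t *\<^sub>R n)
                                 - traction lam mu n u (fault_point m y - t *\<^sub>R n)) \<bullet> \<phi> y)
             \<longlongrightarrow> 0) (at_right 0)) \<and>
       ((\<lambda>t. \<integral>\<^sup>+ y\<in>R. ennreal ((norm (u (fault_point m y + t *\<^sub>R n) - u (fault_point m y - t *\<^sub>R n)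
                                     - tangential_field m (rep_field g y)))\<^sup>2) \<partial>lborel)
          \<longlongrightarrow> 0) (at_right 0))"

text \<open>The operator \<open>A\<^sub>m\<close>: restriction of the solution to the plane \<open>x\<^sub>3 = 0\<close>.\<close>

definition slip_to_displacement ::
  "real \<Rightarrow> real \<Rightarrow> (real ^ 2) set \<Rightarrow> real ^ 3 \<Rightarrow> plane_field \<Rightarrow> real ^ 3 \<Rightarrow> real ^ 3" where
  "slip_to_displacement lam mu R m g = restrict (THE u. dislocation_solution lam mu R m g u) surface_plane"


section \<open>The discrete functional and the densities\<close>

definition diagonal_pos_def :: "real ^ 'n ^ 'n \<Rightarrow> bool" where
  "diagonal_pos_def M \<longleftrightarrow>
     (\<forall>i j. i \<noteq> j \<longrightarrow> M $ i $ j = 0) \<and> (\<forall>x. x \<noteq> 0 \<longrightarrow> 0 < x \<bullet> (M *v x))"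

definition diagonal_inv_sqrt :: "real ^ 'n ^ 'n \<Rightarrow> real ^ 'n ^ 'n" where
  "diagonal_inv_sqrt M = (\<chi> i j. if i = j then 1 / sqrt (M $ i $ i) else 0)"

text \<open>In what follows \<open>A\<close> is the operator \<open>g \<mapsto> A\<^sub>m g\<close> for one geometry \<open>m\<close>, \<open>P\<close> the measurement
  points, \<open>w j\<close> the weight \<open>C'(j, N)\<close>, \<open>Cov\<close> the matrix field \<open>\<C>\<close>, and \<open>\<real>\<^sup>3\<^sup>N\<close> is
  \<open>real ^ ('N \<times> 3)\<close>.\<close>

definition weighted_misfit ::
  "(plane_field \<Rightarrow> real ^ 3 \<Rightarrow> real ^ 3) \<Rightarrow> ('N::finite \<Rightarrow> real ^ 3) \<Rightarrow> ('N \<Rightarrow> real) \<Rightarrow>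
   (real ^ 3 \<Rightarrow> real ^ 3 ^ 3) \<Rightarrow> (real ^ 3 \<Rightarrow> real ^ 3) \<Rightarrow> plane_field \<Rightarrow> real" where
  "weighted_misfit A P w Cov u_meas g =
     (\<Sum>j\<in>UNIV. w j * (norm (diagonal_inv_sqrt (Cov (P j)) *v (A g (P j) - u_meas (P j))))\<^sup>2)"

definition F_disc ::
  "(real ^ 2) set \<Rightarrow> (plane_field \<Rightarrow> real ^ 3 \<Rightarrow> real ^ 3) \<Rightarrow> ('N::finite \<Rightarrow> real ^ 3) \<Rightarrow> ('N \<Rightarrow> real) \<Rightarrow>
   (real ^ 3 \<Rightarrow> real ^ 3 ^ 3) \<Rightarrow> (real ^ 3 \<Rightarrow> real ^ 3) \<Rightarrow> real \<Rightarrow> plane_field \<Rightarrow> real" where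
  "F_disc R A P w Cov u_meas C g = weighted_misfit A P w Cov u_meas g + C * H10_energy R g"

definition h_disc ::
  "(real ^ 2) set \<Rightarrow> plane_field set \<Rightarrow> (plane_field \<Rightarrow> real ^ 3 \<Rightarrow> real ^ 3) \<Rightarrow> ('N::finite \<Rightarrow> real ^ 3) \<Rightarrow>
   ('N \<Rightarrow> real) \<Rightarrow> (real ^ 3 \<Rightarrow> real ^ 3 ^ 3) \<Rightarrow> (real ^ 3 \<Rightarrow> real ^ 3) \<Rightarrow> real \<Rightarrow> plane_field" where
  "h_disc R F A P w Cov u_meas C = arg_min_on (F_disc R A P w Cov u_meas C) F"

definition point_values ::
  "(plane_field \<Rightarrow> real ^ 3 \<Rightarrow> real ^ 3) \<Rightarrow> ('N::finite \<Rightarrow> real ^ 3) \<Rightarrow> plane_field \<Rightarrow> real ^ ('N \<times> 3)" where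
  "point_values A P g = (\<chi> k. A g (P (fst k)) $ snd k)"

definition weight_matrix ::
  "('N::finite \<Rightarrow> real ^ 3) \<Rightarrow> ('N \<Rightarrow> real) \<Rightarrow> (real ^ 3 \<Rightarrow> real ^ 3 ^ 3) \<Rightarrow>
   real ^ ('N \<times> 3) ^ ('N \<times> 3)" where
  "weight_matrix P w Cov =
     (\<chi> k l. if fst k = fst l
             then sqrt (w (fst k)) * diagonal_inv_sqrt (Cov (P (fst k))) $ snd k $ snd l else 0)"

text \<open>The operator \<open>(2\<pi>)\<^sup>-\<^sup>1 (A' \<D>\<^sup>2 A + C I)\<close> on \<open>F\<close>.\<close>

definition posterior_operator ::
  "(real ^ 2) set \<Rightarrow> plane_field set \<Rightarrow> (plane_field \<Rightarrow> real ^ 3 \<Rightarrow> real ^ 3) \<Rightarrow> ('N::finite \<Rightarrow> real ^ 3) \<Rightarrow>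
   ('N \<Rightarrow> real) \<Rightarrow> (real ^ 3 \<Rightarrow> real ^ 3 ^ 3) \<Rightarrow> real \<Rightarrow> plane_field \<Rightarrow> plane_field" where
  "posterior_operator R F A P w Cov C g =
     (let D = weight_matrix P w Cov;
          A' = adjoint_on F (H10_inner R) (point_values A P)
      in (1 / (2 * pi)) *\<^sub>R (A' ((D ** D) *v point_values A P g) + C *\<^sub>R g))"

definition proportional_on :: "'a set \<Rightarrow> ('a \<Rightarrow> real) \<Rightarrow> ('a \<Rightarrow> real) \<Rightarrow> bool" where
  "proportional_on S f g \<longleftrightarrow> (\<exists>\<kappa>>0. \<forall>x\<in>S. f x = \<kappa> * g x)"

end

theory Submission
  imports Defs "HOL-Probability.Distributions"
begin

text \<open>For fixed \<open>m\<close> the exponent is a quadratic polynomial on \<open>F\<close> whose leading part is the bilinear form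
  \<open>2\<pi> \<langle>f, T g\<rangle>\<close>, where \<open>T = (2\<pi>)\<^sup>-\<^sup>1 (A' \<D>\<^sup>2 A + C I)\<close> and \<open>\<langle>\<cdot>, \<cdot>\<rangle>\<close> is the inner product of
  \<open>H\<^sup>1\<^sub>0(R)\<close>.  Completing the square around its minimizer leaves a centred Gaussian integral, which
  equals \<open>(det G det T)\<^sup>-\<^sup>1\<^sup>/\<^sup>2\<close> with \<open>G\<close> the Gram matrix of the chosen basis of \<open>F\<close>; as \<open>G\<close> does not depend
  on \<open>m\<close>, it goes into the constant.  Two inputs are analytic.  The form \<open>\<langle>\<cdot>, \<cdot>\<rangle>\<close> is well defined and
  positive definite, by closability of the gradient and Poincare's inequality.  The operator
  \<open>A\<^sub>m\<close> is linear, because a superposition of dislocation solutions is a dislocation solution and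
  solutions are unique.\<close>

text \<open>The factor \<open>(2 pi)^(-1)\<close> in T absorbs the Gaussian constant: in the chosen
  basis the form has matrix \<open>2 pi\<close> times the Gram matrix times the matrix of T, so its
  determinant carries a factor \<open>(2 pi)^n\<close>, the very power in the numerator of the
  Gaussian integral. The Gram determinant survives because the Lebesgue measure on F is normalized
  by that basis and not by the inner product. What shapes the rest is that the weak gradient, the
  displacement and the minimizer are all picked by choice or definite description, so nothing about
  them is linear at sight. For the gradient, uniqueness up to null sets has to be proved. For the
  displacement, uniqueness is a hypothesis and the work lies in the trace conditions: their
  integrals can be split only when the offset surfaces avoid the fault, that is for small offsets.
  For the minimizer, only the minimal value matters. The term with \<open>C > 0\<close> keeps the
  form definite even if the operator has a kernel on F.\<close>

section \<open>Gaussian integrals\<close>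

text \<open>Up to its normalizing constant the integrand is a normal density with mean
  \<open>a - \<beta> / \<alpha>\<close> and standard deviation \<open>1 / sqrt \<alpha>\<close>. The
  shift has the form that completing the square in the last variable of a form centred at
  \<open>a\<close> produces.\<close>

lemma nn_integral_gaussian_quadratic:
  fixes \<alpha> a \<beta> :: real
  assumes "\<alpha> > 0"
  shows "(\<integral>\<^sup>+ t. ennreal (exp (- (1/2) * (\<alpha> * (t - a + \<beta> / \<alpha>)\<^sup>2))) \<partial>lborel) = ennreal (sqrt (2 * pi / \<alpha>))"
proof -
  have "exp (- (1/2) * (\<alpha> * (t - a + \<beta> / \<alpha>)\<^sup>2))
      = sqrt (2 * pi / \<alpha>) * normal_density (a - \<beta> / \<alpha>) (1 / sqrt \<alpha>) t" for t
    using assms by (simp add: normal_density_def power_divide field_simps real_sqrt_divide)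
  then have "(\<integral>\<^sup>+ t. ennreal (exp (- (1/2) * (\<alpha> * (t - a + \<beta> / \<alpha>)\<^sup>2))) \<partial>lborel)
      = (\<integral>\<^sup>+ t. ennreal (sqrt (2 * pi / \<alpha>)) * ennreal (normal_density (a - \<beta> / \<alpha>) (1 / sqrt \<alpha>) t) \<partial>lborel)"
    using assms by (simp add: ennreal_mult)
  also have "\<dots> = ennreal (sqrt (2 * pi / \<alpha>)) * ennreal (\<integral>t. normal_density (a - \<beta> / \<alpha>) (1 / sqrt \<alpha>) t \<partial>lborel)"
    using assms by (subst nn_integral_cmult) (auto simp: nn_integral_eq_integral)
  finally show ?thesis using assms by simp
qed

text \<open>Coefficients are plain functions on index pairs, so that an induction on
  \<open>n\<close> can change the coefficients and lower the dimension without leaving the type.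
  Matrices appear only inside \<open>fun_det\<close>.\<close>

definition quad_form :: "nat \<Rightarrow> (nat \<Rightarrow> nat \<Rightarrow> real) \<Rightarrow> (nat \<Rightarrow> real) \<Rightarrow> real" where
  "quad_form n G x = (\<Sum>i<n. \<Sum>j<n. G i j * x i * x j)"

text \<open>One elimination step with pivot \<open>G n n\<close>. The same coefficients describe the
  form left after completing the square in the last variable and the block left in the determinant,
  which is why the integral and the determinant follow the same recursion.\<close>

definition schur_complement :: "nat \<Rightarrow> (nat \<Rightarrow> nat \<Rightarrow> real) \<Rightarrow> nat \<Rightarrow> nat \<Rightarrow> real" where
  "schur_complement n G i j = G i j - G i n * G n j / G n n"

abbreviation fun_det :: "nat \<Rightarrow> (nat \<Rightarrow> nat \<Rightarrow> real) \<Rightarrow> real" where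
  "fun_det n G \<equiv> Determinant.det (Matrix.mat n n (\<lambda>(i, j). G i j))"

lemma quad_form_cong: "(\<And>i. i < n \<Longrightarrow> x i = y i) \<Longrightarrow> quad_form n G x = quad_form n G y"
  unfolding quad_form_def by (auto intro!: sum.cong)

text \<open>Completing the square in \<open>x n\<close>: the cross terms with the last variable go
  into the square, and the square of their sum is what the Schur complement subtracts.\<close>

lemma quad_form_Suc:
  assumes sym: "\<And>i j. G i j = G j i" and "G n n \<noteq> 0"
  shows "quad_form (Suc n) G x = quad_form n (schur_complement n G) x
           + G n n * (x n + (\<Sum>i<n. G i n * x i) / G n n)\<^sup>2"
proof -
  define \<beta> where "\<beta> = (\<Sum>i<n. G i n * x i)"
  have 1: "(\<Sum>i<n. G n i * x n * x i) = x n * \<beta>"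
    unfolding \<beta>_def by (subst sum_distrib_left, rule sum.cong) (auto simp: sym[of n])
  have 2: "(\<Sum>i<n. G i n * x i * x n) = x n * \<beta>"
    unfolding \<beta>_def by (subst sum_distrib_left, rule sum.cong) auto
  have 3: "(\<Sum>i<n. \<Sum>j<n. G i n * G n j / G n n * x i * x j) = \<beta>\<^sup>2 / G n n"
    unfolding \<beta>_def power2_eq_square sum_product sum_divide_distrib
  proof (intro sum.cong refl)
    fix i j
    show "G i n * G n j / G n n * x i * x j = G i n * x i * (G j n * x j) / G n n"
      using sym[of n j] by simp
  qed
  have "quad_form (Suc n) G x = quad_form n G x + 2 * x n * \<beta> + G n n * (x n)\<^sup>2"
    using 1 2 by (simp add: quad_form_def sum.distrib power2_eq_square)
  moreover have "quad_form n (schur_complement n G) x = quad_form n G x - \<beta>\<^sup>2 / G n n"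
    unfolding 3[symmetric] by (simp add: quad_form_def schur_complement_def algebra_simps sum_subtractf)
  moreover have "G n n * (x n + \<beta> / G n n)\<^sup>2 = 2 * x n * \<beta> + G n n * (x n)\<^sup>2 + \<beta>\<^sup>2 / G n n"
    using \<open>G n n \<noteq> 0\<close> by (simp add: power2_eq_square field_simps)
  ultimately show ?thesis
    unfolding \<beta>_def[symmetric] by simp
qed

text \<open>The matrix factors as a unitriangular block matrix, whose last column holds the
  multipliers \<open>G i n / G n n\<close>, times a block lower triangular one with diagonal blocks
  the Schur complement and the pivot.\<close>

lemma fun_det_Suc:
  assumes "G n n \<noteq> 0"
  shows "fun_det (Suc n) G = G n n * fun_det n (schur_complement n G)"
proof -
  let ?S = "Matrix.mat n n (\<lambda>(i, j). schur_complement n G i j)"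
  let ?\<beta> = "Matrix.mat n 1 (\<lambda>(i, j). G i n / G n n)"
  let ?r = "Matrix.mat 1 n (\<lambda>(i, j). G n j)"
  let ?\<alpha> = "Matrix.mat 1 1 (\<lambda>(i, j). G n n)"
  let ?U = "four_block_mat (1\<^sub>m n) ?\<beta> (0\<^sub>m 1 n) (1\<^sub>m 1)"
  let ?L = "four_block_mat ?S (0\<^sub>m n 1) ?r ?\<alpha>"
  have "Matrix.mat (Suc n) (Suc n) (\<lambda>(i, j). G i j) = ?U * ?L"
    by (subst mult_four_block_mat[of _ n n _ 1 _ 1])
       (use assms in \<open>auto intro!: eq_matI simp: four_block_mat_def Let_def scalar_prod_def
          schur_complement_def less_Suc_eq\<close>)
  moreover have "Determinant.det (?U * ?L) = Determinant.det ?U * Determinant.det ?L"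
    by (rule det_mult[of _ "n + 1"]) auto
  ultimately have "fun_det (Suc n) G = Determinant.det ?U * Determinant.det ?L"
    by simp
  also have "Determinant.det ?U = 1"
    by (subst det_four_block_mat_lower_left_zero[of _ n _ 1]) auto
  also have "Determinant.det ?L = Determinant.det ?S * Determinant.det ?\<alpha>"
    by (subst det_four_block_mat_upper_right_zero[of _ n _ 1]) auto
  also have "Determinant.det ?\<alpha> = G n n"
    by (subst det_single) auto
  finally show ?thesis by simp
qed

lemma borel_measurable_gaussian:
  "(\<lambda>x. exp (- (1/2) * quad_form n G (\<lambda>i. x i - a i))) \<in> borel_measurable (\<Pi>\<^sub>M i\<in>{..<n}. lborel)"
  unfolding quad_form_def by measurable

text \<open>Induction on the dimension, integrating out the last variable. The two claims are proved
  together, since the recursion for the integral takes square roots of determinants that must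
  already be known to be positive.\<close>

lemma gaussian_integral_det:
  assumes sym: "\<And>i j. G i j = G j i"
    and pos: "\<And>x. (\<exists>i<n. x i \<noteq> 0) \<Longrightarrow> quad_form n G x > 0"
  shows "fun_det n G > 0" (is ?th1)
    and "(\<integral>\<^sup>+ x. ennreal (exp (- (1/2) * quad_form n G (\<lambda>i. x i - a i))) \<partial>(\<Pi>\<^sub>M i\<in>{..<n}. lborel))
           = ennreal (sqrt ((2 * pi) ^ n / fun_det n G))" (is ?th2)
proof -
  interpret product_sigma_finite "\<lambda>_::nat. lborel :: real measure" ..
  have "?th1 \<and> ?th2"
    using assms
  proof (induction n arbitrary: G)
    case 0
    \<comment> \<open>In dimension 0 the determinant is 1, the form is 0 and the product measure has
      mass 1 on one point, so both sides are 1.\<close>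
    show ?case by (simp add: quad_form_def nn_integral_empty space_PiM emeasure_PiM_empty PiM_empty)
  next
    case (Suc n)
    let ?S = "schur_complement n G"
    have "quad_form (Suc n) G (\<lambda>i. if i = n then 1 else 0) > 0"
      by (rule Suc.prems(2)) auto
    then have \<alpha>: "G n n > 0"
      by (simp add: quad_form_def)
    have Spos: "quad_form n ?S x > 0" if "\<exists>i<n. x i \<noteq> 0" for x
    proof -
      \<comment> \<open>The last coordinate is chosen so that the completed square vanishes; the
        large form at \<open>?y\<close> is then the Schur form at \<open>x\<close>.\<close>
      let ?y = "x(n := - (\<Sum>i<n. G i n * x i) / G n n)"
      have "quad_form (Suc n) G ?y > 0"
        by (rule Suc.prems(2)) (use that in auto)
      moreover have "quad_form n ?S ?y = quad_form n ?S x"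
        by (rule quad_form_cong) simp
      ultimately show ?thesis
        using \<alpha> quad_form_Suc[of G n ?y, OF Suc.prems(1)] by simp
    qed
    have Ssym: "?S i j = ?S j i" for i j
      by (simp add: schur_complement_def Suc.prems(1)[of i j] Suc.prems(1)[of i n] Suc.prems(1)[of n j])
    note IH = Suc.IH[of ?S, OF Ssym Spos]
    have det: "fun_det (Suc n) G = G n n * fun_det n ?S"
      using fun_det_Suc[of G n] \<alpha> by simp
    have eq: "quad_form (Suc n) G (\<lambda>i. (x(n := t)) i - a i)
       = quad_form n ?S (\<lambda>i. x i - a i) + G n n * (t - a n + (\<Sum>i<n. G i n * (x i - a i)) / G n n)\<^sup>2" for x t
    proof -
      have "quad_form n ?S (\<lambda>i. (x(n := t)) i - a i) = quad_form n ?S (\<lambda>i. x i - a i)"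
        by (rule quad_form_cong) simp
      then show ?thesis
        using \<alpha> quad_form_Suc[of G n "\<lambda>i. (x(n := t)) i - a i", OF Suc.prems(1)] by simp
    qed
    have "(\<integral>\<^sup>+ x. ennreal (exp (- (1/2) * quad_form (Suc n) G (\<lambda>i. x i - a i))) \<partial>(\<Pi>\<^sub>M i\<in>{..<Suc n}. lborel))
        = (\<integral>\<^sup>+ x. (\<integral>\<^sup>+ t. ennreal (exp (- (1/2) * quad_form (Suc n) G (\<lambda>i. (x(n := t)) i - a i))) \<partial>lborel) 
            \<partial>(\<Pi>\<^sub>M i\<in>{..<n}. lborel))"
      using borel_measurable_gaussian[of "Suc n" G a] unfolding lessThan_Suc
      by (subst product_nn_integral_insert) auto
    \<comment> \<open>The earlier variables only move the centre of the Gaussian in the last one, so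
      the inner integral is a constant.\<close>
    also have "\<dots> = (\<integral>\<^sup>+ x. ennreal (exp (- (1/2) * quad_form n ?S (\<lambda>i. x i - a i))) * ennreal (sqrt (2 * pi / G n n))
            \<partial>(\<Pi>\<^sub>M i\<in>{..<n}. lborel))"
    proof (rule nn_integral_cong)
      fix x :: "nat \<Rightarrow> real"
      let ?q = "- (1/2) * quad_form n ?S (\<lambda>i. x i - a i)"
      let ?g = "\<lambda>t. - (1/2) * (G n n * (t - a n + (\<Sum>i<n. G i n * (x i - a i)) / G n n)\<^sup>2)"
      have "(\<integral>\<^sup>+ t. ennreal (exp (- (1/2) * quad_form (Suc n) G (\<lambda>i. (x(n := t)) i - a i))) \<partial>lborel)
          = (\<integral>\<^sup>+ t. ennreal (exp ?q) * ennreal (exp (?g t)) \<partial>lborel)"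
        unfolding eq distrib_left exp_add by (subst ennreal_mult') simp_all
      also have "\<dots> = ennreal (exp ?q) * (\<integral>\<^sup>+ t. ennreal (exp (?g t)) \<partial>lborel)"
        by (rule nn_integral_cmult) simp
      finally show "(\<integral>\<^sup>+ t. ennreal (exp (- (1/2) * quad_form (Suc n) G (\<lambda>i. (x(n := t)) i - a i))) \<partial>lborel)
          = ennreal (exp ?q) * ennreal (sqrt (2 * pi / G n n))"
        by (simp only: nn_integral_gaussian_quadratic[OF \<alpha>])
    qed
    also have "\<dots> = ennreal (sqrt ((2 * pi) ^ n / fun_det n ?S)) * ennreal (sqrt (2 * pi / G n n))"
      using borel_measurable_gaussian[of n ?S a] IH by (subst nn_integral_multc) auto
    also have "\<dots> = ennreal (sqrt ((2 * pi) ^ Suc n / fun_det (Suc n) G))"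
      using \<alpha> IH unfolding det
      by (subst ennreal_mult'[symmetric]) (simp_all add: real_sqrt_mult[symmetric] mult_ac)
    finally show ?case
      unfolding det using IH \<alpha> by simp
  qed
  then show ?th1 ?th2 by auto
qed

section \<open>Inner products on finite-dimensional subspaces\<close>

definition coords_sum :: "'a::real_vector set \<Rightarrow> (nat \<Rightarrow> real) \<Rightarrow> 'a" where
  "coords_sum F c = (\<Sum>i<dim F. c i *\<^sub>R subspace_basis F i)"

text \<open>This justifies the \<open>SOME\<close> in the definition: a finite spanning set bounds
  the size of independent subsets of \<open>F\<close>, so \<open>F\<close> has a finite basis, which
  can be enumerated by \<open>{..<dim F}\<close>.\<close>

lemma subspace_basis:
  fixes F :: "'a::real_vector set"
  assumes "subspace F" and "\<exists>S. finite S \<and> span S = F"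
  shows "inj_on (subspace_basis F) {..<dim F}"
    and "independent (subspace_basis F ` {..<dim F})"
    and "span (subspace_basis F ` {..<dim F}) = F"
proof -
  obtain S where S: "finite S" "span S = F"
    using assms by auto
  obtain Bs where Bs: "Bs \<subseteq> F" "independent Bs" "F \<subseteq> span Bs" "card Bs = dim F"
    using basis_exists by blast
  have "finite Bs"
    using independent_span_bound[OF S(1) Bs(2)] Bs(1) S(2) by simp
  then obtain b where b: "bij_betw b {..<dim F} Bs"
    using ex_bij_betw_nat_finite[of Bs] Bs(4) by (auto simp: lessThan_atLeast0)
  have "span Bs = F"
    using Bs assms(1) span_minimal[of Bs F] by auto
  then have "\<exists>b. inj_on b {..<dim F} \<and> independent (b ` {..<dim F}) \<and> span (b ` {..<dim F}) = F"
    using b Bs(2) by (intro exI[of _ b]) (auto simp: bij_betw_def)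
  then have "inj_on (subspace_basis F) {..<dim F} \<and> independent (subspace_basis F ` {..<dim F}) \<and>
      span (subspace_basis F ` {..<dim F}) = F"
    unfolding subspace_basis_def by (rule someI_ex)
  then show "inj_on (subspace_basis F) {..<dim F}"
    and "independent (subspace_basis F ` {..<dim F})"
    and "span (subspace_basis F ` {..<dim F}) = F" by auto
qed

text \<open>All laws are relative to \<open>F\<close>, because gradients are controlled only on
  \<open>H10 R\<close>. The locale is instantiated twice on the same space: with
  \<open>H10_inner R\<close>, and with the form in the exponent.\<close>

locale inner_product_on =
  fixes F :: "'a::real_vector set" and ip :: "'a \<Rightarrow> 'a \<Rightarrow> real"
  assumes subspace: "subspace F"
    and finite_dim: "\<exists>S. finite S \<and> span S = F"
    and add_left: "f \<in> F \<Longrightarrow> g \<in> F \<Longrightarrow> h \<in> F \<Longrightarrow> ip (f + g) h = ip f h + ip g h"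
    and scale_left: "f \<in> F \<Longrightarrow> h \<in> F \<Longrightarrow> ip (c *\<^sub>R f) h = c * ip f h"
    and sym: "f \<in> F \<Longrightarrow> g \<in> F \<Longrightarrow> ip f g = ip g f"
    and pos: "f \<in> F \<Longrightarrow> f \<noteq> 0 \<Longrightarrow> ip f f > 0"
begin

abbreviation "n \<equiv> dim F"
abbreviation "b \<equiv> subspace_basis F"

lemmas basis = subspace_basis[OF subspace finite_dim]

lemma basis_in: "i < n \<Longrightarrow> b i \<in> F"
  using basis(3) span_base[of "b i" "b ` {..<n}"] by auto

lemma coords_sum_in: "coords_sum F c \<in> F"
  unfolding coords_sum_def using subspace basis_in
  by (auto intro!: subspace_sum subspace_scale)

lemma sum_left: "finite I \<Longrightarrow> (\<And>i. i \<in> I \<Longrightarrow> f i \<in> F) \<Longrightarrow> h \<in> F \<Longrightarrow> ip (\<Sum>i\<in>I. f i) h = (\<Sum>i\<in>I. ip (f i) h)"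
proof (induction I rule: finite_induct)
  case empty
  then show ?case using scale_left[of 0 h 0] subspace_0[OF subspace] by simp
next
  case (insert i I)
  then show ?case by (simp add: add_left subspace_sum[OF subspace])
qed

lemma linear_coords:
  "h \<in> F \<Longrightarrow> ip (coords_sum F c) h = (\<Sum>i<n. c i * ip (b i) h)"
  unfolding coords_sum_def using basis_in subspace
  by (subst sum_left) (auto simp: scale_left subspace_scale)

lemma coords_sum_diff: "coords_sum F c - coords_sum F d = coords_sum F (\<lambda>i. c i - d i)"
  by (simp add: coords_sum_def sum_subtractf scaleR_diff_left)

lemma coords_sum_zero:
  assumes "coords_sum F c = 0" "i < n"
  shows "c i = 0"
proof -
  let ?u = "\<lambda>x. c (inv_into {..<n} b x)"
  have u: "?u (b j) = c j" if "j < n" for j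
    using that basis(1) by (simp add: inv_into_f_f)
  have "(\<Sum>x\<in>b ` {..<n}. ?u x *\<^sub>R x) = 0"
    using assms(1) u unfolding coords_sum_def by (subst sum.reindex[OF basis(1)]) simp
  then have "?u (b i) = 0"
    using independentD[OF basis(2) _ subset_refl, of ?u "b i"] assms(2) by simp
  then show ?thesis using u assms(2) by simp
qed

text \<open>\<open>embed_measure\<close> transports integrals only along injective maps. Injectivity
  holds on the space of the product measure, whose elements are fixed outside \<open>{..<n}\<close>,
  and there it is linear independence of the basis.\<close>

lemma coords_sum_inj: "inj_on (coords_sum F) (space (\<Pi>\<^sub>M i\<in>{..<n}. (lborel :: real measure)))"
proof (rule inj_onI)
  fix c d assume *: "c \<in> space (\<Pi>\<^sub>M i\<in>{..<n}. (lborel :: real measure))" "d \<in> space (\<Pi>\<^sub>M i\<in>{..<n}. (lborel :: real measure))"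
    "coords_sum F c = coords_sum F d"
  then have "coords_sum F (\<lambda>i. c i - d i) = 0"
    by (simp flip: coords_sum_diff)
  then have "c i = d i" if "i < n" for i
    using coords_sum_zero that by fastforce
  with * show "c = d"
    by (auto simp: space_PiM intro: PiE_ext)
qed

lemma in_coords_sum:
  assumes "f \<in> F"
  obtains c where "f = coords_sum F c"
proof -
  have "f \<in> span (b ` {..<n})" using assms basis(3) by simp
  then obtain u where "f = (\<Sum>v\<in>b ` {..<n}. u v *\<^sub>R v)"
    using span_finite[of "b ` {..<n}"] by auto
  then have "f = coords_sum F (\<lambda>i. u (b i))"
    unfolding coords_sum_def by (simp add: sum.reindex[OF basis(1)])
  then show thesis by (rule that)
qed

text \<open>The entries are cut off to 0 beyond \<open>n\<close> so that symmetry holds for all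
  indices, as the Gaussian lemma requires; outside \<open>F\<close> the form \<open>ip\<close> has
  no known symmetry.\<close>

definition gram :: "nat \<Rightarrow> nat \<Rightarrow> real" where
  "gram i j = (if i < n \<and> j < n then ip (b i) (b j) else 0)"

lemma gram_sym: "gram i j = gram j i"
  by (auto simp: gram_def sym basis_in)

lemma quad_form_gram: "quad_form n gram c = ip (coords_sum F c) (coords_sum F c)"
proof -
  have "ip (coords_sum F c) (coords_sum F c) = (\<Sum>i<n. c i * ip (b i) (coords_sum F c))"
    by (rule linear_coords[OF coords_sum_in])
  also have "\<dots> = (\<Sum>i<n. c i * ip (coords_sum F c) (b i))"
    using coords_sum_in basis_in by (intro sum.cong refl) (simp add: sym)
  also have "\<dots> = (\<Sum>i<n. c i * (\<Sum>j<n. c j * ip (b j) (b i)))"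
    using basis_in by (intro sum.cong refl) (simp add: linear_coords)
  also have "\<dots> = quad_form n gram c"
    unfolding quad_form_def sum_distrib_left
    by (intro sum.cong refl) (auto simp: gram_def sym basis_in)
  finally show ?thesis by simp
qed

lemma quad_form_gram_pos: "\<exists>i<n. c i \<noteq> 0 \<Longrightarrow> quad_form n gram c > 0"
  unfolding quad_form_gram using pos[OF coords_sum_in] coords_sum_zero by blast

lemmas gram_gaussian = gaussian_integral_det[of gram n, OF gram_sym quad_form_gram_pos]

text \<open>Riesz representation in finite dimension: the coordinates of the representer solve the
  Gram system, which is invertible since the Gram determinant is positive. It serves both for the
  minimizer and for the adjoint.\<close>

lemma exists_representer:
  assumes add: "\<And>f g. f \<in> F \<Longrightarrow> g \<in> F \<Longrightarrow> l (f + g) = l f + l g"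
    and scale: "\<And>f c. f \<in> F \<Longrightarrow> l (c *\<^sub>R f) = c * (l f :: real)"
  shows "\<exists>!g. g \<in> F \<and> (\<forall>f\<in>F. ip f g = l f)"
proof -
  let ?G = "Matrix.mat n n (\<lambda>(i, j). gram i j)"
  have "?G \<in> Units (ring_mat TYPE(real) n ())"
    using gram_gaussian(1) by (intro det_non_zero_imp_unit) auto
  then obtain H where H: "H \<in> carrier_mat n n" "?G * H = 1\<^sub>m n"
    by (auto simp: Units_def ring_mat_def)
  define x where "x = H *\<^sub>v Matrix.vec n (\<lambda>i. l (b i))"
  have x: "x \<in> carrier_vec n" using H by (simp add: x_def)
  have "?G *\<^sub>v x = (?G * H) *\<^sub>v Matrix.vec n (\<lambda>i. l (b i))"
    unfolding x_def using H(1) by (intro assoc_mult_mat_vec[symmetric, of _ n n _ n]) auto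
  also have "\<dots> = Matrix.vec n (\<lambda>i. l (b i))" using H by simp
  finally have Gx: "?G *\<^sub>v x = Matrix.vec n (\<lambda>i. l (b i))" .
  let ?g = "coords_sum F (vec_index x)"
  have basis_eq: "ip (b i) ?g = l (b i)" if i: "i < n" for i
  proof -
    have "l (b i) = vec_index (?G *\<^sub>v x) i" using Gx i by simp
    also have "\<dots> = (\<Sum>j<n. gram i j * vec_index x j)"
      using i x by (simp add: scalar_prod_def lessThan_atLeast0)
    also have "\<dots> = ip ?g (b i)"
      using i basis_in by (auto simp: linear_coords gram_def sym intro!: sum.cong)
    finally show ?thesis using i basis_in coords_sum_in by (simp add: sym)
  qed
  have l_sum: "l (\<Sum>i\<in>I. c i *\<^sub>R b i) = (\<Sum>i\<in>I. c i * l (b i))" if "finite I" "I \<subseteq> {..<n}" for I c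
    using that
  proof (induction I rule: finite_induct)
    case empty
    then show ?case using scale[of 0 0] subspace_0[OF subspace] by simp
  next
    case (insert i I)
    then have "(\<Sum>i\<in>I. c i *\<^sub>R b i) \<in> F" "b i \<in> F" "c i *\<^sub>R b i \<in> F"
      using basis_in subspace by (auto intro!: subspace_sum subspace_scale)
    with insert show ?case by (simp add: add scale)
  qed
  have eq: "ip f ?g = l f" if f: "f \<in> F" for f
  proof -
    obtain c where c: "f = coords_sum F c" using in_coords_sum[OF f] .
    have "ip f ?g = (\<Sum>i<n. c i * l (b i))"
      unfolding c by (simp add: linear_coords coords_sum_in basis_eq)
    also have "\<dots> = l f"
      unfolding c coords_sum_def by (rule l_sum[symmetric]) auto
    finally show ?thesis .
  qed
  show ?thesis
  proof (rule ex1I[of _ ?g])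
    show "?g \<in> F \<and> (\<forall>f\<in>F. ip f ?g = l f)" using eq coords_sum_in by auto
    fix h assume h: "h \<in> F \<and> (\<forall>f\<in>F. ip f h = l f)"
    \<comment> \<open>The difference is written as a sum with a multiple, the only operations on
      which the locale gives laws for \<open>ip\<close>.\<close>
    let ?d = "h + (-1) *\<^sub>R ?g"
    have d: "?d \<in> F" "(-1) *\<^sub>R ?g \<in> F"
      using h subspace coords_sum_in by (auto intro: subspace_diff subspace_neg)
    have "ip ?d ?d = ip h ?d + (-1) * ip ?g ?d"
      using h d coords_sum_in add_left[of h "(-1) *\<^sub>R ?g" ?d] scale_left[of ?g ?d "-1"] by simp
    also have "\<dots> = ip ?d h - ip ?d ?g"
      using sym[OF d(1)] h coords_sum_in by simp
    also have "\<dots> = 0" using eq d h by simp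
    finally have "?d = 0" using pos[OF d(1)] by force
    then show "h = ?g" by simp
  qed
qed

text \<open>Pulled back to coordinates, where the measure is the product Lebesgue measure, the
  exponent becomes the Gram form centred at the coordinates of \<open>h\<close>.\<close>

lemma integral_gaussian_subspace:
  assumes h: "h \<in> F"
  shows "(\<integral>g. exp (- (1/2) * ip (g - h) (g - h)) \<partial>lebesgue_on_subspace F) = sqrt ((2 * pi) ^ n / fun_det n gram)"
proof -
  obtain a where a: "h = coords_sum F a" using in_coords_sum[OF h] .
  let ?M = "\<Pi>\<^sub>M i\<in>{..<n}. (lborel :: real measure)"
  let ?g = "\<lambda>g. exp (- (1/2) * ip (g - h) (g - h))"
  have eq: "?g (coords_sum F c) = exp (- (1/2) * quad_form n gram (\<lambda>i. c i - a i))" for c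
    unfolding a coords_sum_diff quad_form_gram ..
  have M: "lebesgue_on_subspace F = embed_measure ?M (coords_sum F)"
    by (simp add: lebesgue_on_subspace_def coords_sum_def[abs_def])
  have meas: "?g \<in> borel_measurable (embed_measure ?M (coords_sum F))"
    by (rule measurable_embed_measure1) (simp only: eq borel_measurable_gaussian)
  have "(\<integral>\<^sup>+g. ?g g \<partial>lebesgue_on_subspace F) = (\<integral>\<^sup>+c. ?g (coords_sum F c) \<partial>?M)"
    unfolding M using meas by (intro nn_integral_embed_measure' coords_sum_inj) auto
  also have "\<dots> = ennreal (sqrt ((2 * pi) ^ n / fun_det n gram))"
    unfolding eq by (rule gram_gaussian(2))
  finally show ?thesis
    using meas gram_gaussian(1) unfolding M by (subst integral_eq_nn_integral) auto
qed

text \<open>The matrix of \<open>B\<close> in the basis is \<open>k\<close> times the Gram matrix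
  times the matrix of \<open>T\<close>, the latter being the one used by
  \<open>operator_det\<close>. Taking determinants produces the power of \<open>k\<close>.\<close>

lemma fun_det_gram_operator:
  assumes T: "\<And>g. g \<in> F \<Longrightarrow> T g \<in> F"
    and form: "\<And>f g. f \<in> F \<Longrightarrow> g \<in> F \<Longrightarrow> k * ip f (T g) = B f g"
  shows "fun_det n (\<lambda>i j. B (b i) (b j)) = k ^ n * fun_det n gram * operator_det F T"
proof -
  let ?G = "Matrix.mat n n (\<lambda>(i, j). gram i j)"
  let ?r = "\<lambda>i j. representation (b ` {..<n}) (T (b j)) (b i)"
  let ?R = "Matrix.mat n n (\<lambda>(i, j). ?r i j)"
  have rep: "T (b j) = coords_sum F (\<lambda>i. ?r i j)" if "j < n" for j
  proof -
    have "T (b j) \<in> span (b ` {..<n})" using T basis_in that basis(3) by simp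
    then have "(\<Sum>v\<in>b ` {..<n}. representation (b ` {..<n}) (T (b j)) v *\<^sub>R v) = T (b j)"
      by (intro sum_representation_eq basis(2)) auto
    then show ?thesis by (simp add: coords_sum_def sum.reindex[OF basis(1)])
  qed
  have "Matrix.mat n n (\<lambda>(i, j). B (b i) (b j)) = k \<cdot>\<^sub>m (?G * ?R)"
  proof (rule eq_matI)
    fix i j assume "i < dim_row (k \<cdot>\<^sub>m (?G * ?R))" "j < dim_col (k \<cdot>\<^sub>m (?G * ?R))"
    then have ij: "i < n" "j < n" by auto
    have "ip (b i) (T (b j)) = ip (T (b j)) (b i)"
      using ij T basis_in by (simp add: sym)
    also have "\<dots> = (\<Sum>l<n. ?r l j * ip (b l) (b i))"
      using ij rep[of j] linear_coords[of "b i" "\<lambda>i. ?r i j"] basis_in by simp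
    also have "\<dots> = (\<Sum>l<n. gram i l * ?r l j)"
      using ij basis_in by (intro sum.cong refl) (simp add: gram_def sym)
    finally have "ip (b i) (T (b j)) = (\<Sum>l<n. gram i l * ?r l j)" .
    then have "B (b i) (b j) = k * (\<Sum>l<n. gram i l * ?r l j)"
      using form[of "b i" "b j"] ij basis_in by simp
    then show "Matrix.mat n n (\<lambda>(i, j). B (b i) (b j)) $$ (i, j) = (k \<cdot>\<^sub>m (?G * ?R)) $$ (i, j)"
      using ij by (simp add: scalar_prod_def lessThan_atLeast0)
  qed auto
  moreover have "Determinant.det (k \<cdot>\<^sub>m (?G * ?R)) = k ^ n * (Determinant.det ?G * Determinant.det ?R)"
    by (subst det_smult) (simp add: det_mult[of ?G n ?R])
  ultimately show ?thesis
    by (simp add: operator_det_def mult.assoc)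
qed

end

section \<open>Smooth functions with compact support\<close>

lemma Ck_on_cong:
  assumes "open S"
  shows "Ck_on k f S \<Longrightarrow> (\<And>x. x \<in> S \<Longrightarrow> f x = g x) \<Longrightarrow> Ck_on k g S"
proof (induction k arbitrary: f g)
  case 0
  then show ?case by (auto cong: continuous_on_cong)
next
  case (Suc k)
  have g: "(g has_derivative frechet_derivative f (at x)) (at x)" if "x \<in> S" for x
  proof -
    have "f differentiable (at x)"
      using Suc.prems(1) that by (simp add: differentiable_on_eq_differentiable_at[OF assms])
    then show ?thesis
      using has_derivative_transform_within_open[OF _ assms that Suc.prems(2)]
      by (simp add: frechet_derivative_works)
  qed
  have "g differentiable_on S"
    unfolding differentiable_on_eq_differentiable_at[OF assms] differentiable_def using g by blast
  moreover have "Ck_on k (\<lambda>x. frechet_derivative g (at x) v) S" if "v \<in> Basis" for v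
  proof (rule Suc.IH)
    show "Ck_on k (\<lambda>x. frechet_derivative f (at x) v) S" using Suc.prems(1) that by simp
    show "frechet_derivative f (at x) v = frechet_derivative g (at x) v" if "x \<in> S" for x
      using frechet_derivative_at[OF g[OF that]] by simp
  qed
  ultimately show ?case by simp
qed

lemma Ck_on_add:
  assumes "open S"
  shows "Ck_on k f S \<Longrightarrow> Ck_on k g S \<Longrightarrow> Ck_on k (\<lambda>x. f x + g x) S"
proof (induction k arbitrary: f g)
  case 0
  then show ?case by (simp add: continuous_on_add)
next
  case (Suc k)
  have eq: "frechet_derivative f (at x) v + frechet_derivative g (at x) v = frechet_derivative (\<lambda>x. f x + g x) (at x) v"
    if "x \<in> S" for x v
  proof -
    have "f differentiable (at x)" "g differentiable (at x)"
      using Suc.prems that by (simp_all add: differentiable_on_eq_differentiable_at[OF assms])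
    then have "((\<lambda>x. f x + g x) has_derivative (\<lambda>v. frechet_derivative f (at x) v + frechet_derivative g (at x) v)) (at x)"
      unfolding frechet_derivative_works by (rule has_derivative_add)
    from frechet_derivative_at[OF this] show ?thesis by (rule fun_cong)
  qed
  have "Ck_on k (\<lambda>x. frechet_derivative (\<lambda>x. f x + g x) (at x) v) S" if "v \<in> Basis" for v
  proof (rule Ck_on_cong[OF assms _ eq])
    show "Ck_on k (\<lambda>x. frechet_derivative f (at x) v + frechet_derivative g (at x) v) S"
      by (rule Suc.IH) (use Suc.prems that in simp_all)
  qed
  then show ?case
    using Suc.prems by (simp add: differentiable_on_add)
qed

lemma Ck_on_scaleR:
  assumes "open S"
  shows "Ck_on k f S \<Longrightarrow> Ck_on k (\<lambda>x. c *\<^sub>R f x) S"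
proof (induction k arbitrary: f)
  case 0
  then show ?case by (simp add: continuous_on_scaleR)
next
  case (Suc k)
  have eq: "c *\<^sub>R frechet_derivative f (at x) v = frechet_derivative (\<lambda>x. c *\<^sub>R f x) (at x) v"
    if "x \<in> S" for x v
  proof -
    have "f differentiable (at x)"
      using Suc.prems that by (simp_all add: differentiable_on_eq_differentiable_at[OF assms])
    then have "((\<lambda>x. c *\<^sub>R f x) has_derivative (\<lambda>v. c *\<^sub>R frechet_derivative f (at x) v)) (at x)"
      unfolding frechet_derivative_works by (rule has_derivative_scaleR_right)
    from frechet_derivative_at[OF this] show ?thesis by (rule fun_cong)
  qed
  have "Ck_on k (\<lambda>x. frechet_derivative (\<lambda>x. c *\<^sub>R f x) (at x) v) S" if "v \<in> Basis" for v
  proof (rule Ck_on_cong[OF assms _ eq])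
    show "Ck_on k (\<lambda>x. c *\<^sub>R frechet_derivative f (at x) v) S"
      by (rule Suc.IH) (use Suc.prems that in simp_all)
  qed
  then show ?case
    using Suc.prems unfolding differentiable_on_def by simp
qed

text \<open>Vanishing outside a ball is easier to pass on to derivatives, products and translates
  than compactness of the closed support, and says the same in Euclidean space.\<close>

definition compact_support :: "('a::euclidean_space \<Rightarrow> 'b::real_normed_vector) \<Rightarrow> bool" where
  "compact_support f \<longleftrightarrow> (\<exists>r. \<forall>x. norm x > r \<longrightarrow> f x = 0)"

lemma integrable_compact_support:
  fixes f :: "'a::euclidean_space \<Rightarrow> 'b::{banach, second_countable_topology}"
  assumes "continuous_on UNIV f" "compact_support f"
  shows "integrable lborel f"
proof -
  obtain r where r: "\<And>x. norm x > r \<Longrightarrow> f x = 0" using assms(2) by (auto simp: compact_support_def)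
  have "integrable lborel (\<lambda>x. indicator (cball 0 r) x *\<^sub>R f x)"
    using assms(1) by (intro borel_integrable_compact) (auto intro: continuous_on_subset)
  also have "(\<lambda>x. indicator (cball 0 r) x *\<^sub>R f x) = f"
    using r by (force simp: indicator_def)
  finally show ?thesis .
qed

lemma compact_support_frechet_derivative:
  assumes "compact_support f"
  shows "compact_support (\<lambda>x. frechet_derivative f (at x) v)"
proof -
  obtain r where r: "\<And>x. norm x > r \<Longrightarrow> f x = 0" using assms by (auto simp: compact_support_def)
  have "frechet_derivative f (at x) v = 0" if "norm x > r" for x
  proof -
    have "open {x::'a. norm x > r}" by (intro open_Collect_less continuous_intros)
    then have "(f has_derivative (\<lambda>_. 0)) (at x)"
      using r that by (intro has_derivative_transform_within_open[of "\<lambda>_. 0" "\<lambda>_. 0" x UNIV "{x. norm x > r}" f]) auto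
    then have "frechet_derivative f (at x) = (\<lambda>_. 0)" using frechet_derivative_at by metis
    then show ?thesis by simp
  qed
  then show ?thesis by (auto simp: compact_support_def)
qed

lemma integral_lborel_translate:
  fixes f :: "'a::euclidean_space \<Rightarrow> real"
  assumes [measurable]: "f \<in> borel_measurable borel"
  shows "(\<integral>x. f (c + x) \<partial>lborel) = (\<integral>x. f x \<partial>lborel)"
proof -
  have "(\<integral>x. f x \<partial>lborel) = (\<integral>x. f x \<partial>distr lborel borel ((+) c))"
    by (simp only: lborel_distr_plus)
  also have "\<dots> = (\<integral>x. f (c + x) \<partial>lborel)"
    by (subst integral_distr) auto
  finally show ?thesis by simp
qed

text \<open>The difference quotients have integral zero by translation invariance and converge
  dominatedly.\<close>

lemma integral_directional_derivative_eq_0: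
  fixes f :: "'a::euclidean_space \<Rightarrow> real"
  assumes diff: "\<And>x. f differentiable (at x)"
    and cont: "continuous_on UNIV (\<lambda>x. frechet_derivative f (at x) v)"
    and supp: "compact_support f"
  shows "(\<integral>x. frechet_derivative f (at x) v \<partial>lborel) = 0"
proof -
  let ?f' = "\<lambda>x. frechet_derivative f (at x) v"
  obtain r where r: "\<And>x. norm x > r \<Longrightarrow> f x = 0" using supp by (auto simp: compact_support_def)
  have f_cont: "continuous_on UNIV f"
    using diff by (auto intro!: continuous_at_imp_continuous_on differentiable_imp_continuous_within)
  have [measurable]: "f \<in> borel_measurable borel" "?f' \<in> borel_measurable borel"
    using f_cont cont by (auto intro: borel_measurable_continuous_onI)
  have f_int: "integrable lborel f" by (rule integrable_compact_support[OF f_cont supp])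
  obtain M where M: "\<And>x. \<bar>?f' x\<bar> \<le> M"
  proof -
    obtain q where q: "\<And>x. norm x > q \<Longrightarrow> ?f' x = 0"
      using compact_support_frechet_derivative[OF supp] by (auto simp: compact_support_def)
    have "bounded (?f' ` cball 0 q)"
      using cont by (intro compact_imp_bounded compact_continuous_image) (auto intro: continuous_on_subset)
    then obtain M where M: "\<And>x. x \<in> cball 0 q \<Longrightarrow> \<bar>?f' x\<bar> \<le> M"
      by (force simp: bounded_iff)
    have "\<bar>?f' x\<bar> \<le> max M 0" for x
      using M[of x] q[of x] by (cases "norm x \<le> q") auto
    then show thesis by (rule that)
  qed
  define h where "h k = 1 / real (Suc k)" for k
  have h: "h k > 0" "h k \<le> 1" for k by (auto simp: h_def)
  have h_lim: "filterlim h (at_right 0) sequentially"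
    unfolding filterlim_at using h LIMSEQ_Suc[OF lim_1_over_n[where 'a = real]]
    by (auto simp: h_def[abs_def] eventually_sequentially)
  define g where "g k x = (f (h k *\<^sub>R v + x) - f x) / h k" for k x
  have [measurable]: "g k \<in> borel_measurable borel" for k
    unfolding g_def by measurable
  have g_int: "(\<integral>x. g k x \<partial>lborel) = 0" for k
  proof -
    have "integrable lborel (\<lambda>x. f (h k *\<^sub>R v + x))"
    proof (rule integrable_compact_support)
      show "continuous_on UNIV (\<lambda>x. f (h k *\<^sub>R v + x))"
        by (intro continuous_on_compose2[OF f_cont] continuous_intros) auto
      have "norm (h k *\<^sub>R v + x) > r" if "norm x > r + norm (h k *\<^sub>R v)" for x
        using norm_triangle_ineq4[of "h k *\<^sub>R v + x" "h k *\<^sub>R v"] that by simp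
      then show "compact_support (\<lambda>x. f (h k *\<^sub>R v + x))"
        using r by (auto simp: compact_support_def)
    qed
    then show ?thesis
      using f_int by (simp add: g_def integral_lborel_translate)
  qed
  have lim: "(\<lambda>k. g k x) \<longlonglongrightarrow> ?f' x" for x
  proof -
    have "(f has_derivative frechet_derivative f (at x)) (at x)"
      using diff frechet_derivative_works by blast
    then have "((\<lambda>t. f (x + t *\<^sub>R v)) has_derivative (\<lambda>t. frechet_derivative f (at x) (t *\<^sub>R v))) (at 0)"
      by (auto intro!: derivative_eq_intros has_derivative_compose[of "\<lambda>t. x + t *\<^sub>R v" "\<lambda>t. t *\<^sub>R v" 0 UNIV f])
    then have "((\<lambda>t. f (x + t *\<^sub>R v)) has_real_derivative ?f' x) (at 0)"
      using linear_frechet_derivative[OF diff, of x]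
      by (simp add: has_field_derivative_def linear_scale mult_commute_abs)
    then have "((\<lambda>t. (f (x + t *\<^sub>R v) - f x) / t) \<longlongrightarrow> ?f' x) (at 0)"
      by (simp add: has_field_derivative_iff)
    then have "((\<lambda>t. (f (x + t *\<^sub>R v) - f x) / t) \<longlongrightarrow> ?f' x) (at_right 0)"
      by (rule tendsto_within_subset) auto
    from filterlim_compose[OF this h_lim] show ?thesis
      by (simp add: g_def add.commute)
  qed
  \<comment> \<open>The steps \<open>h k\<close> are at most 1, so all quotients vanish outside one
    ball of radius \<open>r + norm v\<close>; inside, the mean value theorem bounds them by the
    supremum \<open>M\<close> of the derivative.\<close>
  have bound: "norm (g k x) \<le> indicator (cball 0 (r + norm v)) x *\<^sub>R M" for k x
  proof (cases "norm x > r + norm v")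
    case True
    have "norm (h k *\<^sub>R v) \<le> norm v"
      using h[of k] by (simp add: mult_left_le_one_le)
    then have "norm (h k *\<^sub>R v + x) > r"
      using norm_triangle_ineq4[of "h k *\<^sub>R v + x" "h k *\<^sub>R v"] True by simp
    moreover have "norm x > r" using True norm_ge_zero[of v] by linarith
    ultimately show ?thesis using r True by (simp add: g_def)
  next
    case False
    have "((\<lambda>t. f (x + t *\<^sub>R v)) has_real_derivative ?f' (x + t *\<^sub>R v)) (at t)" for t
    proof -
      have "(f has_derivative frechet_derivative f (at (x + t *\<^sub>R v))) (at (x + t *\<^sub>R v))"
        using diff frechet_derivative_works by blast
      then have "((\<lambda>t. f (x + t *\<^sub>R v)) has_derivative (\<lambda>s. frechet_derivative f (at (x + t *\<^sub>R v)) (s *\<^sub>R v))) (at t)"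
        by (auto intro!: derivative_eq_intros has_derivative_compose[of "\<lambda>t. x + t *\<^sub>R v" "\<lambda>t. t *\<^sub>R v" t UNIV f])
      then show ?thesis
        using linear_frechet_derivative[OF diff, of "x + t *\<^sub>R v"]
        by (simp add: has_field_derivative_def linear_scale mult_commute_abs)
    qed
    then obtain z where "f (x + h k *\<^sub>R v) - f (x + 0 *\<^sub>R v) = (h k - 0) * ?f' (x + z *\<^sub>R v)"
      using MVT2[of 0 "h k" "\<lambda>t. f (x + t *\<^sub>R v)" "\<lambda>t. ?f' (x + t *\<^sub>R v)"] h by blast
    then have "g k x = ?f' (x + z *\<^sub>R v)"
      using h[of k] by (simp add: g_def add.commute field_simps)
    then show ?thesis using M False by (simp add: indicator_def)
  qed
  have "(\<lambda>k. \<integral>x. g k x \<partial>lborel) \<longlonglongrightarrow> (\<integral>x. ?f' x \<partial>lborel)"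
  proof (rule integral_dominated_convergence)
    show "integrable lborel (\<lambda>x. indicator (cball 0 (r + norm v)) x *\<^sub>R M)"
      by (rule borel_integrable_compact) auto
  qed (use lim bound in \<open>auto\<close>)
  then show ?thesis
    unfolding g_int by (simp add: LIMSEQ_const_iff)
qed

definition smooth_compact :: "('a::euclidean_space \<Rightarrow> 'b::real_normed_vector) \<Rightarrow> bool" where
  "smooth_compact \<phi> \<longleftrightarrow> (\<forall>k. Ck_on k \<phi> UNIV) \<and> compact_support \<phi>"

lemma test_field_smooth_compact: "test_field U \<phi> \<Longrightarrow> smooth_compact \<phi>"
proof -
  assume *: "test_field U \<phi>"
  then have "bounded {x. \<phi> x \<noteq> 0}"
    unfolding test_field_def by (blast intro: bounded_subset[OF compact_imp_bounded] subsetD[OF closure_subset])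
  then show ?thesis
    using * by (auto simp: smooth_compact_def test_field_def compact_support_def bounded_iff not_le[symmetric])
qed

lemma test_field_add:
  assumes "test_field U \<phi>" "test_field U \<psi>"
  shows "test_field U (\<lambda>x. \<phi> x + \<psi> x)"
proof -
  have "{x. \<phi> x + \<psi> x \<noteq> 0} \<subseteq> {x. \<phi> x \<noteq> 0} \<union> {x. \<psi> x \<noteq> 0}" by auto
  from closure_mono[OF this]
  have "closure {x. \<phi> x + \<psi> x \<noteq> 0} \<subseteq> closure {x. \<phi> x \<noteq> 0} \<union> closure {x. \<psi> x \<noteq> 0}"
    by (simp add: closure_Un)
  then show ?thesis
    using assms compact_Int_closed[OF compact_Un[of "closure {x. \<phi> x \<noteq> 0}" "closure {x. \<psi> x \<noteq> 0}"], of "closure {x. \<phi> x + \<psi> x \<noteq> 0}"]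
    by (auto simp: test_field_def Ck_on_add Int_absorb1)
qed

lemma test_field_scaleR:
  assumes "test_field U \<phi>"
  shows "test_field U (\<lambda>x. c *\<^sub>R \<phi> x)"
proof -
  have "closure {x. c *\<^sub>R \<phi> x \<noteq> 0} \<subseteq> closure {x. \<phi> x \<noteq> 0}"
    by (rule closure_mono) auto
  then show ?thesis
    using assms compact_Int_closed[of "closure {x. \<phi> x \<noteq> 0}" "closure {x. c *\<^sub>R \<phi> x \<noteq> 0}"]
    by (auto simp: test_field_def Ck_on_scaleR Int_absorb1)
qed

lemma smooth_compact_diff:
  assumes "smooth_compact \<phi>" "smooth_compact \<psi>"
  shows "smooth_compact (\<lambda>x. \<phi> x - \<psi> x)"
proof -
  obtain r s where "\<forall>x. norm x > r \<longrightarrow> \<phi> x = 0" "\<forall>x. norm x > s \<longrightarrow> \<psi> x = 0"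
    using assms by (auto simp: smooth_compact_def compact_support_def)
  then have "compact_support (\<lambda>x. \<phi> x - \<psi> x)"
    unfolding compact_support_def by (intro exI[of _ "max r s"]) auto
  moreover have "Ck_on k (\<lambda>x. \<phi> x + (-1) *\<^sub>R \<psi> x) UNIV" for k
    using assms by (intro Ck_on_add Ck_on_scaleR) (auto simp: smooth_compact_def)
  ultimately show ?thesis by (simp add: smooth_compact_def)
qed

lemma smooth_compact_differentiable: "smooth_compact \<phi> \<Longrightarrow> \<phi> differentiable (at x)"
  unfolding smooth_compact_def by (auto dest!: spec[of _ "Suc 0"] simp: differentiable_on_def)

lemma smooth_compact_continuous: "smooth_compact \<phi> \<Longrightarrow> continuous_on UNIV \<phi>"
  unfolding smooth_compact_def by (auto dest!: spec[of _ 0])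

lemma smooth_compact_pderivative:
  fixes \<phi> :: "real ^ 'n \<Rightarrow> 'b::real_normed_vector"
  assumes "smooth_compact \<phi>"
  shows "smooth_compact (pderivative j \<phi>)"
proof -
  have "Ck_on k (\<lambda>x. frechet_derivative \<phi> (at x) (axis j 1)) UNIV" for k
  proof -
    have "Ck_on (Suc k) \<phi> UNIV" using assms unfolding smooth_compact_def by blast
    then show ?thesis by (simp add: axis_in_Basis_iff)
  qed
  then show ?thesis
    using assms compact_support_frechet_derivative[of \<phi>]
    by (simp add: smooth_compact_def pderivative_def[abs_def])
qed

section \<open>Jacobians, Green's identity and Poincare's inequality\<close>

lemma jacobian_eq_pderivative:
  fixes u :: "real ^ 'n \<Rightarrow> real ^ 'm"
  shows "jacobian u (at x) = (\<chi> i j. pderivative j u x $ i)"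
  by (simp add: jacobian_def matrix_def pderivative_def)

lemma inner_jacobian:
  fixes \<phi> \<psi> :: "real ^ 'n \<Rightarrow> real ^ 'm"
  shows "jacobian \<phi> (at x) \<bullet> jacobian \<psi> (at x) = (\<Sum>j\<in>UNIV. pderivative j \<phi> x \<bullet> pderivative j \<psi> x)"
  unfolding jacobian_eq_pderivative inner_vec_def by (simp, rule sum.swap)

lemma continuous_on_jacobian:
  fixes \<phi> :: "real ^ 'n \<Rightarrow> real ^ 'm"
  assumes "smooth_compact \<phi>"
  shows "continuous_on UNIV (\<lambda>x. jacobian \<phi> (at x))"
  unfolding jacobian_eq_pderivative
  by (intro continuous_on_vec_lambda continuous_on_component smooth_compact_continuous smooth_compact_pderivative assms)

lemma jacobian_eq_0:
  fixes \<phi> :: "real ^ 'n \<Rightarrow> real ^ 'm"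
  assumes "open S" "x \<in> S" "\<And>y. y \<in> S \<Longrightarrow> \<phi> y = 0"
  shows "jacobian \<phi> (at x) = 0"
proof -
  have "(\<phi> has_derivative (\<lambda>_. 0)) (at x)"
    using assms by (intro has_derivative_transform_within_open[of "\<lambda>_. 0" "\<lambda>_. 0" x UNIV S \<phi>]) auto
  from frechet_derivative_at[OF this]
  have "frechet_derivative \<phi> (at x) = (\<lambda>_. 0)" by (rule sym)
  then show ?thesis
    by (simp add: jacobian_eq_pderivative pderivative_def Finite_Cartesian_Product.vec_eq_iff)
qed

lemma compact_support_jacobian:
  fixes \<phi> :: "real ^ 'n \<Rightarrow> real ^ 'm"
  assumes "smooth_compact \<phi>"
  shows "compact_support (\<lambda>x. jacobian \<phi> (at x))"
proof -
  obtain r where r: "\<And>x. norm x > r \<Longrightarrow> \<phi> x = 0"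
    using assms by (auto simp: smooth_compact_def compact_support_def)
  have "open {x::real ^ 'n. norm x > r}" by (intro open_Collect_less continuous_intros)
  then have "jacobian \<phi> (at x) = 0" if "norm x > r" for x
    by (rule jacobian_eq_0) (use that r in auto)
  then show ?thesis by (auto simp: compact_support_def)
qed

lemma compact_support_binop:
  assumes "compact_support f" "\<And>y. h 0 y = 0"
  shows "compact_support (\<lambda>x. h (f x) (g x))"
  using assms unfolding compact_support_def by metis

lemma integrable_inner_compact_support:
  fixes f g :: "'a::euclidean_space \<Rightarrow> 'b::real_inner"
  assumes "continuous_on UNIV f" "continuous_on UNIV g" "compact_support f"
  shows "integrable lborel (\<lambda>x. f x \<bullet> g x)"
  using assms by (intro integrable_compact_support continuous_on_inner compact_support_binop[where h = inner]) auto

text \<open>For each direction \<open>j\<close> the derivative of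
  \<open>\<phi> x \<bullet> pderivative j \<psi> x\<close> along the axis \<open>j\<close> has
  integral 0, and the product rule splits it into the two integrands. Summing over \<open>j\<close>
  gives the Frobenius product and the Laplacian.\<close>

lemma greens_identity:
  fixes \<phi> \<psi> :: "real ^ 'n \<Rightarrow> real ^ 'n"
  assumes \<phi>: "smooth_compact \<phi>" and \<psi>: "smooth_compact \<psi>"
  shows "(\<integral>x. jacobian \<phi> (at x) \<bullet> jacobian \<psi> (at x) \<partial>lborel) = - (\<integral>x. \<phi> x \<bullet> laplacian \<psi> x \<partial>lborel)"
    and "continuous_on UNIV (laplacian \<psi>)"
proof -
  note cont = smooth_compact_continuous
  note pd = smooth_compact_pderivative
  have *: "(\<integral>x. pderivative j \<phi> x \<bullet> pderivative j \<psi> x \<partial>lborel)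
      = - (\<integral>x. \<phi> x \<bullet> pderivative j (pderivative j \<psi>) x \<partial>lborel)" for j
  proof -
    let ?f = "\<lambda>x. \<phi> x \<bullet> pderivative j \<psi> x"
    have D: "(?f has_derivative (\<lambda>h. \<phi> x \<bullet> frechet_derivative (pderivative j \<psi>) (at x) h
        + frechet_derivative \<phi> (at x) h \<bullet> pderivative j \<psi> x)) (at x)" for x
      using smooth_compact_differentiable[OF \<phi>] smooth_compact_differentiable[OF pd[OF \<psi>]]
      unfolding frechet_derivative_works by (rule has_derivative_inner)
    have eq: "frechet_derivative ?f (at x) (axis j 1)
        = \<phi> x \<bullet> pderivative j (pderivative j \<psi>) x + pderivative j \<phi> x \<bullet> pderivative j \<psi> x" for x
      unfolding frechet_derivative_at[OF D, symmetric] by (simp add: pderivative_def)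
    have "(\<integral>x. frechet_derivative ?f (at x) (axis j 1) \<partial>lborel) = 0"
    proof (rule integral_directional_derivative_eq_0)
      show "?f differentiable (at x)" for x using D by (rule differentiableI)
      show "continuous_on UNIV (\<lambda>x. frechet_derivative ?f (at x) (axis j 1))"
        unfolding eq by (intro continuous_intros cont pd \<phi> \<psi>)
      show "compact_support ?f"
        using \<phi> by (intro compact_support_binop[where h = inner]) (auto simp: smooth_compact_def)
    qed
    moreover have "integrable lborel (\<lambda>x. \<phi> x \<bullet> pderivative j (pderivative j \<psi>) x)"
      "integrable lborel (\<lambda>x. pderivative j \<phi> x \<bullet> pderivative j \<psi> x)"
      using \<phi> pd[OF \<phi>] by (auto intro!: integrable_inner_compact_support cont pd \<phi> \<psi> simp: smooth_compact_def)
    ultimately show ?thesis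
      unfolding eq by simp
  qed
  have "(\<integral>x. jacobian \<phi> (at x) \<bullet> jacobian \<psi> (at x) \<partial>lborel)
      = (\<Sum>j\<in>UNIV. \<integral>x. pderivative j \<phi> x \<bullet> pderivative j \<psi> x \<partial>lborel)"
    unfolding inner_jacobian using pd[OF \<phi>]
    by (intro Bochner_Integration.integral_sum integrable_inner_compact_support cont pd \<phi> \<psi>) (auto simp: smooth_compact_def)
  also have "\<dots> = - (\<Sum>j\<in>UNIV. \<integral>x. \<phi> x \<bullet> pderivative j (pderivative j \<psi>) x \<partial>lborel)"
    by (simp add: * sum_negf)
  also have "(\<Sum>j\<in>UNIV. \<integral>x. \<phi> x \<bullet> pderivative j (pderivative j \<psi>) x \<partial>lborel) = (\<integral>x. \<phi> x \<bullet> laplacian \<psi> x \<partial>lborel)"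
    unfolding laplacian_def inner_sum_right using \<phi>
    by (intro Bochner_Integration.integral_sum[symmetric] integrable_inner_compact_support cont pd \<phi> \<psi>) (auto simp: smooth_compact_def)
  finally show "(\<integral>x. jacobian \<phi> (at x) \<bullet> jacobian \<psi> (at x) \<partial>lborel) = - (\<integral>x. \<phi> x \<bullet> laplacian \<psi> x \<partial>lborel)" .
  show "continuous_on UNIV (laplacian \<psi>)"
    unfolding laplacian_def[abs_def] by (intro continuous_intros cont pd \<psi>)
qed

text \<open>Integrate the derivative of \<open>x\<^sub>i |\<phi>|\<^sup>2\<close> in the direction \<open>i\<close>.\<close>

lemma poincare_inequality:
  fixes \<phi> :: "real ^ 'n \<Rightarrow> real ^ 'n"
  assumes \<phi>: "smooth_compact \<phi>" and r: "\<And>x. norm x > r \<Longrightarrow> \<phi> x = 0"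
  shows "(\<integral>x. (norm (\<phi> x))\<^sup>2 \<partial>lborel) \<le> 4 * r\<^sup>2 * (\<integral>x. (norm (jacobian \<phi> (at x)))\<^sup>2 \<partial>lborel)"
proof -
  \<comment> \<open>Any single coordinate direction is enough; index types are never empty.\<close>
  obtain i :: 'n where True by blast
  note cont = smooth_compact_continuous
  note pd = smooth_compact_pderivative
  let ?f = "\<lambda>x. x $ i * (\<phi> x \<bullet> \<phi> x)"
  have D: "(?f has_derivative (\<lambda>h. x $ i * (\<phi> x \<bullet> frechet_derivative \<phi> (at x) h
        + frechet_derivative \<phi> (at x) h \<bullet> \<phi> x) + h $ i * (\<phi> x \<bullet> \<phi> x))) (at x)" for x
    using smooth_compact_differentiable[OF \<phi>] unfolding frechet_derivative_works
    by (intro has_derivative_mult has_derivative_inner bounded_linear_imp_has_derivative bounded_linear_vec_nth)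
  have eq: "frechet_derivative ?f (at x) (axis i 1)
      = (norm (\<phi> x))\<^sup>2 + 2 * x $ i * (\<phi> x \<bullet> pderivative i \<phi> x)" for x
    unfolding frechet_derivative_at[OF D, symmetric]
    by (simp add: pderivative_def axis_def inner_commute power2_norm_eq_inner)
  have cont_eq: "continuous_on UNIV (\<lambda>x. (norm (\<phi> x))\<^sup>2 + 2 * x $ i * (\<phi> x \<bullet> pderivative i \<phi> x))"
    by (intro continuous_intros cont pd \<phi>)
  have supp: "compact_support \<phi>" "compact_support (\<lambda>x. jacobian \<phi> (at x))"
    using \<phi> compact_support_jacobian by (auto simp: smooth_compact_def)
  have "(\<integral>x. frechet_derivative ?f (at x) (axis i 1) \<partial>lborel) = 0"
  proof (rule integral_directional_derivative_eq_0)
    show "?f differentiable (at x)" for x using D by (rule differentiableI)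
    show "continuous_on UNIV (\<lambda>x. frechet_derivative ?f (at x) (axis i 1))"
      unfolding eq by (rule cont_eq)
    show "compact_support ?f"
      using supp(1) by (rule compact_support_binop[where h = "\<lambda>(a :: real ^ 'n) (b :: real ^ 'n). b $ i * (a \<bullet> a)" and g = "\<lambda>x. x"]) auto
  qed
  then have zero: "(\<integral>x. (norm (\<phi> x))\<^sup>2 + 2 * x $ i * (\<phi> x \<bullet> pderivative i \<phi> x) \<partial>lborel) = 0"
    unfolding eq .
  have int: "integrable lborel (\<lambda>x. (norm (\<phi> x))\<^sup>2)" "integrable lborel (\<lambda>x. (norm (jacobian \<phi> (at x)))\<^sup>2)"
    unfolding power2_norm_eq_inner
    by (intro integrable_inner_compact_support cont \<phi> continuous_on_jacobian supp)+
  have int': "integrable lborel (\<lambda>x. (norm (\<phi> x))\<^sup>2 + 2 * x $ i * (\<phi> x \<bullet> pderivative i \<phi> x))"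
    using supp(1) by (intro integrable_compact_support[OF cont_eq]
        compact_support_binop[where h = "\<lambda>(a :: real ^ 'n) (b, c). (norm a)\<^sup>2 + 2 * b * (a \<bullet> c)" and g = "\<lambda>x. (x $ i, pderivative i \<phi> x)", simplified])
      auto
  \<comment> \<open>Half of \<open>|a + 2 x_i b|^2 >= 0\<close>, with \<open>a\<close> the value and
    \<open>b\<close> the partial derivative, together with \<open>|x_i| <= r\<close>. The integral
    of the right side is 0, so half the integral of \<open>|\<phi>|^2\<close> is at most
    \<open>2 r^2\<close> times that of the Jacobian: this is the constant
    \<open>4 r^2\<close>.\<close>
  have "(1 / 2) * (norm (\<phi> x))\<^sup>2 - 2 * r\<^sup>2 * (norm (jacobian \<phi> (at x)))\<^sup>2
      \<le> (norm (\<phi> x))\<^sup>2 + 2 * x $ i * (\<phi> x \<bullet> pderivative i \<phi> x)" for x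
  proof (cases "norm x > r")
    case True
    then show ?thesis using r by simp
  next
    case False
    define a where "a = \<phi> x"
    define b where "b = pderivative i \<phi> x"
    have 1: "0 \<le> (norm (a + (2 * x $ i) *\<^sub>R b))\<^sup>2" by simp
    have "(norm (a + (2 * x $ i) *\<^sub>R b))\<^sup>2 = (norm a)\<^sup>2 + 4 * x $ i * (a \<bullet> b) + 4 * (x $ i)\<^sup>2 * (norm b)\<^sup>2"
      unfolding power2_norm_eq_inner by (simp add: algebra_simps inner_commute power2_eq_square)
    moreover have "(x $ i)\<^sup>2 \<le> r\<^sup>2"
      using False component_le_norm_cart[of x i] by (simp add: power2_le_iff_abs_le)
    then have "(x $ i)\<^sup>2 * (norm b)\<^sup>2 \<le> r\<^sup>2 * (norm (jacobian \<phi> (at x)))\<^sup>2"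
    proof (rule mult_mono)
      show "(norm b)\<^sup>2 \<le> (norm (jacobian \<phi> (at x)))\<^sup>2"
        unfolding power2_norm_eq_inner inner_jacobian b_def
        by (rule member_le_sum[of i UNIV "\<lambda>j. pderivative j \<phi> x \<bullet> pderivative j \<phi> x"]) auto
    qed auto
    ultimately show ?thesis
      using 1 unfolding a_def[symmetric] b_def[symmetric] by simp
  qed
  then have "(\<integral>x. (1 / 2) * (norm (\<phi> x))\<^sup>2 - 2 * r\<^sup>2 * (norm (jacobian \<phi> (at x)))\<^sup>2 \<partial>lborel) \<le> 0"
    unfolding zero[symmetric] using int int' by (intro integral_mono) auto
  then show ?thesis
    using int by simp
qed

section \<open>The inner product of \<open>H\<^sup>1\<^sub>0(R)\<close>\<close>

text \<open>The squared L2 norm with values in \<open>ennreal\<close>, infinity allowed, so that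
  convergence can be stated before integrability is known. The limits in \<open>H10_limit\<close>
  and in the jump condition have this shape.\<close>

definition sq_norm :: "'a measure \<Rightarrow> ('a \<Rightarrow> 'b::real_normed_vector) \<Rightarrow> ennreal" where
  "sq_norm M f = (\<integral>\<^sup>+ x. ennreal ((norm (f x))\<^sup>2) \<partial>M)"

lemma norm_add_power2_le: "(norm (a + b :: 'a::real_normed_vector))\<^sup>2 \<le> 2 * (norm a)\<^sup>2 + 2 * (norm b)\<^sup>2"
proof -
  have "(norm (a + b))\<^sup>2 \<le> (norm a + norm b)\<^sup>2"
    by (intro power_mono norm_triangle_ineq) auto
  also have "\<dots> \<le> 2 * (norm a)\<^sup>2 + 2 * (norm b)\<^sup>2"
    using sum_squares_bound[of "norm a" "norm b"] by (simp add: power2_sum)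
  finally show ?thesis .
qed

lemma sq_norm_add_le:
  fixes f g :: "'a \<Rightarrow> 'b::{real_normed_vector, second_countable_topology}"
  assumes [measurable]: "f \<in> borel_measurable M" "g \<in> borel_measurable M"
  shows "sq_norm M (\<lambda>x. f x + g x) \<le> 2 * sq_norm M f + 2 * sq_norm M g"
proof -
  have "sq_norm M (\<lambda>x. f x + g x) \<le> (\<integral>\<^sup>+ x. 2 * ennreal ((norm (f x))\<^sup>2) + 2 * ennreal ((norm (g x))\<^sup>2) \<partial>M)"
    unfolding sq_norm_def
  proof (rule nn_integral_mono)
    fix x
    have "ennreal ((norm (f x + g x))\<^sup>2) \<le> ennreal (2 * (norm (f x))\<^sup>2 + 2 * (norm (g x))\<^sup>2)"
      by (rule ennreal_leI[OF norm_add_power2_le])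
    then show "ennreal ((norm (f x + g x))\<^sup>2) \<le> 2 * ennreal ((norm (f x))\<^sup>2) + 2 * ennreal ((norm (g x))\<^sup>2)"
      by (simp add: ennreal_plus ennreal_mult')
  qed
  also have "\<dots> = 2 * sq_norm M f + 2 * sq_norm M g"
    unfolding sq_norm_def by (subst nn_integral_add) (auto simp: nn_integral_cmult)
  finally show ?thesis .
qed

lemma sq_norm_scaleR:
  fixes f :: "'a \<Rightarrow> 'b::{real_normed_vector, second_countable_topology}"
  assumes [measurable]: "f \<in> borel_measurable M"
  shows "sq_norm M (\<lambda>x. c *\<^sub>R f x) = ennreal (c\<^sup>2) * sq_norm M f"
  unfolding sq_norm_def by (subst nn_integral_cmult[symmetric]) (auto simp: power_mult_distrib ennreal_mult)

lemma sq_norm_cong_AE: "AE x in M. norm (f x) = norm (g x) \<Longrightarrow> sq_norm M f = sq_norm M g"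
  unfolding sq_norm_def by (rule nn_integral_cong_AE) auto

lemma sq_norm_minus_commute: "sq_norm M (\<lambda>x. f x - g x) = sq_norm M (\<lambda>x. g x - f x)"
  unfolding sq_norm_def by (simp add: norm_minus_commute)

lemma sq_norm_eq_0_iff:
  fixes f :: "'a \<Rightarrow> 'b::{real_normed_vector, second_countable_topology}"
  assumes [measurable]: "f \<in> borel_measurable M"
  shows "sq_norm M f = 0 \<longleftrightarrow> (AE x in M. f x = 0)"
  unfolding sq_norm_def by (subst nn_integral_0_iff_AE) auto

lemma sq_norm_tendsto_0_add:
  fixes f g :: "'i \<Rightarrow> 'a \<Rightarrow> 'b::{real_normed_vector, second_countable_topology}"
  assumes [measurable]: "\<And>k. f k \<in> borel_measurable M" "\<And>k. g k \<in> borel_measurable M"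
    and "((\<lambda>k. sq_norm M (f k)) \<longlongrightarrow> 0) L" "((\<lambda>k. sq_norm M (g k)) \<longlongrightarrow> 0) L"
  shows "((\<lambda>k. sq_norm M (\<lambda>x. f k x + g k x)) \<longlongrightarrow> 0) L"
proof (rule tendsto_sandwich[of "\<lambda>_. 0"])
  have "((\<lambda>k. 2 * sq_norm M (f k) + 2 * sq_norm M (g k)) \<longlongrightarrow> 2 * 0 + 2 * 0) L"
    using assms by (intro tendsto_add ennreal_tendsto_cmult) auto
  then show "((\<lambda>k. 2 * sq_norm M (f k) + 2 * sq_norm M (g k)) \<longlongrightarrow> 0) L" by simp
qed (auto intro!: always_eventually sq_norm_add_le)

lemma sq_norm_tendsto_0_scaleR:
  fixes f :: "'i \<Rightarrow> 'a \<Rightarrow> 'b::{real_normed_vector, second_countable_topology}"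
  assumes [measurable]: "\<And>k. f k \<in> borel_measurable M"
    and "((\<lambda>k. sq_norm M (f k)) \<longlongrightarrow> 0) L"
  shows "((\<lambda>k. sq_norm M (\<lambda>x. c *\<^sub>R f k x)) \<longlongrightarrow> 0) L"
proof -
  have "((\<lambda>k. ennreal (c\<^sup>2) * sq_norm M (f k)) \<longlongrightarrow> ennreal (c\<^sup>2) * 0) L"
    using assms by (intro ennreal_tendsto_cmult) auto
  then show ?thesis by (simp add: sq_norm_scaleR)
qed

lemma sq_norm_compact_support:
  fixes f :: "'a::euclidean_space \<Rightarrow> 'b::{real_inner, second_countable_topology}"
  assumes "continuous_on UNIV f" "compact_support f"
  shows "sq_norm lborel f = ennreal (\<integral>x. (norm (f x))\<^sup>2 \<partial>lborel)"
  unfolding sq_norm_def power2_norm_eq_inner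
  using assms by (intro nn_integral_eq_integral integrable_inner_compact_support) auto

text \<open>A closability statement: \<open>\<theta> k\<close> tends to 0 and its gradients are Cauchy.  By Green's identity
  the inner product of the gradients of \<open>\<theta> k\<close> and \<open>\<theta> l\<close> tends to 0 as \<open>k\<close> grows.\<close>

lemma jacobian_limit_eq_0:
  fixes \<theta> :: "nat \<Rightarrow> real ^ 'n \<Rightarrow> real ^ 'n" and H :: "real ^ 'n \<Rightarrow> real ^ 'n ^ 'n"
  assumes \<theta>: "\<And>k. smooth_compact (\<theta> k)"
    and [measurable]: "H \<in> borel_measurable borel"
    and lim: "(\<lambda>k. sq_norm lborel (\<theta> k)) \<longlonglongrightarrow> 0"
    and lim': "(\<lambda>k. sq_norm lborel (\<lambda>x. jacobian (\<theta> k) (at x) - H x)) \<longlonglongrightarrow> 0"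
  shows "AE x in lborel. H x = 0"
proof -
  let ?J = "\<lambda>k x. jacobian (\<theta> k) (at x)"
  have cJ: "continuous_on UNIV (?J k)" "compact_support (?J k)" for k
    using \<theta> by (auto intro: continuous_on_jacobian compact_support_jacobian)
  have [measurable]: "?J k \<in> borel_measurable borel" for k
    using cJ by (intro borel_measurable_continuous_onI) auto
  have c\<theta>: "continuous_on UNIV (\<theta> k)" "compact_support (\<theta> k)" for k
    using smooth_compact_continuous[OF \<theta>] \<theta> by (simp_all add: smooth_compact_def)
  have cL: "continuous_on UNIV (laplacian (\<theta> l))" for l
    by (rule greens_identity(2)[OF \<theta> \<theta>])
  have sL: "compact_support (laplacian (\<theta> l))" for l
  proof -
    have "compact_support (pderivative i (pderivative i (\<theta> l)))" for i
      using smooth_compact_pderivative[OF smooth_compact_pderivative[OF \<theta>]] by (auto simp: smooth_compact_def)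
    then obtain r where r: "\<And>i x. norm x > r i \<Longrightarrow> pderivative i (pderivative i (\<theta> l)) x = 0"
      unfolding compact_support_def by metis
    have "laplacian (\<theta> l) x = 0" if "norm x > Max (range r)" for x
      unfolding laplacian_def using that r by (intro sum.neutral) (auto simp: Max_less_iff)
    then show ?thesis unfolding compact_support_def by blast
  qed
  define a where "a k = (\<integral>x. (norm (\<theta> k x))\<^sup>2 \<partial>lborel)" for k
  define d where "d k = (\<integral>x. (norm (laplacian (\<theta> k) x))\<^sup>2 \<partial>lborel)" for k
  define n where "n k = (\<integral>x. (norm (?J k x))\<^sup>2 \<partial>lborel)" for k
  define e where "e k l = (\<integral>x. (norm (?J k x - ?J l x))\<^sup>2 \<partial>lborel)" for k l
  have int: "integrable lborel (\<lambda>x. f x \<bullet> g x)"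
    if "continuous_on UNIV f" "continuous_on UNIV g" "compact_support f" for f g :: "real ^ 'n \<Rightarrow> 'c::real_inner"
    using integrable_inner_compact_support[OF that] .
  have nonneg: "n k \<ge> 0" "a k \<ge> 0" "d k \<ge> 0" "e k l \<ge> 0" for k l
    by (auto simp: n_def a_def d_def e_def)
  have polar: "n k + n l = e k l + 2 * (\<integral>x. ?J k x \<bullet> ?J l x \<partial>lborel)" for k l
  proof -
    have "e k l = (\<integral>x. ?J k x \<bullet> ?J k x + ?J l x \<bullet> ?J l x - 2 * (?J k x \<bullet> ?J l x) \<partial>lborel)"
      unfolding e_def power2_norm_eq_inner
      by (intro Bochner_Integration.integral_cong refl) (simp add: inner_diff_left inner_diff_right inner_commute)
    then show ?thesis
      using int[OF cJ(1) cJ(1) cJ(2)] by (simp add: n_def power2_norm_eq_inner)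
  qed
  \<comment> \<open>Young's inequality with a free parameter. Nothing controls \<open>d l\<close> as
    \<open>l\<close> grows, so \<open>l\<close> stays fixed while \<open>k\<close> goes to infinity,
    and only then does \<open>\<delta>\<close> go to 0.\<close>
  have green: "2 * (\<integral>x. ?J k x \<bullet> ?J l x \<partial>lborel) \<le> a k / \<delta> + \<delta> * d l" if "\<delta> > 0" for k l \<delta>
  proof -
    have "2 * (\<integral>x. ?J k x \<bullet> ?J l x \<partial>lborel) = (\<integral>x. - 2 * (\<theta> k x \<bullet> laplacian (\<theta> l) x) \<partial>lborel)"
      using greens_identity(1)[OF \<theta> \<theta>, of k l] by simp
    also have "\<dots> \<le> (\<integral>x. (\<theta> k x \<bullet> \<theta> k x) / \<delta> + \<delta> * (laplacian (\<theta> l) x \<bullet> laplacian (\<theta> l) x) \<partial>lborel)"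
    proof (rule integral_mono)
      fix x
      have "0 \<le> (\<theta> k x + \<delta> *\<^sub>R laplacian (\<theta> l) x) \<bullet> (\<theta> k x + \<delta> *\<^sub>R laplacian (\<theta> l) x)" by simp
      then show "- 2 * (\<theta> k x \<bullet> laplacian (\<theta> l) x) \<le> (\<theta> k x \<bullet> \<theta> k x) / \<delta> + \<delta> * (laplacian (\<theta> l) x \<bullet> laplacian (\<theta> l) x)"
        using that by (simp add: inner_add_left inner_add_right inner_commute field_simps)
    qed (use int[OF c\<theta>(1) c\<theta>(1) c\<theta>(2)] int[OF cL cL sL] int[OF c\<theta>(1) cL c\<theta>(2)] in auto)
    also have "\<dots> = a k / \<delta> + \<delta> * d l"
      using int[OF c\<theta>(1) c\<theta>(1) c\<theta>(2)] int[OF cL cL sL] by (simp add: a_def d_def power2_norm_eq_inner)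
    finally show ?thesis .
  qed
  have a_lim: "a \<longlonglongrightarrow> 0"
    using lim unfolding sq_norm_compact_support[OF c\<theta>] a_def[symmetric]
    by (subst (asm) ennreal_0[symmetric], subst (asm) tendsto_ennreal_iff) (use nonneg in auto)
  have n_lim: "n \<longlonglongrightarrow> 0"
  proof (rule LIMSEQ_I)
    fix \<epsilon>' :: real assume "\<epsilon>' > 0"
    \<comment> \<open>The limit arguments give only the weak bound
      \<open>n l \<le> \<epsilon>\<close>; halving leaves room for the strict one.\<close>
    define \<epsilon> where "\<epsilon> = \<epsilon>' / 2"
    have \<epsilon>: "\<epsilon> > 0" "\<epsilon> < \<epsilon>'" using \<open>\<epsilon>' > 0\<close> by (auto simp: \<epsilon>_def)
    have "eventually (\<lambda>k. sq_norm lborel (\<lambda>x. ?J k x - H x) < ennreal (\<epsilon> / 4)) sequentially"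
      using lim' \<epsilon> by (intro order_tendstoD) auto
    then obtain N where N: "\<And>k. k \<ge> N \<Longrightarrow> sq_norm lborel (\<lambda>x. ?J k x - H x) < ennreal (\<epsilon> / 4)"
      by (auto simp: eventually_sequentially)
    have e: "e k l \<le> \<epsilon>" if "k \<ge> N" "l \<ge> N" for k l
    proof -
      have "continuous_on UNIV (\<lambda>x. ?J k x - ?J l x)" using cJ by (intro continuous_intros)
      moreover have "compact_support (\<lambda>x. ?J k x - ?J l x)"
      proof -
        obtain r s where "\<forall>x. norm x > r \<longrightarrow> ?J k x = 0" "\<forall>x. norm x > s \<longrightarrow> ?J l x = 0"
          using cJ(2) unfolding compact_support_def by metis
        then show ?thesis
          unfolding compact_support_def by (intro exI[of _ "max r s"]) auto
      qed
      ultimately have "ennreal (e k l) = sq_norm lborel (\<lambda>x. ?J k x - ?J l x)"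
        by (simp add: e_def sq_norm_compact_support)
      also have "\<dots> = sq_norm lborel (\<lambda>x. (?J k x - H x) + (H x - ?J l x))" by simp
      also have "\<dots> \<le> 2 * sq_norm lborel (\<lambda>x. ?J k x - H x) + 2 * sq_norm lborel (\<lambda>x. H x - ?J l x)"
        by (rule sq_norm_add_le) auto
      also have "\<dots> \<le> 2 * ennreal (\<epsilon> / 4) + 2 * ennreal (\<epsilon> / 4)"
        using N[OF that(1)] N[OF that(2)] sq_norm_minus_commute[of lborel H "?J l"]
        by (intro add_mono mult_left_mono) auto
      also have "\<dots> = ennreal (2 * (\<epsilon> / 4) + 2 * (\<epsilon> / 4))"
        using \<epsilon> by (simp only: ennreal_plus ennreal_mult' ennreal_numeral)
      finally show ?thesis using \<epsilon> by (subst (asm) ennreal_le_iff) auto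
    qed
    have bound: "n l \<le> \<epsilon>" if l: "l \<ge> N" for l
    proof -
      have *: "n l \<le> \<epsilon> + \<delta> * d l" if "\<delta> > 0" for \<delta>
      proof (rule tendsto_lowerbound)
        have "(\<lambda>k. \<epsilon> + (a k / \<delta> + \<delta> * d l)) \<longlonglongrightarrow> \<epsilon> + (0 / \<delta> + \<delta> * d l)"
          using \<open>\<delta> > 0\<close> by (intro tendsto_intros a_lim) auto
        then show "(\<lambda>k. \<epsilon> + (a k / \<delta> + \<delta> * d l)) \<longlonglongrightarrow> \<epsilon> + \<delta> * d l" by simp
        show "eventually (\<lambda>k. n l \<le> \<epsilon> + (a k / \<delta> + \<delta> * d l)) sequentially"
          unfolding eventually_sequentially
        proof (intro exI[of _ N] allI impI)
          fix k assume "N \<le> k"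
          then show "n l \<le> \<epsilon> + (a k / \<delta> + \<delta> * d l)"
            using polar[of k l] e[OF _ l, of k] green[OF \<open>\<delta> > 0\<close>, of k l] nonneg[of k] by linarith
        qed
      qed auto
      show ?thesis
      proof (rule tendsto_lowerbound)
        have "((\<lambda>\<delta>. \<epsilon> + \<delta> * d l) \<longlongrightarrow> \<epsilon> + 0 * d l) (at_right 0)"
          by (intro tendsto_intros)
        then show "((\<lambda>\<delta>. \<epsilon> + \<delta> * d l) \<longlongrightarrow> \<epsilon>) (at_right 0)" by simp
        show "eventually (\<lambda>\<delta>. n l \<le> \<epsilon> + \<delta> * d l) (at_right 0)"
          using * by (auto simp: eventually_at_filter)
      qed auto
    qed
    then show "\<exists>no. \<forall>l\<ge>no. norm (n l - 0) < \<epsilon>'"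
      using \<epsilon> nonneg by (intro exI[of _ N]) force
  qed
  have "(\<lambda>k. sq_norm lborel (?J k)) \<longlonglongrightarrow> 0"
    using tendsto_ennrealI[OF n_lim] unfolding sq_norm_compact_support[OF cJ] n_def by simp
  \<comment> \<open>The sum inside equals \<open>H x\<close> for every \<open>k\<close>, so a
    constant sequence tends to 0.\<close>
  then have "(\<lambda>k. sq_norm lborel (\<lambda>x. (-1) *\<^sub>R (?J k x - H x) + ?J k x)) \<longlonglongrightarrow> 0"
    by (intro sq_norm_tendsto_0_add sq_norm_tendsto_0_scaleR lim') auto
  then have "sq_norm lborel H = 0"
    by (simp add: LIMSEQ_const_iff)
  then show ?thesis by (subst (asm) sq_norm_eq_0_iff) auto
qed

section \<open>Almost-everywhere calculus of plane fields and their weak gradients\<close>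

lemma rep_field_measurable [measurable]: "rep_field g \<in> borel_measurable borel"
  using Quotient_rel_rep[OF Quotient_plane_field, of g g] by simp

lemma plane_field_eq_iff: "g = h \<longleftrightarrow> (AE x in lborel. rep_field g x = rep_field h x)"
  using Quotient_rel_rep[OF Quotient_plane_field, of g h] by simp

lemma rep_abs_field_AE:
  assumes "f \<in> borel_measurable borel"
  shows "AE x in lborel. rep_field (abs_field f) x = f x"
  using rep_abs_rsp_left[OF Quotient3_plane_field, of f f] assms by simp

lemma rep_field_plus: "AE x in lborel. rep_field (g + h) x = rep_field g x + rep_field h x"
proof -
  have "g + h = abs_field (\<lambda>x. rep_field g x + rep_field h x)"
    by (simp add: plus_plane_field_def)
  then show ?thesis by (simp add: rep_abs_field_AE)
qed

lemma rep_field_scaleR: "AE x in lborel. rep_field (c *\<^sub>R g) x = c *\<^sub>R rep_field g x"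
proof -
  have "c *\<^sub>R g = abs_field (\<lambda>x. c *\<^sub>R rep_field g x)"
    by (simp add: scaleR_plane_field_def)
  then show ?thesis by (simp add: rep_abs_field_AE)
qed

lemma rep_field_zero: "AE x in lborel. rep_field 0 x = 0"
proof -
  have "0 = abs_field (\<lambda>x. 0)" by (simp add: zero_plane_field_def)
  then show ?thesis using rep_abs_field_AE[of "\<lambda>_. 0"] by simp
qed

lemma measurable_smooth_compact:
  fixes \<phi> :: "real ^ 'n \<Rightarrow> real ^ 'm"
  assumes "smooth_compact \<phi>"
  shows "\<phi> \<in> borel_measurable borel" "(\<lambda>x. jacobian \<phi> (at x)) \<in> borel_measurable borel"
  using smooth_compact_continuous[OF assms] continuous_on_jacobian[OF assms]
  by (auto intro: borel_measurable_continuous_onI)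

lemma jacobian_add:
  fixes f g :: "real ^ 'n \<Rightarrow> real ^ 'm"
  assumes "f differentiable (at x)" "g differentiable (at x)"
  shows "jacobian (\<lambda>x. f x + g x) (at x) = jacobian f (at x) + jacobian g (at x)"
proof -
  from has_derivative_add[OF assms[unfolded frechet_derivative_works]]
  show ?thesis
    by (simp add: jacobian_def matrix_def frechet_derivative_at[symmetric] Finite_Cartesian_Product.vec_eq_iff)
qed

lemma jacobian_scaleR:
  fixes f :: "real ^ 'n \<Rightarrow> real ^ 'm"
  assumes "f differentiable (at x)"
  shows "jacobian (\<lambda>x. c *\<^sub>R f x) (at x) = c *\<^sub>R jacobian f (at x)"
proof -
  from has_derivative_scaleR_right[OF assms[unfolded frechet_derivative_works], of c]
  show ?thesis
    by (simp add: jacobian_def matrix_def frechet_derivative_at[symmetric] Finite_Cartesian_Product.vec_eq_iff)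
qed

lemma H10_limit_sq_norm:
  "H10_limit R g G \<longleftrightarrow> G \<in> borel_measurable borel \<and>
     (\<exists>\<phi> :: nat \<Rightarrow> real ^ 2 \<Rightarrow> real ^ 2. (\<forall>k. test_field (interior R) (\<phi> k)) \<and>
        (\<lambda>k. sq_norm lborel (\<lambda>x. \<phi> k x - rep_field g x)) \<longlonglongrightarrow> 0 \<and>
        (\<lambda>k. sq_norm lborel (\<lambda>x. jacobian (\<phi> k) (at x) - G x)) \<longlonglongrightarrow> 0)"
  unfolding H10_limit_def sq_norm_def ..

text \<open>The differences of two approximating sequences tend to the zero field while their
  Jacobians tend to \<open>G - G'\<close>, so closability applies. This makes the
  \<open>SOME\<close> in \<open>field_gradient\<close> harmless up to null sets.\<close>

lemma H10_limit_unique: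
  assumes "H10_limit R g G" "H10_limit R g G'"
  shows "AE x in lborel. G x = G' x"
proof -
  obtain \<phi> where \<phi>: "\<And>k. test_field (interior R) (\<phi> k)"
    "(\<lambda>k. sq_norm lborel (\<lambda>x. \<phi> k x - rep_field g x)) \<longlonglongrightarrow> 0"
    "(\<lambda>k. sq_norm lborel (\<lambda>x. jacobian (\<phi> k) (at x) - G x)) \<longlonglongrightarrow> 0"
    using assms(1) unfolding H10_limit_sq_norm by auto
  obtain \<psi> where \<psi>: "\<And>k. test_field (interior R) (\<psi> k)"
    "(\<lambda>k. sq_norm lborel (\<lambda>x. \<psi> k x - rep_field g x)) \<longlonglongrightarrow> 0"
    "(\<lambda>k. sq_norm lborel (\<lambda>x. jacobian (\<psi> k) (at x) - G' x)) \<longlonglongrightarrow> 0"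
    using assms(2) unfolding H10_limit_sq_norm by auto
  have [measurable]: "G \<in> borel_measurable borel" "G' \<in> borel_measurable borel"
    using assms by (auto simp: H10_limit_sq_norm)
  have s: "smooth_compact (\<phi> k)" "smooth_compact (\<psi> k)" for k
    using \<phi>(1) \<psi>(1) by (auto intro: test_field_smooth_compact)
  note [measurable] = measurable_smooth_compact[OF s(1)] measurable_smooth_compact[OF s(2)]
  have J: "jacobian (\<lambda>x. \<phi> k x - \<psi> k x) (at x) = jacobian (\<phi> k) (at x) - jacobian (\<psi> k) (at x)" for k x
  proof -
    have d: "\<phi> k differentiable (at x)" "\<psi> k differentiable (at x)"
      using s by (auto intro: smooth_compact_differentiable)
    then have "(\<lambda>x. (-1) *\<^sub>R \<psi> k x) differentiable (at x)"
      by (intro differentiable_scaleR differentiable_const)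
    from jacobian_add[OF d(1) this] jacobian_scaleR[OF d(2), of "-1"] show ?thesis by simp
  qed
  have "AE x in lborel. G x - G' x = 0"
  proof (rule jacobian_limit_eq_0[of "\<lambda>k x. \<phi> k x - \<psi> k x"])
    have "(\<lambda>k. sq_norm lborel (\<lambda>x. (\<phi> k x - rep_field g x) + (-1) *\<^sub>R (\<psi> k x - rep_field g x))) \<longlonglongrightarrow> 0"
      by (intro sq_norm_tendsto_0_add sq_norm_tendsto_0_scaleR \<phi> \<psi>) auto
    then show "(\<lambda>k. sq_norm lborel (\<lambda>x. \<phi> k x - \<psi> k x)) \<longlonglongrightarrow> 0" by simp
    have "(\<lambda>k. sq_norm lborel (\<lambda>x. (jacobian (\<phi> k) (at x) - G x) + (-1) *\<^sub>R (jacobian (\<psi> k) (at x) - G' x))) \<longlonglongrightarrow> 0"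
      by (intro sq_norm_tendsto_0_add sq_norm_tendsto_0_scaleR \<phi> \<psi>) auto
    then show "(\<lambda>k. sq_norm lborel (\<lambda>x. jacobian (\<lambda>x. \<phi> k x - \<psi> k x) (at x) - (G x - G' x))) \<longlonglongrightarrow> 0"
      by (simp add: J algebra_simps)
    show "smooth_compact (\<lambda>x. \<phi> k x - \<psi> k x)" for k
      using s by (intro smooth_compact_diff)
  qed auto
  then show ?thesis by auto
qed

lemma H10_limit_add:
  assumes "H10_limit R g G" "H10_limit R h H"
  shows "H10_limit R (g + h) (\<lambda>x. G x + H x)"
proof -
  obtain \<phi> where \<phi>: "\<And>k. test_field (interior R) (\<phi> k)"
    "(\<lambda>k. sq_norm lborel (\<lambda>x. \<phi> k x - rep_field g x)) \<longlonglongrightarrow> 0"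
    "(\<lambda>k. sq_norm lborel (\<lambda>x. jacobian (\<phi> k) (at x) - G x)) \<longlonglongrightarrow> 0"
    using assms(1) unfolding H10_limit_sq_norm by auto
  obtain \<psi> where \<psi>: "\<And>k. test_field (interior R) (\<psi> k)"
    "(\<lambda>k. sq_norm lborel (\<lambda>x. \<psi> k x - rep_field h x)) \<longlonglongrightarrow> 0"
    "(\<lambda>k. sq_norm lborel (\<lambda>x. jacobian (\<psi> k) (at x) - H x)) \<longlonglongrightarrow> 0"
    using assms(2) unfolding H10_limit_sq_norm by auto
  have [measurable]: "G \<in> borel_measurable borel" "H \<in> borel_measurable borel"
    using assms by (auto simp: H10_limit_sq_norm)
  have s: "smooth_compact (\<phi> k)" "smooth_compact (\<psi> k)" for k
    using \<phi>(1) \<psi>(1) by (auto intro: test_field_smooth_compact)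
  note [measurable] = measurable_smooth_compact[OF s(1)] measurable_smooth_compact[OF s(2)]
  have "(\<lambda>k. sq_norm lborel (\<lambda>x. (\<phi> k x - rep_field g x) + (\<psi> k x - rep_field h x))) \<longlonglongrightarrow> 0"
    by (intro sq_norm_tendsto_0_add \<phi> \<psi>) auto
  also have "(\<lambda>k. sq_norm lborel (\<lambda>x. (\<phi> k x - rep_field g x) + (\<psi> k x - rep_field h x)))
      = (\<lambda>k. sq_norm lborel (\<lambda>x. (\<phi> k x + \<psi> k x) - rep_field (g + h) x))"
  proof (intro ext sq_norm_cong_AE)
    fix k
    show "AE x in lborel. norm ((\<phi> k x - rep_field g x) + (\<psi> k x - rep_field h x))
        = norm ((\<phi> k x + \<psi> k x) - rep_field (g + h) x)"
      using rep_field_plus[of g h] by eventually_elim (simp add: algebra_simps)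
  qed
  finally have 1: "(\<lambda>k. sq_norm lborel (\<lambda>x. (\<phi> k x + \<psi> k x) - rep_field (g + h) x)) \<longlonglongrightarrow> 0" .
  have "(\<lambda>k. sq_norm lborel (\<lambda>x. (jacobian (\<phi> k) (at x) - G x) + (jacobian (\<psi> k) (at x) - H x))) \<longlonglongrightarrow> 0"
    by (intro sq_norm_tendsto_0_add \<phi> \<psi>) auto
  then have 2: "(\<lambda>k. sq_norm lborel (\<lambda>x. jacobian (\<lambda>x. \<phi> k x + \<psi> k x) (at x) - (G x + H x))) \<longlonglongrightarrow> 0"
    using s by (simp add: jacobian_add smooth_compact_differentiable algebra_simps)
  show ?thesis
    unfolding H10_limit_sq_norm using 1 2 \<phi>(1) \<psi>(1)
    by (intro conjI exI[of _ "\<lambda>k x. \<phi> k x + \<psi> k x"] allI test_field_add) auto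
qed

lemma H10_limit_scaleR:
  assumes "H10_limit R g G"
  shows "H10_limit R (c *\<^sub>R g) (\<lambda>x. c *\<^sub>R G x)"
proof -
  obtain \<phi> where \<phi>: "\<And>k. test_field (interior R) (\<phi> k)"
    "(\<lambda>k. sq_norm lborel (\<lambda>x. \<phi> k x - rep_field g x)) \<longlonglongrightarrow> 0"
    "(\<lambda>k. sq_norm lborel (\<lambda>x. jacobian (\<phi> k) (at x) - G x)) \<longlonglongrightarrow> 0"
    using assms(1) unfolding H10_limit_sq_norm by auto
  have [measurable]: "G \<in> borel_measurable borel"
    using assms by (auto simp: H10_limit_sq_norm)
  have s: "smooth_compact (\<phi> k)" for k
    using \<phi>(1) by (auto intro: test_field_smooth_compact)
  note [measurable] = measurable_smooth_compact[OF s(1)]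
  have "(\<lambda>k. sq_norm lborel (\<lambda>x. c *\<^sub>R (\<phi> k x - rep_field g x))) \<longlonglongrightarrow> 0"
    by (intro sq_norm_tendsto_0_scaleR \<phi>) auto
  also have "(\<lambda>k. sq_norm lborel (\<lambda>x. c *\<^sub>R (\<phi> k x - rep_field g x)))
      = (\<lambda>k. sq_norm lborel (\<lambda>x. c *\<^sub>R \<phi> k x - rep_field (c *\<^sub>R g) x))"
  proof (intro ext sq_norm_cong_AE)
    fix k
    show "AE x in lborel. norm (c *\<^sub>R (\<phi> k x - rep_field g x)) = norm (c *\<^sub>R \<phi> k x - rep_field (c *\<^sub>R g) x)"
      using rep_field_scaleR[of c g] by eventually_elim (simp add: scaleR_diff_right)
  qed
  finally have 1: "(\<lambda>k. sq_norm lborel (\<lambda>x. c *\<^sub>R \<phi> k x - rep_field (c *\<^sub>R g) x)) \<longlonglongrightarrow> 0" .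
  have "(\<lambda>k. sq_norm lborel (\<lambda>x. c *\<^sub>R (jacobian (\<phi> k) (at x) - G x))) \<longlonglongrightarrow> 0"
    by (intro sq_norm_tendsto_0_scaleR \<phi>) auto
  then have 2: "(\<lambda>k. sq_norm lborel (\<lambda>x. jacobian (\<lambda>x. c *\<^sub>R \<phi> k x) (at x) - c *\<^sub>R G x)) \<longlonglongrightarrow> 0"
    using s by (simp add: jacobian_scaleR smooth_compact_differentiable scaleR_diff_right)
  show ?thesis
    unfolding H10_limit_sq_norm using 1 2 \<phi>(1)
    by (intro conjI exI[of _ "\<lambda>k x. c *\<^sub>R \<phi> k x"] allI test_field_scaleR) auto
qed

lemma H10_limit_field_gradient: "g \<in> H10 R \<Longrightarrow> H10_limit R g (field_gradient R g)"
  unfolding field_gradient_def H10_def by (auto intro: someI[of "H10_limit R g"])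

lemma field_gradient_measurable [measurable (raw)]:
  "g \<in> H10 R \<Longrightarrow> field_gradient R g \<in> borel_measurable borel"
  using H10_limit_field_gradient by (auto simp: H10_limit_def)

text \<open>The three gradients are independent choices. The sum of two of them is an admissible
  gradient of \<open>g + h\<close>, and uniqueness links it to the chosen one.\<close>

lemma field_gradient_add:
  assumes "g \<in> H10 R" "h \<in> H10 R"
  shows "AE x in lborel. field_gradient R (g + h) x = field_gradient R g x + field_gradient R h x"
proof -
  note lim = H10_limit_add[OF assms[THEN H10_limit_field_gradient]]
  then have "g + h \<in> H10 R" by (auto simp: H10_def)
  from H10_limit_unique[OF H10_limit_field_gradient[OF this] lim] show ?thesis .
qed

lemma field_gradient_scaleR:
  assumes "g \<in> H10 R"
  shows "AE x in lborel. field_gradient R (c *\<^sub>R g) x = c *\<^sub>R field_gradient R g x"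
proof -
  note lim = H10_limit_scaleR[OF assms[THEN H10_limit_field_gradient], of c]
  then have "c *\<^sub>R g \<in> H10 R" by (auto simp: H10_def)
  from H10_limit_unique[OF H10_limit_field_gradient[OF this] lim] show ?thesis .
qed

text \<open>The gradient is within finite L2 distance of the Jacobian of some test field, which is
  continuous with compact support; hence it is square integrable, and Cauchy-Schwarz dominates the
  product.\<close>

lemma integrable_field_gradient_inner:
  assumes g: "g \<in> H10 R" and h: "h \<in> H10 R"
  shows "integrable lborel (\<lambda>x. field_gradient R g x \<bullet> field_gradient R h x)"
proof -
  have sq: "integrable lborel (\<lambda>x. (norm (field_gradient R g x))\<^sup>2)" if g: "g \<in> H10 R" for g
  proof -
    let ?G = "field_gradient R g"
    have [measurable]: "?G \<in> borel_measurable borel" using g by (rule field_gradient_measurable)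
    obtain \<phi> where \<phi>: "\<And>k::nat. test_field (interior R) (\<phi> k)"
      "(\<lambda>k. sq_norm lborel (\<lambda>x. jacobian (\<phi> k) (at x) - ?G x)) \<longlonglongrightarrow> 0"
      using H10_limit_field_gradient[OF g] unfolding H10_limit_sq_norm by auto
    have "eventually (\<lambda>k. sq_norm lborel (\<lambda>x. jacobian (\<phi> k) (at x) - ?G x) < 1) sequentially"
      using \<phi>(2) by (intro order_tendstoD) auto
    then obtain k where k: "sq_norm lborel (\<lambda>x. jacobian (\<phi> k) (at x) - ?G x) < 1"
      by (auto simp: eventually_sequentially)
    have s: "smooth_compact (\<phi> k)" using \<phi>(1) by (rule test_field_smooth_compact)
    note [measurable] = measurable_smooth_compact[OF s]
    have "sq_norm lborel ?G = sq_norm lborel (\<lambda>x. (?G x - jacobian (\<phi> k) (at x)) + jacobian (\<phi> k) (at x))" by simp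
    also have "\<dots> \<le> 2 * sq_norm lborel (\<lambda>x. ?G x - jacobian (\<phi> k) (at x)) + 2 * sq_norm lborel (\<lambda>x. jacobian (\<phi> k) (at x))"
      by (rule sq_norm_add_le) auto
    also have "\<dots> < \<infinity>"
    proof -
      have "sq_norm lborel (\<lambda>x. ?G x - jacobian (\<phi> k) (at x)) < \<infinity>"
        using k sq_norm_minus_commute[of lborel ?G "\<lambda>x. jacobian (\<phi> k) (at x)"]
        by (auto intro: less_trans)
      moreover have "sq_norm lborel (\<lambda>x. jacobian (\<phi> k) (at x)) < \<infinity>"
        using sq_norm_compact_support[OF continuous_on_jacobian[OF s] compact_support_jacobian[OF s]] by simp
      ultimately show ?thesis by (simp add: ennreal_mult_less_top)
    qed
    finally show ?thesis
      unfolding sq_norm_def by (intro integrableI_bounded) auto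
  qed
  have [measurable]: "field_gradient R g \<in> borel_measurable borel" "field_gradient R h \<in> borel_measurable borel"
    using g h by (auto intro: field_gradient_measurable)
  show ?thesis
  proof (rule Bochner_Integration.integrable_bound)
    show "integrable lborel (\<lambda>x. (norm (field_gradient R g x))\<^sup>2 + (norm (field_gradient R h x))\<^sup>2)"
      using sq g h by auto
    have "\<bar>a \<bullet> b\<bar> \<le> (norm a)\<^sup>2 + (norm b)\<^sup>2" for a b :: "real ^ 2 ^ 2"
    proof -
      have "\<bar>a \<bullet> b\<bar> \<le> norm a * norm b" by (rule Cauchy_Schwarz_ineq2)
      also have "\<dots> \<le> 2 * norm a * norm b" by simp
      also have "\<dots> \<le> (norm a)\<^sup>2 + (norm b)\<^sup>2" by (rule sum_squares_bound)
      finally show ?thesis .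
    qed
    then show "AE x in lborel. norm (field_gradient R g x \<bullet> field_gradient R h x)
        \<le> norm ((norm (field_gradient R g x))\<^sup>2 + (norm (field_gradient R h x))\<^sup>2)"
      by simp
  qed auto
qed

text \<open>\<open>H10_inner\<close> integrates over \<open>R\<close> only, so the hypothesis says
  nothing about the gradient off \<open>R\<close>. Poincare's inequality is therefore applied to the
  approximating test fields, whose Jacobians vanish there; these fields tend to 0 as well as to
  \<open>g\<close>.\<close>

lemma H10_inner_eq_0D:
  assumes R: "compact R" and g: "g \<in> H10 R" and zero: "H10_inner R g g = 0"
  shows "g = 0"
proof -
  let ?G = "field_gradient R g"
  have [measurable]: "R \<in> sets borel" using R by (auto intro: borel_compact)
  have [measurable]: "?G \<in> borel_measurable borel" using g by (rule field_gradient_measurable)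
  have "integrable lborel (\<lambda>x. indicator R x *\<^sub>R (?G x \<bullet> ?G x))"
    using integrable_field_gradient_inner[OF g g] by (intro integrable_mult_indicator) auto
  then have "AE x in lborel. indicator R x *\<^sub>R (?G x \<bullet> ?G x) = 0"
    using zero unfolding H10_inner_def set_lebesgue_integral_def
    by (subst (asm) integral_nonneg_eq_0_iff_AE) auto
  then have G0: "AE x in lborel. x \<in> R \<longrightarrow> ?G x = 0" by (auto simp: indicator_def)
  obtain r where r: "\<And>x. x \<in> R \<Longrightarrow> norm x \<le> r"
    using compact_imp_bounded[OF R] by (auto simp: bounded_iff)
  obtain \<phi> where \<phi>: "\<And>k::nat. test_field (interior R) (\<phi> k)"
    "(\<lambda>k. sq_norm lborel (\<lambda>x. \<phi> k x - rep_field g x)) \<longlonglongrightarrow> 0"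
    "(\<lambda>k. sq_norm lborel (\<lambda>x. jacobian (\<phi> k) (at x) - ?G x)) \<longlonglongrightarrow> 0"
    using H10_limit_field_gradient[OF g] unfolding H10_limit_sq_norm by auto
  have s: "smooth_compact (\<phi> k)" for k
    using \<phi>(1) by (auto intro: test_field_smooth_compact)
  note [measurable] = measurable_smooth_compact[OF s(1)]
  have off: "\<phi> k x = 0" if "x \<notin> R" for k x
  proof -
    have "{x. \<phi> k x \<noteq> 0} \<subseteq> R"
      using \<phi>(1)[of k] closure_subset[of "{x. \<phi> k x \<noteq> 0}"] interior_subset[of R]
      unfolding test_field_def by (elim conjE) (rule subset_trans, assumption, rule subset_trans)
    then show ?thesis using that by auto
  qed
  have offJ: "jacobian (\<phi> k) (at x) = 0" if "x \<notin> R" for k x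
    by (rule jacobian_eq_0[of "- R"]) (use that off compact_imp_closed[OF R] in auto)
  have bound: "sq_norm lborel (\<phi> k) \<le> ennreal (4 * r\<^sup>2) * sq_norm lborel (\<lambda>x. jacobian (\<phi> k) (at x) - ?G x)" for k
  proof -
    have "sq_norm lborel (\<phi> k) = ennreal (\<integral>x. (norm (\<phi> k x))\<^sup>2 \<partial>lborel)"
      using s[of k] smooth_compact_continuous[OF s] by (intro sq_norm_compact_support) (simp_all add: smooth_compact_def)
    also have "\<dots> \<le> ennreal (4 * r\<^sup>2 * (\<integral>x. (norm (jacobian (\<phi> k) (at x)))\<^sup>2 \<partial>lborel))"
    proof (intro ennreal_leI poincare_inequality s)
      show "\<phi> k x = 0" if "norm x > r" for x
        using off[of x k] r[of x] that by auto
    qed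
    also have "\<dots> = ennreal (4 * r\<^sup>2) * sq_norm lborel (\<lambda>x. jacobian (\<phi> k) (at x))"
      using sq_norm_compact_support[OF continuous_on_jacobian[OF s] compact_support_jacobian[OF s]]
      by (simp add: ennreal_mult)
    \<comment> \<open>Almost everywhere on \<open>R\<close> the gradient \<open>?G\<close> vanishes,
      and off \<open>R\<close> the Jacobian does, so the integrands compare pointwise.\<close>
    also have "sq_norm lborel (\<lambda>x. jacobian (\<phi> k) (at x)) \<le> sq_norm lborel (\<lambda>x. jacobian (\<phi> k) (at x) - ?G x)"
      unfolding sq_norm_def
    proof (rule nn_integral_mono_AE)
      show "AE x in lborel. ennreal ((norm (jacobian (\<phi> k) (at x)))\<^sup>2) \<le> ennreal ((norm (jacobian (\<phi> k) (at x) - ?G x))\<^sup>2)"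
        using G0
      proof eventually_elim
        case (elim x)
        then show ?case using offJ[of x k] by (cases "x \<in> R") auto
      qed
    qed
    finally show ?thesis by (simp add: mult_left_mono)
  qed
  have "(\<lambda>k. sq_norm lborel (\<phi> k)) \<longlonglongrightarrow> 0"
  proof (rule tendsto_sandwich[of "\<lambda>_. 0"])
    have "(\<lambda>k. ennreal (4 * r\<^sup>2) * sq_norm lborel (\<lambda>x. jacobian (\<phi> k) (at x) - ?G x)) \<longlonglongrightarrow> ennreal (4 * r\<^sup>2) * 0"
      by (intro ennreal_tendsto_cmult \<phi>) auto
    then show "(\<lambda>k. ennreal (4 * r\<^sup>2) * sq_norm lborel (\<lambda>x. jacobian (\<phi> k) (at x) - ?G x)) \<longlonglongrightarrow> 0" by simp
  qed (use bound in auto)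
  then have "(\<lambda>k. sq_norm lborel (\<lambda>x. (-1) *\<^sub>R (\<phi> k x - rep_field g x) + \<phi> k x)) \<longlonglongrightarrow> 0"
    by (intro sq_norm_tendsto_0_add sq_norm_tendsto_0_scaleR \<phi>) auto
  then have "sq_norm lborel (rep_field g) = 0"
    by (simp add: LIMSEQ_const_iff)
  then have "AE x in lborel. rep_field g x = 0"
    by (subst (asm) sq_norm_eq_0_iff) auto
  with rep_field_zero show ?thesis
    unfolding plane_field_eq_iff by eventually_elim simp
qed

lemma inner_product_on_H10_inner:
  assumes R: "compact R" and F: "subspace F" "\<exists>S. finite S \<and> span S = F" "F \<subseteq> H10 R"
  shows "inner_product_on F (H10_inner R)"
proof
  have [measurable]: "R \<in> sets borel" using R by (auto intro: borel_compact)
  fix f g h :: plane_field and c :: real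
  have int: "integrable lborel (\<lambda>x. indicator R x *\<^sub>R (field_gradient R f x \<bullet> field_gradient R h x))"
    if "f \<in> F" "h \<in> F" for f h
    using integrable_field_gradient_inner[of f R h] that F(3) by (intro integrable_mult_indicator) auto
  have meas: "field_gradient R f \<in> borel_measurable borel" if "f \<in> F" for f
    using that F(3) by (intro field_gradient_measurable) auto
  show "H10_inner R (f + g) h = H10_inner R f h + H10_inner R g h" if "f \<in> F" "g \<in> F" "h \<in> F"
  proof -
    have [measurable]: "field_gradient R f \<in> borel_measurable borel" "field_gradient R g \<in> borel_measurable borel"
      "field_gradient R h \<in> borel_measurable borel" "field_gradient R (f + g) \<in> borel_measurable borel"
      by (intro meas that subspace_add F(1))+
    have "H10_inner R (f + g) h = (\<integral>x. indicator R x *\<^sub>R (field_gradient R f x \<bullet> field_gradient R h x)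
        + indicator R x *\<^sub>R (field_gradient R g x \<bullet> field_gradient R h x) \<partial>lborel)"
      unfolding H10_inner_def set_lebesgue_integral_def
    proof (rule integral_cong_AE)
      have "f \<in> H10 R" "g \<in> H10 R" using that F(3) by auto
      from field_gradient_add[OF this]
      show "AE x in lborel. indicator R x *\<^sub>R (field_gradient R (f + g) x \<bullet> field_gradient R h x)
          = indicator R x *\<^sub>R (field_gradient R f x \<bullet> field_gradient R h x)
            + indicator R x *\<^sub>R (field_gradient R g x \<bullet> field_gradient R h x)"
        by eventually_elim (simp add: inner_add_left algebra_simps)
    qed measurable
    then show ?thesis
      using int that by (simp add: H10_inner_def set_lebesgue_integral_def)
  qed
  show "H10_inner R (c *\<^sub>R f) h = c * H10_inner R f h" if "f \<in> F" "h \<in> F"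
  proof -
    have [measurable]: "field_gradient R f \<in> borel_measurable borel"
      "field_gradient R h \<in> borel_measurable borel" "field_gradient R (c *\<^sub>R f) \<in> borel_measurable borel"
      by (intro meas that subspace_scale F(1))+
    have "H10_inner R (c *\<^sub>R f) h = (\<integral>x. c * (indicator R x *\<^sub>R (field_gradient R f x \<bullet> field_gradient R h x)) \<partial>lborel)"
      unfolding H10_inner_def set_lebesgue_integral_def
    proof (rule integral_cong_AE)
      have "f \<in> H10 R" using that F(3) by auto
      from field_gradient_scaleR[OF this, of c]
      show "AE x in lborel. indicator R x *\<^sub>R (field_gradient R (c *\<^sub>R f) x \<bullet> field_gradient R h x)
          = c * (indicator R x *\<^sub>R (field_gradient R f x \<bullet> field_gradient R h x))"
        by eventually_elim simp
    qed measurable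
    then show ?thesis
      by (simp add: H10_inner_def set_lebesgue_integral_def)
  qed
  show "H10_inner R f g = H10_inner R g f"
    by (simp add: H10_inner_def inner_commute)
  show "H10_inner R f f > 0" if "f \<in> F" "f \<noteq> 0"
  proof -
    have "H10_inner R f f \<noteq> 0" using H10_inner_eq_0D[OF R] that F(3) by blast
    moreover have "H10_inner R f f \<ge> 0"
      unfolding H10_inner_def set_lebesgue_integral_def by (rule integral_nonneg_AE) auto
    ultimately show ?thesis by simp
  qed
qed (use F in auto)

section \<open>Superposition of dislocation solutions\<close>

text \<open>The linear relation is assumed only on an open set, so that the rule can be iterated:
  relations between first derivatives hold only inside the domain, yet they can be differentiated
  again there.\<close>

lemma pderivative_lin:
  fixes f f\<^sub>1 f\<^sub>2 :: "real ^ 'n \<Rightarrow> 'b::real_normed_vector"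
  assumes "open S" "x \<in> S" "f\<^sub>1 differentiable (at x)" "f\<^sub>2 differentiable (at x)"
    and "\<And>y. y \<in> S \<Longrightarrow> f y = c *\<^sub>R f\<^sub>1 y + f\<^sub>2 y"
  shows "pderivative i f x = c *\<^sub>R pderivative i f\<^sub>1 x + pderivative i f\<^sub>2 x"
    and "f differentiable (at x)"
proof -
  have "((\<lambda>y. c *\<^sub>R f\<^sub>1 y + f\<^sub>2 y) has_derivative
      (\<lambda>h. c *\<^sub>R frechet_derivative f\<^sub>1 (at x) h + frechet_derivative f\<^sub>2 (at x) h)) (at x)"
    using assms(3,4) unfolding frechet_derivative_works
    by (intro has_derivative_add has_derivative_scaleR_right)
  from has_derivative_transform_within_open[OF this assms(1,2) assms(5)[symmetric]]
  have D: "(f has_derivative (\<lambda>h. c *\<^sub>R frechet_derivative f\<^sub>1 (at x) h + frechet_derivative f\<^sub>2 (at x) h)) (at x)" .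
  show "pderivative i f x = c *\<^sub>R pderivative i f\<^sub>1 x + pderivative i f\<^sub>2 x"
    unfolding pderivative_def frechet_derivative_at[OF D, symmetric] ..
  show "f differentiable (at x)" using D by (rule differentiableI)
qed

context
  fixes \<Omega> :: "(real ^ 'n) set" and u :: "real ^ 'n \<Rightarrow> 'b::real_normed_vector"
  assumes \<Omega>: "open \<Omega>" and C2: "Ck_on 2 u \<Omega>"
begin

lemma C2_differentiable: "x \<in> \<Omega> \<Longrightarrow> u differentiable (at x)"
  using C2 by (simp add: numeral_2_eq_2 differentiable_on_eq_differentiable_at[OF \<Omega>])

lemma C2_continuous: "continuous_on \<Omega> u"
  using C2 by (auto simp: numeral_2_eq_2 intro: differentiable_imp_continuous_on)

lemma C2_pderivative_differentiable:
  assumes "x \<in> \<Omega>" shows "pderivative j u differentiable (at x)"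
proof -
  have "(\<lambda>x. frechet_derivative u (at x) (axis j 1)) differentiable_on \<Omega>"
    using C2 by (simp add: numeral_2_eq_2 axis_in_Basis_iff)
  then show ?thesis
    using assms by (simp add: differentiable_on_eq_differentiable_at[OF \<Omega>] pderivative_def[abs_def])
qed

lemma C2_pderivative_continuous: "continuous_on \<Omega> (pderivative j u)"
  using C2_pderivative_differentiable
  by (auto intro!: differentiable_imp_continuous_on simp: differentiable_on_eq_differentiable_at[OF \<Omega>])

end

lemma differentiable_divergence:
  fixes u :: "real ^ 'n \<Rightarrow> real ^ 'n"
  assumes "open \<Omega>" "Ck_on 2 u \<Omega>" "x \<in> \<Omega>"
  shows "divergence u differentiable (at x)"
  unfolding divergence_def[abs_def]
proof (rule differentiable_sum)
  show "\<forall>i\<in>UNIV. (\<lambda>x. pderivative i u x $ i) differentiable (at x)"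
  proof
    fix i
    from C2_pderivative_differentiable[OF assms, of i]
    have "(pderivative i u has_derivative frechet_derivative (pderivative i u) (at x)) (at x)"
      unfolding frechet_derivative_works .
    from bounded_linear.has_derivative[OF bounded_linear_vec_nth this, of i]
    show "(\<lambda>x. pderivative i u x $ i) differentiable (at x)" by (rule differentiableI)
  qed
qed simp

context
  fixes \<Omega> :: "(real ^ 'n) set" and u v :: "real ^ 'n \<Rightarrow> real ^ 'n" and c :: real
  assumes \<Omega>: "open \<Omega>" and u: "Ck_on 2 u \<Omega>" and v: "Ck_on 2 v \<Omega>"
begin

lemma pderivative_superposition: "x \<in> \<Omega> \<Longrightarrow> pderivative i (\<lambda>x. c *\<^sub>R u x + v x) x = c *\<^sub>R pderivative i u x + pderivative i v x"
  using C2_differentiable[OF \<Omega> u] C2_differentiable[OF \<Omega> v]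
  by (intro pderivative_lin(1)[OF \<Omega>]) auto

lemma jacobian_superposition: "x \<in> \<Omega> \<Longrightarrow> jacobian (\<lambda>x. c *\<^sub>R u x + v x) (at x) = c *\<^sub>R jacobian u (at x) + jacobian v (at x)"
  by (simp add: jacobian_eq_pderivative pderivative_superposition Finite_Cartesian_Product.vec_eq_iff)

lemma laplacian_superposition: "x \<in> \<Omega> \<Longrightarrow> laplacian (\<lambda>x. c *\<^sub>R u x + v x) x = c *\<^sub>R laplacian u x + laplacian v x"
proof -
  assume x: "x \<in> \<Omega>"
  have "pderivative i (pderivative i (\<lambda>x. c *\<^sub>R u x + v x)) x
      = c *\<^sub>R pderivative i (pderivative i u) x + pderivative i (pderivative i v) x" for i
    by (rule pderivative_lin(1)[OF \<Omega> x C2_pderivative_differentiable[OF \<Omega> u x] C2_pderivative_differentiable[OF \<Omega> v x]])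
       (rule pderivative_superposition)
  then show ?thesis by (simp add: laplacian_def sum.distrib scaleR_sum_right)
qed

lemma divergence_superposition: "x \<in> \<Omega> \<Longrightarrow> divergence (\<lambda>x. c *\<^sub>R u x + v x) x = c *\<^sub>R divergence u x + divergence v x"
  by (simp add: divergence_def pderivative_superposition sum.distrib sum_distrib_left)

lemma gradient_divergence_superposition:
  "x \<in> \<Omega> \<Longrightarrow> gradient (divergence (\<lambda>x. c *\<^sub>R u x + v x)) x = c *\<^sub>R gradient (divergence u) x + gradient (divergence v) x"
  using pderivative_lin(1)[OF \<Omega> _ differentiable_divergence[OF \<Omega> u] differentiable_divergence[OF \<Omega> v] divergence_superposition]
  by (simp add: gradient_def Finite_Cartesian_Product.vec_eq_iff)

end

lemma traction_superposition:
  assumes "open \<Omega>" "Ck_on 2 u \<Omega>" "Ck_on 2 v \<Omega>" "x \<in> \<Omega>"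
  shows "traction lam mu n (\<lambda>x. c *\<^sub>R u x + v x) x = c *\<^sub>R traction lam mu n u x + traction lam mu n v x"
proof -
  have "stress lam mu (\<lambda>x. c *\<^sub>R u x + v x) x = c *\<^sub>R stress lam mu u x + stress lam mu v x"
    using divergence_superposition[OF assms(1-4), of c] pderivative_superposition[OF assms(1-4), where c = c]
    by (simp add: stress_def Finite_Cartesian_Product.vec_eq_iff algebra_simps)
  then show ?thesis
    by (simp add: traction_def matrix_vector_mult_add_rdistrib scaleR_matrix_vector_assoc)
qed

lemma continuous_on_traction:
  assumes "open \<Omega>" "Ck_on 2 u \<Omega>"
  shows "continuous_on \<Omega> (traction lam mu n u)"
proof -
  have "continuous_on \<Omega> (stress lam mu u)"
    unfolding stress_def[abs_def] divergence_def[abs_def]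
    by (intro continuous_on_vec_lambda continuous_intros continuous_on_component C2_pderivative_continuous assms)
  then show ?thesis
    unfolding traction_def[abs_def] matrix_vector_mult_def
    by (intro continuous_on_vec_lambda continuous_intros continuous_on_component)
qed

text \<open>Integrability of the squared norms does not make the fields themselves measurable;
  continuity on the open set supplies measurability of the combination, and domination does the
  rest.\<close>

lemma set_integrable_norm_power2_lin:
  fixes f g :: "'a::euclidean_space \<Rightarrow> 'b::euclidean_space"
  assumes \<Omega>: "open \<Omega>" and cont: "continuous_on \<Omega> f" "continuous_on \<Omega> g"
    and int: "set_integrable lborel \<Omega> (\<lambda>x. (norm (f x))\<^sup>2)" "set_integrable lborel \<Omega> (\<lambda>x. (norm (g x))\<^sup>2)"
  shows "set_integrable lborel \<Omega> (\<lambda>x. (norm (c *\<^sub>R f x + g x))\<^sup>2)"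
  unfolding set_integrable_def
proof (rule Bochner_Integration.integrable_bound)
  show "integrable lborel (\<lambda>x. 2 * c\<^sup>2 * (indicator \<Omega> x *\<^sub>R (norm (f x))\<^sup>2) + 2 * (indicator \<Omega> x *\<^sub>R (norm (g x))\<^sup>2))"
    using int unfolding set_integrable_def
    by (intro Bochner_Integration.integrable_add integrable_mult_right)
  have "continuous_on \<Omega> (\<lambda>x. (norm (c *\<^sub>R f x + g x))\<^sup>2)"
    by (intro continuous_intros cont)
  from borel_measurable_continuous_on_indicator[OF _ this]
  show "(\<lambda>x. indicator \<Omega> x *\<^sub>R (norm (c *\<^sub>R f x + g x))\<^sup>2) \<in> borel_measurable lborel"
    using \<Omega> by simp
  have "(norm (c *\<^sub>R f x + g x))\<^sup>2 \<le> 2 * c\<^sup>2 * (norm (f x))\<^sup>2 + 2 * (norm (g x))\<^sup>2" for x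
    using norm_add_power2_le[of "c *\<^sub>R f x" "g x"] by (simp add: power_mult_distrib)
  then show "AE x in lborel. norm (indicator \<Omega> x *\<^sub>R (norm (c *\<^sub>R f x + g x))\<^sup>2)
      \<le> norm (2 * c\<^sup>2 * (indicator \<Omega> x *\<^sub>R (norm (f x))\<^sup>2) + 2 * (indicator \<Omega> x *\<^sub>R (norm (g x))\<^sup>2))"
    by (intro always_eventually allI) (auto simp: indicator_def)
qed

lemma energy_space_superposition:
  assumes \<Omega>: "open \<Omega>" and u: "Ck_on 2 u \<Omega>" and v: "Ck_on 2 v \<Omega>"
    and "u \<in> energy_space \<Omega>" "v \<in> energy_space \<Omega>"
  shows "(\<lambda>x. c *\<^sub>R u x + v x) \<in> energy_space \<Omega>"
proof -
  have cJ: "continuous_on \<Omega> (\<lambda>x. jacobian u (at x))" if "Ck_on 2 u \<Omega>" for u :: "real ^ 3 \<Rightarrow> real ^ 3"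
    unfolding jacobian_eq_pderivative
    by (intro continuous_on_vec_lambda continuous_on_component C2_pderivative_continuous[OF \<Omega> that])
  have cw: "continuous_on \<Omega> (\<lambda>x. u x /\<^sub>R sqrt (1 + (norm x)\<^sup>2))" if "Ck_on 2 u \<Omega>" for u :: "real ^ 3 \<Rightarrow> real ^ 3"
  proof (intro continuous_intros C2_continuous[OF \<Omega> that] ballI)
    fix x :: "real ^ 3"
    have "1 + (norm x)\<^sup>2 > 0" by (simp add: add_pos_nonneg)
    then show "sqrt (1 + (norm x)\<^sup>2) \<noteq> 0" by simp
  qed
  have "set_integrable lborel \<Omega> (\<lambda>x. (norm (c *\<^sub>R jacobian u (at x) + jacobian v (at x)))\<^sup>2)"
    using assms by (intro set_integrable_norm_power2_lin cJ) (auto simp: energy_space_def)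
  then have 1: "set_integrable lborel \<Omega> (\<lambda>x. (norm (jacobian (\<lambda>x. c *\<^sub>R u x + v x) (at x)))\<^sup>2)"
    using jacobian_superposition[OF \<Omega> u v]
    by (simp cong: set_integrable_cong)
  have "set_integrable lborel \<Omega> (\<lambda>x. (norm (c *\<^sub>R (u x /\<^sub>R sqrt (1 + (norm x)\<^sup>2)) + v x /\<^sub>R sqrt (1 + (norm x)\<^sup>2)))\<^sup>2)"
    using assms by (intro set_integrable_norm_power2_lin cw) (auto simp: energy_space_def)
  then have 2: "set_integrable lborel \<Omega> (\<lambda>x. (norm ((c *\<^sub>R u x + v x) /\<^sub>R sqrt (1 + (norm x)\<^sup>2)))\<^sup>2)"
    by (simp add: scaleR_add_right mult.commute)
  show ?thesis using 1 2 by (simp add: energy_space_def)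
qed

section \<open>Geometry of the rectangle and of the fault\<close>

lemma compact_closed_rectangle:
  assumes "closed_rectangle R"
  shows "compact R"
proof -
  obtain p v w where R: "R = {p + s *\<^sub>R v + t *\<^sub>R w |s t. s \<in> {0..1} \<and> t \<in> {0..1}}"
    using assms unfolding closed_rectangle_def by blast
  have "R = (\<lambda>(s, t). p + s *\<^sub>R v + t *\<^sub>R w) ` ({0..1::real} \<times> {0..1::real})"
    unfolding R by (auto simp: image_iff) blast
  moreover have "compact ((\<lambda>(s, t). p + s *\<^sub>R v + t *\<^sub>R w) ` ({0..1::real} \<times> {0..1::real}))"
    unfolding case_prod_unfold
    by (intro compact_continuous_image continuous_intros compact_Times) auto
  ultimately show ?thesis by simp
qed

lemma continuous_on_fault_point: "continuous_on S (fault_point m)"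
proof -
  have "continuous_on S (\<lambda>y. fault_point m y $ i)" for i
  proof -
    have eqs: "(\<lambda>y. fault_point m y $ 1) = (\<lambda>y. y $ 1)" "(\<lambda>y. fault_point m y $ 2) = (\<lambda>y. y $ 2)"
      "(\<lambda>y. fault_point m y $ 3) = (\<lambda>y. m $ 1 * y $ 1 + m $ 2 * y $ 2 + m $ 3)"
      by (simp_all add: fault_point_def)
    consider "i = 1" | "i = 2" | "i = 3" using exhaust_3[of i] by blast
    then show ?thesis
      by cases (simp_all only: eqs, (intro continuous_intros continuous_on_id)+)
  qed
  then show ?thesis
    using continuous_on_vec_lambda[of S "\<lambda>i y. fault_point m y $ i"] by simp
qed

text \<open>By compactness the fault keeps a positive distance from the boundary of the half-space,
  and moving along the normal leaves the plane of the fault. For small offsets the traces thus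
  sample the solution only inside its open domain, where it is regular.\<close>

lemma fault_point_normal_offset:
  assumes R: "compact R" and fault: "fault m R \<subseteq> lower_halfspace"
  shows "eventually (\<lambda>t. \<forall>y\<in>R. fault_point m y + t *\<^sub>R fault_normal m \<in> lower_halfspace - fault m R \<and>
           fault_point m y - t *\<^sub>R fault_normal m \<in> lower_halfspace - fault m R) (at_right 0)"
proof -
  define s where "s = sqrt (1 + (m $ 1)\<^sup>2 + (m $ 2)\<^sup>2)"
  have s2: "1 + (m $ 1)\<^sup>2 + (m $ 2)\<^sup>2 > 0" by (simp add: add_pos_nonneg)
  then have s: "s > 0" "s\<^sup>2 = 1 + (m $ 1)\<^sup>2 + (m $ 2)\<^sup>2" by (auto simp: s_def)
  let ?n = "fault_normal m"
  have n: "?n $ 1 = - m $ 1 / s" "?n $ 2 = - m $ 2 / s" "?n $ 3 = 1 / s"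
    by (simp_all add: fault_normal_def s_def)
  \<comment> \<open>An affine function that equals \<open>m $ 3\<close> on the plane of the fault
    and grows with slope \<open>s > 0\<close> along the normal; it detects leaving the
    fault.\<close>
  define lev where "lev x = x $ 3 - m $ 1 * x $ 1 - m $ 2 * x $ 2" for x :: "real ^ 3"
  have lev_fault: "lev x = m $ 3" if "x \<in> fault m R" for x
    using that by (auto simp: fault_def fault_point_def lev_def)
  have lev_offset: "lev (x + t *\<^sub>R ?n) = lev x + t * s" for x t
  proof -
    have "lev (x + t *\<^sub>R ?n) = lev x + t * ((1 + (m $ 1)\<^sup>2 + (m $ 2)\<^sup>2) / s)"
      by (simp add: lev_def n power2_eq_square algebra_simps add_divide_distrib)
    also have "(1 + (m $ 1)\<^sup>2 + (m $ 2)\<^sup>2) / s = s"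
      using s by (metis nonzero_eq_divide_eq less_irrefl power2_eq_square)
    finally show ?thesis .
  qed
  have "compact (fault m R)"
    unfolding fault_def by (intro compact_continuous_image continuous_on_fault_point R)
  moreover have "open lower_halfspace"
    unfolding lower_halfspace_def by (intro open_Collect_less continuous_intros)
  ultimately obtain e where e: "e > 0" "(\<Union>x\<in>fault m R. ball x e) \<subseteq> lower_halfspace"
    using fault by (rule compact_subset_open_imp_ball_epsilon_subset)
  \<comment> \<open>The denominator \<open>1 + norm ?n\<close> is positive and gives
    \<open>norm (t *\<^sub>R ?n) < e\<close> without computing the norm of the normal.\<close>
  have "eventually (\<lambda>t::real. 0 < t \<and> t < e / (1 + norm ?n)) (at_right 0)"
    using e(1) by (intro eventually_conj eventually_at_right_less eventually_at_rightI[of 0 "e / (1 + norm ?n)"])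
      (auto simp: add_pos_nonneg)
  then show ?thesis
  proof eventually_elim
    case (elim t)
    have *: "fault_point m y + r *\<^sub>R ?n \<in> lower_halfspace - fault m R" if "y \<in> R" "\<bar>r\<bar> = t" for y r
    proof -
      have y: "fault_point m y \<in> fault m R" using that by (simp add: fault_def)
      have "norm (r *\<^sub>R ?n) \<le> t * (1 + norm ?n)" using that elim by simp
      also have "\<dots> < e" using elim by (simp add: pos_less_divide_eq add_pos_nonneg)
      finally have "fault_point m y + r *\<^sub>R ?n \<in> ball (fault_point m y) e" by (simp add: dist_norm)
      moreover have "fault_point m y + r *\<^sub>R ?n \<notin> fault m R"
      proof
        assume "fault_point m y + r *\<^sub>R ?n \<in> fault m R"
        then have "r * s = 0" using lev_fault lev_fault[OF y] lev_offset by fastforce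
        then show False using s that elim by auto
      qed
      ultimately show ?thesis using e(2) y by blast
    qed
    show ?case using *[of _ t] *[of _ "- t"] elim by auto
  qed
qed

lemma tangential_field_lin: "tangential_field m (c *\<^sub>R a + b) = c *\<^sub>R tangential_field m a + tangential_field m b"
  by (simp add: tangential_field_def algebra_simps)

lemma tangential_field_measurable [measurable]: "tangential_field m \<in> borel_measurable borel"
  unfolding tangential_field_def by measurable

text \<open>The offset traces are known to be measurable only for small offsets. Replacing the
  functions by 0 at the bad parameters changes no limit and makes measurability
  unconditional.\<close>

lemma sq_norm_tendsto_0_lin:
  fixes f g :: "'i \<Rightarrow> 'a \<Rightarrow> 'b::{real_normed_vector, second_countable_topology}"
  assumes meas: "eventually (\<lambda>k. f k \<in> borel_measurable M \<and> g k \<in> borel_measurable M) L"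
    and lim: "((\<lambda>k. sq_norm M (f k)) \<longlongrightarrow> 0) L" "((\<lambda>k. sq_norm M (g k)) \<longlongrightarrow> 0) L"
  shows "((\<lambda>k. sq_norm M (\<lambda>x. c *\<^sub>R f k x + g k x)) \<longlongrightarrow> 0) L"
proof -
  define good where "good k \<longleftrightarrow> f k \<in> borel_measurable M \<and> g k \<in> borel_measurable M" for k
  define f' where "f' k = (if good k then f k else (\<lambda>_. 0))" for k
  define g' where "g' k = (if good k then g k else (\<lambda>_. 0))" for k
  have ev: "eventually (\<lambda>k. f' k = f k \<and> g' k = g k) L"
    using meas by eventually_elim (simp add: f'_def g'_def good_def)
  have "((\<lambda>k. sq_norm M (f' k)) \<longlongrightarrow> 0) L"
    by (rule Lim_transform_eventually[OF lim(1)]) (use ev in eventually_elim, simp)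
  moreover have "((\<lambda>k. sq_norm M (g' k)) \<longlongrightarrow> 0) L"
    by (rule Lim_transform_eventually[OF lim(2)]) (use ev in eventually_elim, simp)
  ultimately have "((\<lambda>k. sq_norm M (\<lambda>x. c *\<^sub>R f' k x + g' k x)) \<longlongrightarrow> 0) L"
    by (intro sq_norm_tendsto_0_add sq_norm_tendsto_0_scaleR) (auto simp: f'_def g'_def good_def)
  then show ?thesis
    by (rule Lim_transform_eventually) (use ev in eventually_elim, simp)
qed

text \<open>Every condition is linear, but splitting the integrals across the fault needs
  integrability, or measurability, at a fixed offset. Both come from continuity inside the domain,
  hence hold for small offsets, which is all that a limit at 0 sees.\<close>

lemma dislocation_solution_superposition:
  assumes R: "compact R" and fault: "fault m R \<subseteq> lower_halfspace"
    and u: "dislocation_solution lam mu R m g u" and v: "dislocation_solution lam mu R m h v"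
  shows "dislocation_solution lam mu R m (c *\<^sub>R g + h) (\<lambda>x. c *\<^sub>R u x + v x)"
proof -
  define \<Omega> where "\<Omega> = lower_halfspace - fault m R"
  let ?n = "fault_normal m"
  let ?w = "\<lambda>x. c *\<^sub>R u x + v x"
  note u = u[unfolded dislocation_solution_def Let_def, folded \<Omega>_def]
  note v = v[unfolded dislocation_solution_def Let_def, folded \<Omega>_def]
  have compact: "compact (fault m R)"
    unfolding fault_def by (intro compact_continuous_image continuous_on_fault_point R)
  then have closed: "closed (fault m R)" by (rule compact_imp_closed)
  have \<Omega>: "open \<Omega>"
    unfolding \<Omega>_def lower_halfspace_def
    by (intro open_Diff closed open_Collect_less continuous_intros)
  have R_borel [measurable]: "R \<in> sets borel" using R by (rule borel_compact)
  have C2: "Ck_on 2 u \<Omega>" "Ck_on 2 v \<Omega>" using u v by auto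
  have offset: "eventually (\<lambda>t. \<forall>y\<in>R. fault_point m y + t *\<^sub>R ?n \<in> \<Omega> \<and> fault_point m y - t *\<^sub>R ?n \<in> \<Omega>) (at_right 0)"
    unfolding \<Omega>_def by (rule fault_point_normal_offset[OF R fault])
  have cont_offset: "continuous_on R (\<lambda>y. f (fault_point m y + t *\<^sub>R ?n) - f (fault_point m y - t *\<^sub>R ?n))"
    if "continuous_on \<Omega> f" "\<forall>y\<in>R. fault_point m y + t *\<^sub>R ?n \<in> \<Omega> \<and> fault_point m y - t *\<^sub>R ?n \<in> \<Omega>"
    for f :: "real ^ 3 \<Rightarrow> real ^ 3" and t
    using that(2) by (intro continuous_on_diff continuous_on_compose2[OF that(1)] continuous_intros continuous_on_fault_point) auto
  let ?jump = "\<lambda>f t y. f (fault_point m y + t *\<^sub>R ?n) - f (fault_point m y - t *\<^sub>R ?n)"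
  let ?T = "\<lambda>u. traction lam mu ?n u"

  have "?w \<in> energy_space \<Omega>"
    using energy_space_superposition[OF \<Omega> C2] u v by simp
  moreover have "Ck_on 2 ?w \<Omega>"
    by (intro Ck_on_add Ck_on_scaleR \<Omega> C2)
  moreover have "continuous_on (\<Omega> \<union> surface_plane) ?w"
    using u v by (intro continuous_intros) auto
  moreover have "\<forall>x. x \<notin> \<Omega> \<union> surface_plane \<longrightarrow> ?w x = 0"
    using u v by auto
  moreover have "\<forall>x\<in>\<Omega>. mu *\<^sub>R laplacian ?w x + (lam + mu) *\<^sub>R gradient (divergence ?w) x = 0"
  proof
    fix x assume x: "x \<in> \<Omega>"
    have "mu *\<^sub>R laplacian ?w x + (lam + mu) *\<^sub>R gradient (divergence ?w) x
       = c *\<^sub>R (mu *\<^sub>R laplacian u x + (lam + mu) *\<^sub>R gradient (divergence u) x)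
         + (mu *\<^sub>R laplacian v x + (lam + mu) *\<^sub>R gradient (divergence v) x)"
      unfolding laplacian_superposition[OF \<Omega> C2 x] gradient_divergence_superposition[OF \<Omega> C2 x]
      by (simp add: algebra_simps)
    then show "mu *\<^sub>R laplacian ?w x + (lam + mu) *\<^sub>R gradient (divergence ?w) x = 0"
      using u v x by simp
  qed
  moreover have "\<forall>x\<in>surface_plane. (traction lam mu (vector [0, 0, 1]) ?w \<longlongrightarrow> 0) (at x within lower_halfspace)"
  proof
    fix x assume x: "x \<in> surface_plane"
    let ?e = "vector [0, 0, 1] :: real ^ 3"
    have "((\<lambda>y. c *\<^sub>R traction lam mu ?e u y + traction lam mu ?e v y) \<longlongrightarrow> c *\<^sub>R 0 + 0) (at x within lower_halfspace)"
      using u v x by (intro tendsto_intros) auto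
    then have *: "((\<lambda>y. c *\<^sub>R traction lam mu ?e u y + traction lam mu ?e v y) \<longlongrightarrow> 0) (at x within lower_halfspace)"
      by simp
    \<comment> \<open>The closed fault lies strictly below the plane, so half-space points near
      \<open>x\<close> belong to the domain, where the traction is linear in the field.\<close>
    have "x \<in> - fault m R" "open (- fault m R)"
      using x fault closed by (auto simp: surface_plane_def lower_halfspace_def)
    then have "eventually (\<lambda>y. y \<in> - fault m R) (nhds x)"
      by (intro eventually_nhds_in_open)
    then have "eventually (\<lambda>y. y \<in> \<Omega>) (at x within lower_halfspace)"
      by (auto simp: eventually_at_filter \<Omega>_def elim: eventually_mono)
    then have "eventually (\<lambda>y. c *\<^sub>R traction lam mu ?e u y + traction lam mu ?e v y = traction lam mu ?e ?w y) (at x within lower_halfspace)"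
      by eventually_elim (simp add: traction_superposition[OF \<Omega> C2])
    from Lim_transform_eventually[OF * this]
    show "(traction lam mu ?e ?w \<longlongrightarrow> 0) (at x within lower_halfspace)" .
  qed
  moreover have "\<forall>\<phi> :: real ^ 2 \<Rightarrow> real ^ 3. test_field (interior R) \<phi> \<longrightarrow>
          ((\<lambda>t. LINT y:R|lborel. ?jump (?T ?w) t y \<bullet> \<phi> y) \<longlongrightarrow> 0) (at_right 0)"
  proof (intro allI impI)
    fix \<phi> :: "real ^ 2 \<Rightarrow> real ^ 3" assume \<phi>: "test_field (interior R) \<phi>"
    have "((\<lambda>t. c * (LINT y:R|lborel. ?jump (?T u) t y \<bullet> \<phi> y) + (LINT y:R|lborel. ?jump (?T v) t y \<bullet> \<phi> y))
        \<longlongrightarrow> c * 0 + 0) (at_right 0)"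
      using u v \<phi> by (intro tendsto_intros) auto
    then have *: "((\<lambda>t. c * (LINT y:R|lborel. ?jump (?T u) t y \<bullet> \<phi> y) + (LINT y:R|lborel. ?jump (?T v) t y \<bullet> \<phi> y))
        \<longlongrightarrow> 0) (at_right 0)" by simp
    from offset have "eventually (\<lambda>t. c * (LINT y:R|lborel. ?jump (?T u) t y \<bullet> \<phi> y) + (LINT y:R|lborel. ?jump (?T v) t y \<bullet> \<phi> y)
        = (LINT y:R|lborel. ?jump (?T ?w) t y \<bullet> \<phi> y)) (at_right 0)"
    proof eventually_elim
      case (elim t)
      \<comment> \<open>For such \<open>t\<close> both offset copies of \<open>R\<close> lie in the
        domain, so the integrand is continuous on a compact set.\<close>
      have int: "set_integrable lborel R (\<lambda>y. ?jump (?T u) t y \<bullet> \<phi> y)" if "Ck_on 2 u \<Omega>" for u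
        unfolding set_integrable_def
        using smooth_compact_continuous[OF test_field_smooth_compact[OF \<phi>]]
        by (intro borel_integrable_compact R continuous_on_inner cont_offset continuous_on_traction \<Omega> that elim)
           (auto intro: continuous_on_subset)
      have "(LINT y:R|lborel. ?jump (?T ?w) t y \<bullet> \<phi> y)
          = (LINT y:R|lborel. c * (?jump (?T u) t y \<bullet> \<phi> y) + ?jump (?T v) t y \<bullet> \<phi> y)"
      proof (rule set_lebesgue_integral_cong, simp, intro allI impI)
        fix y assume y: "y \<in> R"
        have "?jump (?T ?w) t y = c *\<^sub>R ?jump (?T u) t y + ?jump (?T v) t y"
          unfolding traction_superposition[OF \<Omega> C2 conjunct1[OF bspec[OF elim y]]]
            traction_superposition[OF \<Omega> C2 conjunct2[OF bspec[OF elim y]]]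
          by (simp add: algebra_simps)
        then show "?jump (?T ?w) t y \<bullet> \<phi> y = c * (?jump (?T u) t y \<bullet> \<phi> y) + ?jump (?T v) t y \<bullet> \<phi> y"
          by (simp only: inner_add_left inner_scaleR_left)
      qed
      also have "\<dots> = c * (LINT y:R|lborel. ?jump (?T u) t y \<bullet> \<phi> y) + (LINT y:R|lborel. ?jump (?T v) t y \<bullet> \<phi> y)"
        using int[OF C2(1)] int[OF C2(2)] by (simp add: set_integral_add)
      finally show ?case by simp
    qed
    from Lim_transform_eventually[OF * this]
    show "((\<lambda>t. LINT y:R|lborel. ?jump (?T ?w) t y \<bullet> \<phi> y) \<longlongrightarrow> 0) (at_right 0)" .
  qed
  moreover have "((\<lambda>t. \<integral>\<^sup>+ y\<in>R. ennreal ((norm (?jump ?w t y - tangential_field m (rep_field (c *\<^sub>R g + h) y)))\<^sup>2) \<partial>lborel)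
          \<longlongrightarrow> 0) (at_right 0)"
  proof -
    \<comment> \<open>Multiplying by the indicator turns the integral over \<open>R\<close> into a
      \<open>sq_norm\<close> on the whole plane.\<close>
    let ?J = "\<lambda>f g t y. indicator R y *\<^sub>R (?jump f t y - tangential_field m (rep_field g y))"
    have J: "(\<integral>\<^sup>+ y\<in>R. ennreal ((norm (?jump f t y - tangential_field m (rep_field g y)))\<^sup>2) \<partial>lborel)
        = sq_norm lborel (?J f g t)" for f :: "real ^ 3 \<Rightarrow> real ^ 3" and g t
      unfolding sq_norm_def by (intro nn_integral_cong) (auto simp: indicator_def)
    have meas: "?J f g t \<in> borel_measurable lborel"
      if "Ck_on 2 f \<Omega>" "\<forall>y\<in>R. fault_point m y + t *\<^sub>R ?n \<in> \<Omega> \<and> fault_point m y - t *\<^sub>R ?n \<in> \<Omega>"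
      for f :: "real ^ 3 \<Rightarrow> real ^ 3" and g t
    proof -
      have [measurable]: "(\<lambda>y. indicator R y *\<^sub>R ?jump f t y) \<in> borel_measurable borel"
        by (intro borel_measurable_continuous_on_indicator cont_offset C2_continuous[OF \<Omega>] that) simp
      have "(\<lambda>y. indicator R y *\<^sub>R ?jump f t y - indicator R y *\<^sub>R tangential_field m (rep_field g y)) \<in> borel_measurable lborel"
        by measurable
      then show ?thesis by (simp add: scaleR_diff_right)
    qed
    have "((\<lambda>t. sq_norm lborel (\<lambda>y. c *\<^sub>R ?J u g t y + ?J v h t y)) \<longlongrightarrow> 0) (at_right 0)"
    proof (rule sq_norm_tendsto_0_lin)
      show "eventually (\<lambda>t. ?J u g t \<in> borel_measurable lborel \<and> ?J v h t \<in> borel_measurable lborel) (at_right 0)"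
        using offset by eventually_elim (intro conjI meas C2)
      show "((\<lambda>t. sq_norm lborel (?J u g t)) \<longlongrightarrow> 0) (at_right 0)" "((\<lambda>t. sq_norm lborel (?J v h t)) \<longlongrightarrow> 0) (at_right 0)"
        using u v unfolding J by auto
    qed
    moreover have "sq_norm lborel (\<lambda>y. c *\<^sub>R ?J u g t y + ?J v h t y) = sq_norm lborel (?J ?w (c *\<^sub>R g + h) t)" for t
    proof (rule sq_norm_cong_AE)
      \<comment> \<open>Representatives of a linear combination of classes agree with the
        combination of representatives only off a null set.\<close>
      show "AE y in lborel. norm (c *\<^sub>R ?J u g t y + ?J v h t y) = norm (?J ?w (c *\<^sub>R g + h) t y)"
        using rep_field_plus[of "c *\<^sub>R g" h] rep_field_scaleR[of c g]
      proof eventually_elim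
        case (elim y)
        have "tangential_field m (rep_field (c *\<^sub>R g + h) y)
            = c *\<^sub>R tangential_field m (rep_field g y) + tangential_field m (rep_field h y)"
          unfolding elim by (rule tangential_field_lin)
        then have "c *\<^sub>R ?J u g t y + ?J v h t y = ?J ?w (c *\<^sub>R g + h) t y"
          by (simp add: algebra_simps)
        then show ?case by (rule arg_cong)
      qed
    qed
    ultimately show ?thesis unfolding J[of ?w] by simp
  qed
  ultimately show ?thesis
    unfolding dislocation_solution_def Let_def \<Omega>_def[symmetric] by simp
qed

section \<open>The posterior density\<close>

lemma H10_energy_eq_inner: "H10_energy R g = H10_inner R g g"
  by (simp add: H10_energy_def H10_inner_def power2_norm_eq_inner)

section \<open>The misfit as a squared Euclidean norm\<close>

lemma norm_vec_prod_power2: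
  fixes z :: "real ^ ('a::finite \<times> 'b::finite)"
  shows "(norm z)\<^sup>2 = (\<Sum>j\<in>UNIV. (norm (\<chi> i. z $ (j, i)))\<^sup>2)"
proof -
  have "(norm z)\<^sup>2 = (\<Sum>k\<in>UNIV \<times> UNIV. (z $ k)\<^sup>2)"
    unfolding power2_norm_eq_inner inner_vec_def by (simp add: power2_eq_square)
  also have "\<dots> = (\<Sum>j\<in>UNIV. \<Sum>i\<in>UNIV. (z $ (j, i))\<^sup>2)"
    by (simp add: sum.cartesian_product case_prod_unfold)
  finally show ?thesis
    unfolding power2_norm_eq_inner inner_vec_def by (simp add: power2_eq_square)
qed

lemma weight_matrix_mult_nth:
  "(weight_matrix P w Cov *v z) $ k
     = sqrt (w (fst k)) * (diagonal_inv_sqrt (Cov (P (fst k))) *v (\<chi> i. z $ (fst k, i))) $ snd k"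
proof -
  have "(weight_matrix P w Cov *v z) $ k = (\<Sum>l\<in>UNIV \<times> UNIV. weight_matrix P w Cov $ k $ l * z $ l)"
    by (simp add: matrix_vector_mult_def)
  also have "\<dots> = (\<Sum>j\<in>UNIV. \<Sum>i\<in>UNIV. weight_matrix P w Cov $ k $ (j, i) * z $ (j, i))"
    by (simp only: sum.cartesian_product case_prod_unfold prod.collapse)
  also have "\<dots> = (\<Sum>i\<in>UNIV. sqrt (w (fst k)) * diagonal_inv_sqrt (Cov (P (fst k))) $ snd k $ i * z $ (fst k, i))"
    by (subst sum.mono_neutral_right[of UNIV "{fst k}"]) (auto simp: weight_matrix_def)
  finally show ?thesis
    by (simp add: matrix_vector_mult_def sum_distrib_left mult.assoc)
qed

lemma transpose_weight_matrix: "transpose (weight_matrix P w Cov) = weight_matrix P w Cov"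
  by (auto simp: transpose_def weight_matrix_def diagonal_inv_sqrt_def Finite_Cartesian_Product.vec_eq_iff)

text \<open>The weight matrix is block diagonal, so the norm on the product index splits over the
  measurement points; nonnegative weights make \<open>(sqrt (w j))^2\<close> equal to
  \<open>w j\<close>.\<close>

lemma weighted_misfit_eq:
  assumes "\<And>j. w j > 0"
  shows "weighted_misfit A P w Cov u g
    = (norm (weight_matrix P w Cov *v (point_values A P g - (\<chi> k. u (P (fst k)) $ snd k))))\<^sup>2"
proof -
  have "(\<chi> i. (weight_matrix P w Cov *v (point_values A P g - (\<chi> k. u (P (fst k)) $ snd k))) $ (j, i))
      = sqrt (w j) *\<^sub>R (diagonal_inv_sqrt (Cov (P j)) *v (A g (P j) - u (P j)))" for j
  proof -
    have "(\<chi> i. (point_values A P g - (\<chi> k. u (P (fst k)) $ snd k)) $ (j, i)) = A g (P j) - u (P j)"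
      by (simp add: point_values_def Finite_Cartesian_Product.vec_eq_iff)
    then show ?thesis
      unfolding weight_matrix_mult_nth Finite_Cartesian_Product.vec_eq_iff
      by (simp del: vector_minus_component)
  qed
  then show ?thesis
    using assms[THEN less_imp_le]
    by (simp add: norm_vec_prod_power2 weighted_misfit_def power_mult_distrib)
qed

text \<open>One geometry is fixed and \<open>A\<close> is its operator. Linearity is assumed only at
  the points \<open>P j\<close>, since \<open>slip_to_displacement\<close> is meaningful on the
  plane alone.\<close>

context
  fixes R :: "(real ^ 2) set" and F :: "plane_field set" and A :: "plane_field \<Rightarrow> real ^ 3 \<Rightarrow> real ^ 3"
    and P :: "'N::finite \<Rightarrow> real ^ 3" and w :: "'N \<Rightarrow> real" and Cov :: "real ^ 3 \<Rightarrow> real ^ 3 ^ 3"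
    and u_meas :: "real ^ 3 \<Rightarrow> real ^ 3" and C :: real
  assumes H10: "inner_product_on F (H10_inner R)"
    and A_add: "\<And>f g j. f \<in> F \<Longrightarrow> g \<in> F \<Longrightarrow> A (f + g) (P j) = A f (P j) + A g (P j)"
    and A_scale: "\<And>c f j. f \<in> F \<Longrightarrow> A (c *\<^sub>R f) (P j) = c *\<^sub>R A f (P j)"
    and C: "C > 0" and w: "\<And>j. w j > 0"
begin

definition posterior_form :: "plane_field \<Rightarrow> plane_field \<Rightarrow> real" where
  "posterior_form f g = (weight_matrix P w Cov *v point_values A P f) \<bullet> (weight_matrix P w Cov *v point_values A P g)
     + C * H10_inner R f g"

interpretation H: inner_product_on F "H10_inner R" by (rule H10)

lemma point_values_add: "f \<in> F \<Longrightarrow> g \<in> F \<Longrightarrow> point_values A P (f + g) = point_values A P f + point_values A P g"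
  by (simp add: point_values_def A_add Finite_Cartesian_Product.vec_eq_iff)

lemma point_values_scale: "f \<in> F \<Longrightarrow> point_values A P (c *\<^sub>R f) = c *\<^sub>R point_values A P f"
  by (simp add: point_values_def A_scale Finite_Cartesian_Product.vec_eq_iff)

text \<open>Definiteness comes from the regularizing term: the misfit part is only nonnegative. The
  locale now yields the Gaussian integral and the representers for this form as well.\<close>

lemma inner_product_on_posterior_form: "inner_product_on F posterior_form"
proof
  fix f g h :: plane_field and c :: real
  show "posterior_form (f + g) h = posterior_form f h + posterior_form g h" if "f \<in> F" "g \<in> F" "h \<in> F"
    using that by (simp add: posterior_form_def point_values_add H.add_left
        matrix_vector_right_distrib inner_add_left algebra_simps)
  show "posterior_form (c *\<^sub>R f) h = c * posterior_form f h" if "f \<in> F" "h \<in> F"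
    using that by (simp add: posterior_form_def point_values_scale H.scale_left
        matrix_vector_mult_scaleR algebra_simps)
  show "posterior_form f g = posterior_form g f" if "f \<in> F" "g \<in> F"
    using that by (simp add: posterior_form_def H.sym inner_commute)
  show "posterior_form f f > 0" if "f \<in> F" "f \<noteq> 0"
    unfolding posterior_form_def using H.pos[OF that] C by (intro add_nonneg_pos) auto
qed (use H.subspace H.finite_dim in auto)

interpretation B: inner_product_on F posterior_form by (rule inner_product_on_posterior_form)

text \<open>The centre \<open>h\<close> is the representer, for \<open>posterior_form\<close>, of
  the linear part of the functional, so that the linear terms cancel. Expanding at
  \<open>g = (g - h) + h\<close> leaves a pure square.\<close>

lemma F_disc_complete_square:
  obtains h where "h \<in> F"
    "\<And>g. g \<in> F \<Longrightarrow> F_disc R A P w Cov u_meas C g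
        = F_disc R A P w Cov u_meas C h + posterior_form (g - h) (g - h)"
proof -
  let ?D = "weight_matrix P w Cov" and ?U = "(\<chi> k. u_meas (P (fst k)) $ snd k)"
  let ?L = "\<lambda>g. ?D *v point_values A P g"
  have F_eq: "F_disc R A P w Cov u_meas C g = posterior_form g g - 2 * (?L g \<bullet> (?D *v ?U)) + (?D *v ?U) \<bullet> (?D *v ?U)" for g
    unfolding F_disc_def weighted_misfit_eq[OF w] H10_energy_eq_inner posterior_form_def
    unfolding power2_norm_eq_inner matrix_vector_mult_diff_distrib inner_diff_left inner_diff_right
    by (simp add: inner_commute[of "?D *v ?U" "?L g"])
  have "\<exists>!h. h \<in> F \<and> (\<forall>f\<in>F. posterior_form f h = ?L f \<bullet> (?D *v ?U))"
    by (rule B.exists_representer)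
       (simp_all add: point_values_add point_values_scale matrix_vector_right_distrib
         matrix_vector_mult_scaleR inner_add_left)
  then obtain h where h: "h \<in> F" "\<And>f. f \<in> F \<Longrightarrow> posterior_form f h = ?L f \<bullet> (?D *v ?U)" by blast
  show thesis
  proof (rule that[OF h(1)])
    fix g assume g: "g \<in> F"
    have d: "g - h \<in> F" using H.subspace g h(1) by (rule subspace_diff)
    have "posterior_form g g = posterior_form ((g - h) + h) ((g - h) + h)" by simp
    also have "\<dots> = posterior_form (g - h) (g - h) + 2 * posterior_form (g - h) h + posterior_form h h"
      using d h(1) g B.add_left[of "g - h" h "(g - h) + h"] B.add_left[of "g - h" h "g - h"] B.add_left[of "g - h" h h]
        B.sym[of "g - h" "(g - h) + h"] B.sym[of h "(g - h) + h"] B.sym[of h "g - h"] by simp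
    finally have "posterior_form g g = posterior_form (g - h) (g - h) + 2 * posterior_form (g - h) h + posterior_form h h" .
    moreover have "posterior_form (g - h) h + posterior_form h h = posterior_form g h"
      using B.add_left[of "g - h" h h] d h(1) by simp
    ultimately show "F_disc R A P w Cov u_meas C g
        = F_disc R A P w Cov u_meas C h + posterior_form (g - h) (g - h)"
      using h(2)[OF g] h(2)[OF h(1)] unfolding F_eq by simp
  qed
qed

text \<open>\<open>adjoint_on\<close> is a definite description, so its defining property becomes
  available only once a unique representer exists. As the weight matrix is its own transpose, one
  factor of \<open>?D ** ?D\<close> moves to the other side of the inner product.\<close>

lemma posterior_operator_form:
  assumes f: "f \<in> F" and g: "g \<in> F"
  shows "posterior_operator R F A P w Cov C g \<in> F"
    and "2 * pi * H10_inner R f (posterior_operator R F A P w Cov C g) = posterior_form f g"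
proof -
  let ?D = "weight_matrix P w Cov"
  let ?v = "(?D ** ?D) *v point_values A P g"
  let ?a = "adjoint_on F (H10_inner R) (point_values A P) ?v"
  have "\<exists>!a. a \<in> F \<and> (\<forall>f\<in>F. H10_inner R f a = point_values A P f \<bullet> ?v)"
    by (rule H.exists_representer)
       (simp_all add: point_values_add point_values_scale inner_add_left)
  then have "?a \<in> F \<and> (\<forall>f\<in>F. H10_inner R f ?a = point_values A P f \<bullet> ?v)"
    unfolding adjoint_on_def by (rule theI')
  then have a: "?a \<in> F" "\<And>f. f \<in> F \<Longrightarrow> H10_inner R f ?a = point_values A P f \<bullet> ?v" by auto
  have T: "posterior_operator R F A P w Cov C g = (1 / (2 * pi)) *\<^sub>R (?a + C *\<^sub>R g)"
    by (simp add: posterior_operator_def Let_def)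
  have s: "?a + C *\<^sub>R g \<in> F" "C *\<^sub>R g \<in> F"
    using a(1) g H.subspace by (auto intro: subspace_add subspace_scale)
  then show TF: "posterior_operator R F A P w Cov C g \<in> F"
    unfolding T by (intro subspace_scale H.subspace)
  have "H10_inner R f (posterior_operator R F A P w Cov C g) = H10_inner R (posterior_operator R F A P w Cov C g) f"
    by (rule H.sym[OF f TF])
  also have "\<dots> = (1 / (2 * pi)) * (H10_inner R ?a f + C * H10_inner R g f)"
    unfolding T using a(1) g f s by (simp only: H.scale_left H.add_left)
  also have "\<dots> = (1 / (2 * pi)) * (point_values A P f \<bullet> ?v + C * H10_inner R f g)"
    using a f g H.sym[of ?a f] H.sym[of g f] by simp
  also have "point_values A P f \<bullet> ?v = (?D *v point_values A P f) \<bullet> (?D *v point_values A P g)"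
    using transpose_matrix_vector[of ?D "point_values A P f"]
    by (simp add: matrix_vector_mul_assoc[symmetric] dot_lmul_matrix[symmetric] transpose_weight_matrix)
  finally show "2 * pi * H10_inner R f (posterior_operator R F A P w Cov C g) = posterior_form f g"
    by (simp add: posterior_form_def)
qed

lemma integral_exp_F_disc:
  "(LINT g|lebesgue_on_subspace F. exp (- (1 / 2) * F_disc R A P w Cov u_meas C g))
     = (1 / sqrt (fun_det (dim F) H.gram))
       * (exp (- (1 / 2) * F_disc R A P w Cov u_meas C (h_disc R F A P w Cov u_meas C))
          / sqrt (operator_det F (posterior_operator R F A P w Cov C)))"
proof -
  let ?\<Phi> = "F_disc R A P w Cov u_meas C"
  let ?T = "posterior_operator R F A P w Cov C"
  let ?h' = "h_disc R F A P w Cov u_meas C"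
  obtain h where h: "h \<in> F" "\<And>g. g \<in> F \<Longrightarrow> ?\<Phi> g = ?\<Phi> h + posterior_form (g - h) (g - h)"
    using F_disc_complete_square that by blast
  have nonneg: "posterior_form f f \<ge> 0" if "f \<in> F" for f
    using B.pos[OF that] B.scale_left[of f f 0] that by (cases "f = 0") auto
  have "?\<Phi> h \<le> ?\<Phi> g" if "g \<in> F" for g
    using h(2)[OF that] nonneg[OF subspace_diff[OF H.subspace that h(1)]] by simp
  \<comment> \<open>\<open>h_disc\<close> is a chosen minimizer, which means something once one
    exists; only the equality of the two minimal values is used.\<close>
  then have "is_arg_min ?\<Phi> (\<lambda>x. x \<in> F) h"
    using h(1) by (simp add: is_arg_min_linorder)
  then have "is_arg_min ?\<Phi> (\<lambda>x. x \<in> F) ?h'"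
    unfolding h_disc_def arg_min_on_def arg_min_def by (rule someI)
  then have min: "?\<Phi> ?h' = ?\<Phi> h"
    using \<open>is_arg_min ?\<Phi> (\<lambda>x. x \<in> F) h\<close> by (auto simp: is_arg_min_linorder intro: order_antisym)
  have space: "g \<in> F" if "g \<in> space (lebesgue_on_subspace F)" for g
    using that H.coords_sum_in unfolding lebesgue_on_subspace_def space_embed_measure coords_sum_def by auto
  have "(LINT g|lebesgue_on_subspace F. exp (- (1 / 2) * ?\<Phi> g))
      = (LINT g|lebesgue_on_subspace F. exp (- (1 / 2) * ?\<Phi> h) * exp (- (1 / 2) * posterior_form (g - h) (g - h)))"
    using h(2) space by (intro Bochner_Integration.integral_cong refl) (simp add: exp_add[symmetric] algebra_simps)
  also have "\<dots> = exp (- (1 / 2) * ?\<Phi> h) * sqrt ((2 * pi) ^ dim F / fun_det (dim F) B.gram)"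
    by (subst integral_mult_right_zero) (simp only: B.integral_gaussian_subspace[OF h(1)])
  \<comment> \<open>The power of \<open>2 * pi\<close> that appears here cancels the one in the
    Gaussian integral.\<close>
  also have "fun_det (dim F) B.gram = (2 * pi) ^ dim F * fun_det (dim F) H.gram * operator_det F ?T"
  proof -
    have "Matrix.mat (dim F) (dim F) (\<lambda>(i, j). B.gram i j)
        = Matrix.mat (dim F) (dim F) (\<lambda>(i, j). posterior_form (subspace_basis F i) (subspace_basis F j))"
      by (rule cong_mat) (auto simp: B.gram_def)
    then show ?thesis
      using H.fun_det_gram_operator[of ?T "2 * pi" posterior_form] posterior_operator_form by simp
  qed
  finally show ?thesis
    unfolding min by (simp add: real_sqrt_divide real_sqrt_mult)
qed

end

text \<open>\<open>slip_to_displacement\<close> is a restriction to the plane, so the measurement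
  points, taken in the closure of \<open>V\<close>, must be shown to lie on it.\<close>

lemma surface_plane_closure:
  assumes "openin (top_of_set surface_plane) V" "x \<in> closure V"
  shows "x \<in> surface_plane"
proof -
  have "closed surface_plane"
    unfolding surface_plane_def by (intro closed_Collect_eq continuous_intros)
  moreover have "V \<subseteq> surface_plane"
    using assms(1) openin_imp_subset by blast
  ultimately show ?thesis
    using assms(2) closure_minimal by blast
qed

lemma slip_to_displacement_lin:
  assumes R: "compact R" and fault: "fault m R \<subseteq> lower_halfspace"
    and unique: "\<And>g. g \<in> F \<Longrightarrow> \<exists>!u. dislocation_solution lam mu R m g u"
    and F: "subspace F" and g: "g \<in> F" and h: "h \<in> F" and x: "x \<in> surface_plane"
  shows "slip_to_displacement lam mu R m (c *\<^sub>R g + h) x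
       = c *\<^sub>R slip_to_displacement lam mu R m g x + slip_to_displacement lam mu R m h x"
proof -
  let ?u = "\<lambda>g. THE u. dislocation_solution lam mu R m g u"
  have sol: "dislocation_solution lam mu R m g (?u g)" if "g \<in> F" for g
    using unique[OF that] by (rule theI')
  have "c *\<^sub>R g + h \<in> F"
    using F g h by (intro subspace_add subspace_scale)
  then have "?u (c *\<^sub>R g + h) = (\<lambda>x. c *\<^sub>R ?u g x + ?u h x)"
    by (intro the1_equality unique dislocation_solution_superposition R fault sol g h)
  then show ?thesis
    using x by (simp add: slip_to_displacement_def)
qed

text \<open>Each proportionality on \<open>B\<close> times \<open>F\<close> has one constant for all
  pairs, so it leaves the integral over \<open>F\<close> without a trace of \<open>m\<close>.
  Well-posedness of the elasticity problem enters as a hypothesis for slips in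
  \<open>H10 R\<close>.\<close>

theorem proposition5p1:
  fixes lam mu C :: real
    and R :: "(real ^ 2) set"
    and B V :: "(real ^ 3) set"
    and P :: "'N::finite \<Rightarrow> real ^ 3"
    and w :: "'N \<Rightarrow> real"
    and Cov :: "real ^ 3 \<Rightarrow> real ^ 3 ^ 3"
    and F :: "plane_field set"
    and u_meas :: "real ^ 3 \<Rightarrow> real ^ 3"
    and \<rho>_post \<rho>_like :: "real ^ 3 \<Rightarrow> plane_field \<Rightarrow> real"
    and \<rho>_F :: "plane_field \<Rightarrow> real"
    and \<rho>_prior :: "real ^ 3 \<Rightarrow> real"
  defines "A \<equiv> slip_to_displacement lam mu R"
  assumes "lam > 0" and "mu > 0" and "C > 0"
    and "closed_rectangle R"
    and "closed B" and "bounded B"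
    and "\<And>m. m \<in> B \<Longrightarrow> fault m R \<subseteq> lower_halfspace"
    and well_posed: "\<And>m g. m \<in> B \<Longrightarrow> g \<in> H10 R \<Longrightarrow> \<exists>!u. dislocation_solution lam mu R m g u"
    and "bounded V" and "openin (top_of_set surface_plane) V"
    and "\<And>j. P j \<in> closure V"
    and "\<And>j. w j > 0"
    and "\<And>x. x \<in> closure V \<Longrightarrow> diagonal_pos_def (Cov x)"
    and "smooth_on_set Cov (closure V)"
    and "subspace F" and "F \<subseteq> H10 R" and "\<exists>S. finite S \<and> span S = F"
    and "proportional_on UNIV \<rho>_prior (indicator B)"
    and "proportional_on (B \<times> F) (\<lambda>(m, g). \<rho>_like m g)
           (\<lambda>(m, g). exp (- (1 / 2) * weighted_misfit (A m) P w Cov u_meas g))"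
    and "proportional_on F \<rho>_F (\<lambda>g. exp (- (1 / 2) * (C * H10_energy R g)))"
    and "proportional_on (B \<times> F) (\<lambda>(m, g). \<rho>_post m g)
           (\<lambda>(m, g). \<rho>_like m g * \<rho>_F g * \<rho>_prior m)"
  shows "proportional_on B (\<lambda>m. LINT g|lebesgue_on_subspace F. \<rho>_post m g)
           (\<lambda>m. exp (- (1 / 2) * F_disc R (A m) P w Cov u_meas C (h_disc R F (A m) P w Cov u_meas C))
                * \<rho>_prior m / sqrt (operator_det F (posterior_operator R F (A m) P w Cov C)))"
proof -
  note R = compact_closed_rectangle[OF \<open>closed_rectangle R\<close>]
  have H10: "inner_product_on F (H10_inner R)"
    by (rule inner_product_on_H10_inner[OF R]) (use assms in auto)
  interpret H: inner_product_on F "H10_inner R" by (rule H10)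
  obtain k1 where k1: "k1 > 0"
    "\<And>m g. m \<in> B \<Longrightarrow> g \<in> F \<Longrightarrow> \<rho>_like m g = k1 * exp (- (1 / 2) * weighted_misfit (A m) P w Cov u_meas g)"
    using \<open>proportional_on (B \<times> F) (\<lambda>(m, g). \<rho>_like m g) _\<close> unfolding proportional_on_def by auto
  obtain k2 where k2: "k2 > 0" "\<And>g. g \<in> F \<Longrightarrow> \<rho>_F g = k2 * exp (- (1 / 2) * (C * H10_energy R g))"
    using \<open>proportional_on F \<rho>_F _\<close> unfolding proportional_on_def by auto
  obtain k3 where k3: "k3 > 0"
    "\<And>m g. m \<in> B \<Longrightarrow> g \<in> F \<Longrightarrow> \<rho>_post m g = k3 * (\<rho>_like m g * \<rho>_F g * \<rho>_prior m)"
    using \<open>proportional_on (B \<times> F) (\<lambda>(m, g). \<rho>_post m g) _\<close> unfolding proportional_on_def by auto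
  let ?d = "fun_det (dim F) H.gram"
  \<comment> \<open>The constant collects the three proportionality constants and the Gram
    determinant of \<open>H10_inner R\<close>, none of which involves \<open>m\<close>; the prior is
    carried along as a factor.\<close>
  have post: "(LINT g|lebesgue_on_subspace F. \<rho>_post m g) = (k1 * k2 * k3 / sqrt ?d)
      * (exp (- (1 / 2) * F_disc R (A m) P w Cov u_meas C (h_disc R F (A m) P w Cov u_meas C))
                * \<rho>_prior m / sqrt (operator_det F (posterior_operator R F (A m) P w Cov C)))"
    if m: "m \<in> B" for m
  proof -
    have lin: "A m (c *\<^sub>R g + h) (P j) = c *\<^sub>R A m g (P j) + A m h (P j)" if "g \<in> F" "h \<in> F" for c g h j
      unfolding A_def
    proof (rule slip_to_displacement_lin[OF R assms(8)[OF m] _ \<open>subspace F\<close> that])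
      show "\<exists>!u. dislocation_solution lam mu R m g u" if "g \<in> F" for g
        using that \<open>F \<subseteq> H10 R\<close> by (intro well_posed[OF m]) auto
      show "P j \<in> surface_plane"
        by (rule surface_plane_closure[of V]) fact+
    qed
    have add: "A m (g + h) (P j) = A m g (P j) + A m h (P j)" if "g \<in> F" "h \<in> F" for g h j
      using lin[OF that, of 1 j] by simp
    have scale: "A m (c *\<^sub>R g) (P j) = c *\<^sub>R A m g (P j)" if "g \<in> F" for c g j
    proof -
      \<comment> \<open>With \<open>c = -1\<close> and both fields equal to \<open>g\<close> the
        combination is 0; scaling is then the case of a zero second field.\<close>
      have "A m 0 (P j) = 0" using lin[OF that that, of "-1" j] by simp
      then show ?thesis using lin[OF that H.subspace[THEN subspace_0], of c j] by simp
    qed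
    have "(LINT g|lebesgue_on_subspace F. \<rho>_post m g)
        = (LINT g|lebesgue_on_subspace F. (k1 * k2 * k3 * \<rho>_prior m) * exp (- (1 / 2) * F_disc R (A m) P w Cov u_meas C g))"
    proof (intro Bochner_Integration.integral_cong refl)
      fix g assume "g \<in> space (lebesgue_on_subspace F)"
      then have g: "g \<in> F"
        using H.coords_sum_in unfolding lebesgue_on_subspace_def space_embed_measure coords_sum_def by auto
      have "exp (- (1 / 2) * F_disc R (A m) P w Cov u_meas C g)
          = exp (- (1 / 2) * weighted_misfit (A m) P w Cov u_meas g) * exp (- (1 / 2) * (C * H10_energy R g))"
        unfolding F_disc_def distrib_left exp_add ..
      then show "\<rho>_post m g = (k1 * k2 * k3 * \<rho>_prior m) * exp (- (1 / 2) * F_disc R (A m) P w Cov u_meas C g)"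
        using k1(2)[OF m g] k2(2)[OF g] k3(2)[OF m g] by simp
    qed
    also have "\<dots> = (k1 * k2 * k3 * \<rho>_prior m) * (LINT g|lebesgue_on_subspace F. exp (- (1 / 2) * F_disc R (A m) P w Cov u_meas C g))"
      by (rule integral_mult_right_zero)
    also have "(LINT g|lebesgue_on_subspace F. exp (- (1 / 2) * F_disc R (A m) P w Cov u_meas C g))
        = (1 / sqrt ?d) * (exp (- (1 / 2) * F_disc R (A m) P w Cov u_meas C (h_disc R F (A m) P w Cov u_meas C))
          / sqrt (operator_det F (posterior_operator R F (A m) P w Cov C)))"
      using H10 add scale \<open>C > 0\<close> \<open>\<And>j. w j > 0\<close> by (rule integral_exp_F_disc)
    finally show ?thesis by simp
  qed
  show ?thesis
    unfolding proportional_on_def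
    using k1(1) k2(1) k3(1) H.gram_gaussian(1) post
    by (intro exI[of _ "k1 * k2 * k3 / sqrt ?d"]) simp
qed

end
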